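(* Let $\mathbb{K}$ be an algebraically closed field, $k\ge0$, and let $\mathsf{A}_k$ be one of the planar diagram algebras $\mathsf{TL}_k(x)$, $\mathsf{M}_k(x)$, $\mathsf{PR}_k$, with $0\ne x\in\mathbb{K}$ chosen such that $\mathsf{A}_k$ is semisimple ($x=1$ for $\mathsf{PR}_k$). Then for each $0\le r\le k$ (with $r\equiv k\pmod 2$ if $\mathsf{A}_k=\mathsf{TL}_k(x)$), the $\mathsf{A}_k$-module $\mathsf{M}_{\mathsf{A}_k}^r\cong\mathsf{A}_k^{(r)}$ is irreducible, and thus $$\mathsf{M}_{\mathsf{A}_k}=\bigoplus_{r=0}^k\mathsf{M}_{\mathsf{A}_k}^r$$ is a decomposition into irreducible $\mathsf{A}_k$-modules (where, for $\mathsf{TL}_k(x)$, the summands with $r\not\equiv k\pmod 2$ are zero).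
   Context: **Diagrams.** Let $\mathcal{P}_k$ be the set of set partitions ("diagrams") of $\{1,\dots,k,1',\dots,k'\}$, drawn as graphs with top row $1,\dots,k$, bottom row $1',\dots,k'$ and connected components equal to the blocks. For $d_1,d_2\in\mathcal{P}_k$, stack $d_1$ above $d_2$, identifying $j'$ of $d_1$ with $j$ of $d_2$; delete the connected components lying entirely in the middle row; the resulting set partition of the top row of $d_1$ and bottom row of $d_2$ is $d_1\circ d_2$, and $\kappa(d_1,d_2)$ is the number of deleted components. The product of diagrams is $d_1d_2=x^{\kappa(d_1,d_2)}d_1\circ d_2$. A block is propagating if it meets both rows; $\mathrm{rank}(d)$ is the number of propagating blocks. A diagram is planar if it can be drawn without edge crossings inside the rectangle formed by its vertices. The identity $\mathbf{1}_k$ has blocks $\{i,i'\}$. **Algebras.** $\mathsf{A}_k$ is the algebra with basis the set $\mathcal{A}_k$ of planar diagrams such that: all blocks have size 2 (Temperley-Lieb algebra $\mathsf{TL}_k(x)$); all blocks have size 1 or 2 (Motzkin algebra $\mathsf{M}_k(x)$); each block has at most one vertex in the top row and at most one in the bottom row, with $x=1$ (planar rook monoid algebra $\mathsf{PR}_k$). $\mathsf{A}_0=\mathbb{K}$. $\mathsf{A}_{k-1}\subseteq\mathsf{A}_k$ by adding a block $\{k,k'\}$ on the right of each diagram. **The module.** $d^T$ is obtained from $d$ by exchanging $i\leftrightarrow i'$; $t$ is symmetric if $t^T=t$; a block is fixed if it is mapped to itself under $i\leftrightarrow i'$. $\mathsf{M}_{\mathsf{A}_k}^r$ is the $\mathbb{K}$-vector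 space with basis the symmetric diagrams in $\mathcal{A}_k$ of rank $r$, and $\mathsf{M}_{\mathsf{A}_k}=\bigoplus_{r=0}^k\mathsf{M}_{\mathsf{A}_k}^r$. For $d\in\mathcal{A}_k$ and $t$ symmetric, the signed conjugation action is $d\cdot t=x^{\kappa(d,t)}S(d,t)\,d\circ t\circ d^T$ if $\mathrm{rank}(d\circ t\circ d^T)=\mathrm{rank}(t)$, and $d\cdot t=0$ if $\mathrm{rank}(d\circ t\circ d^T)<\mathrm{rank}(t)$, extended linearly. Here $S(d,t)$ is the sign of the permutation of the fixed blocks of $t$ induced by conjugation: when ranks agree, each fixed block of $d\circ t\circ d^T$ comes from exactly one fixed block of $t$ in the stacked diagram, and $S(d,t)$ is the sign of this bijection when the fixed blocks of each diagram are ordered by leftmost vertex. **Labels.** The irreducible $\mathsf{A}_k$-modules are $\mathsf{A}_k^{(r)}$, $0\le r\le k$ (only $r\equiv k$ mod 2 for $\mathsf{TL}_k(x)$), determined recursively. Set $p=k-2$ for $\mathsf{TL}_k(x)$ and $p=k-1$ otherwise. Let $\mathsf{e}_k=\frac1xE_k$, where $E_k$ has blocks $\{i,i'\}$ for $i\le p$ and, if $p=k-1$, the top vertex $k$ and the bottom vertex below it are isolated; if $p=k-2$ (so $k\ge2$), top vertices $k-1,k$ form a block and the two bottom vertices below them form a block. Then $a\mapsto a\mathsf{e}_k$ is an isomorphism $\mathsf{A}_p\cong\mathsf{e}_k\mathsf{A}_k\mathsf{e}_k$. $\mathsf{A}_k^{(k)}$ is the one-dimensional module on which all diagrams of rank less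 than $k$ act as $0$ (and $\mathbf{1}_k$ acts as the identity); for $r<k$, $\mathsf{A}_k^{(r)}$ is the irreducible module with $\mathsf{e}_k\mathsf{A}_k^{(r)}\cong\mathsf{A}_p^{(r)}$ as a module for $\mathsf{A}_p\cong\mathsf{e}_k\mathsf{A}_k\mathsf{e}_k$. *)

theory Defs
  imports
    "HOL-Analysis.Analysis"
    "HOL-Library.Disjoint_Sets"
    "HOL-Library.Poly_Mapping"
    "HOL-Combinatorics.Permutations"
    "HOL-Computational_Algebra.Polynomial"
begin

section \<open>Diagrams\<close>

text \<open>The vertex \<open>i\<close> of the top row is \<open>(0, i)\<close>, the vertex \<open>i'\<close> of the bottom row is
  \<open>(1, i)\<close>. When diagrams are stacked there are further rows \<open>2, 3, \<dots>\<close> below.\<close>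

type_synonym vertex = "nat \<times> nat"
type_synonym diagram = "vertex set set"

definition verts :: "nat \<Rightarrow> vertex set" where
  "verts k = {0, 1} \<times> {1..k}"

definition diagrams :: "nat \<Rightarrow> diagram set" where
  "diagrams k = {d. partition_on (verts k) d}"

definition components :: "'v set \<Rightarrow> ('v \<times> 'v) set \<Rightarrow> 'v set set" where
  "components V R = V // R\<^sup>*"

definition propagating :: "vertex set \<Rightarrow> bool" where
  "propagating b \<longleftrightarrow> 0 \<in> fst ` b \<and> 1 \<in> fst ` b"

definition diagram_rank :: "diagram \<Rightarrow> nat" where
  "diagram_rank d = card {b \<in> d. propagating b}"

definition id_diagram :: "nat \<Rightarrow> diagram" where
  "id_diagram k = {{(0, i), (1, i)} | i. i \<in> {1..k}}"

definition flip :: "vertex \<Rightarrow> vertex" where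
  "flip = (\<lambda>(s, i). (1 - s, i))"

definition flip_diagram :: "diagram \<Rightarrow> diagram" where
  "flip_diagram d = (\<lambda>b. flip ` b) ` d"

definition symmetric_diagram :: "diagram \<Rightarrow> bool" where
  "symmetric_diagram t \<longleftrightarrow> flip_diagram t = t"

definition fixed_blocks :: "diagram \<Rightarrow> vertex set set" where
  "fixed_blocks t = {b \<in> t. flip ` b = b}"

definition position :: "vertex \<Rightarrow> real \<times> real" where
  "position = (\<lambda>(s, i). (real i, 1 - real s))"

text \<open>A drawing of \<open>d\<close> consists of a graph on the vertices whose connected components are the
  blocks and of an arc in the rectangle for each edge; an arc meets vertices only at its ends, and
  two arcs meet only in common ends.\<close>

definition planar :: "nat \<Rightarrow> diagram \<Rightarrow> bool" where
  "planar k d \<longleftrightarrow> (\<exists>(E :: vertex set set) (\<gamma> :: vertex set \<Rightarrow> real \<Rightarrow> real \<times> real).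
     (\<forall>e\<in>E. e \<subseteq> verts k \<and> card e = 2) \<and>
     components (verts k) {(u, v). {u, v} \<in> E} = d \<and>
     (\<forall>e\<in>E. arc (\<gamma> e) \<and> {pathstart (\<gamma> e), pathfinish (\<gamma> e)} = position ` e \<and>
        path_image (\<gamma> e) \<subseteq> cbox (1, 0) (real k, 1) \<and>
        path_image (\<gamma> e) \<inter> position ` verts k = position ` e) \<and>
     (\<forall>e\<in>E. \<forall>f\<in>E. e \<noteq> f \<longrightarrow> path_image (\<gamma> e) \<inter> path_image (\<gamma> f) \<subseteq> position ` (e \<inter> f)))"

subsection \<open>Stacking\<close>

text \<open>The diagrams \<open>ds ! 0, ds ! 1, \<dots>\<close> are stacked from top to bottom, \<open>ds ! m\<close> occupying the
  rows \<open>m\<close> and \<open>m + 1\<close>.\<close>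

definition shift :: "nat \<Rightarrow> vertex \<Rightarrow> vertex" where
  "shift m = (\<lambda>(s, i). (m + s, i))"

definition stack_rel :: "diagram list \<Rightarrow> (vertex \<times> vertex) set" where
  "stack_rel ds = {(u, v). \<exists>m < length ds. \<exists>b \<in> ds ! m. u \<in> shift m ` b \<and> v \<in> shift m ` b}"

definition stack_components :: "nat \<Rightarrow> diagram list \<Rightarrow> vertex set set" where
  "stack_components k ds = components ({..length ds} \<times> {1..k}) (stack_rel ds)"

text \<open>The part of \<open>c\<close> in the outer rows \<open>0\<close> and \<open>n\<close> of a stack of \<open>n \<ge> 1\<close> diagrams, with row \<open>n\<close>
  becoming the bottom row.\<close>

definition outer :: "nat \<Rightarrow> vertex set \<Rightarrow> vertex set" where
  "outer n c = (\<lambda>(m, i). (if m = 0 then 0 else 1, i)) ` (c \<inter> {0, n} \<times> UNIV)"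

definition compose_diagram :: "nat \<Rightarrow> diagram \<Rightarrow> diagram \<Rightarrow> diagram" where
  "compose_diagram k d1 d2 = {outer 2 c | c. c \<in> stack_components k [d1, d2] \<and> \<not> c \<subseteq> {1} \<times> UNIV}"

definition kappa :: "nat \<Rightarrow> diagram \<Rightarrow> diagram \<Rightarrow> nat" where
  "kappa k d1 d2 = card {c \<in> stack_components k [d1, d2]. c \<subseteq> {1} \<times> UNIV}"

subsection \<open>Conjugation and its sign\<close>

definition conjugate :: "nat \<Rightarrow> diagram \<Rightarrow> diagram \<Rightarrow> diagram" where
  "conjugate k d t = compose_diagram k (compose_diagram k d t) (flip_diagram d)"

text \<open>The block of the conjugate of \<open>t\<close> that comes from the block \<open>b\<close> of \<open>t\<close>: the outer part of
  the component containing \<open>b\<close> in the stack of \<open>d\<close>, \<open>t\<close> and the flipped \<open>d\<close>.\<close>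

definition conj_block :: "diagram \<Rightarrow> diagram \<Rightarrow> vertex set \<Rightarrow> vertex set" where
  "conj_block d t b = outer 3 ((stack_rel [d, t, flip_diagram d])\<^sup>* `` (shift 1 ` b))"

definition fixed_list :: "diagram \<Rightarrow> vertex set list" where
  "fixed_list t = sorted_key_list_of_set (\<lambda>b. Min (snd ` b)) (fixed_blocks t)"

text \<open>The bijection of fixed blocks induced by conjugation, as a permutation of the positions in
  the left-to-right orders. It is meaningful only if the ranks of \<open>t\<close> and its conjugate agree.\<close>

definition conj_perm :: "nat \<Rightarrow> diagram \<Rightarrow> diagram \<Rightarrow> nat \<Rightarrow> nat" where
  "conj_perm k d t i =
     (if i < length (fixed_list t)
      then THE j. j < length (fixed_list (conjugate k d t)) \<and>
             fixed_list (conjugate k d t) ! j = conj_block d t (fixed_list t ! i)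
      else i)"

definition conj_sign :: "nat \<Rightarrow> diagram \<Rightarrow> diagram \<Rightarrow> int" where
  "conj_sign k d t = sign (conj_perm k d t)"

section \<open>The planar diagram algebras\<close>

datatype planar_family = TL | Motzkin | Planar_Rook

fun block_condition :: "planar_family \<Rightarrow> vertex set \<Rightarrow> bool" where
  "block_condition TL b \<longleftrightarrow> card b = 2"
| "block_condition Motzkin b \<longleftrightarrow> card b = 1 \<or> card b = 2"
| "block_condition Planar_Rook b \<longleftrightarrow>
     card (b \<inter> {0} \<times> UNIV) \<le> 1 \<and> card (b \<inter> {1} \<times> UNIV) \<le> 1"

definition diagram_basis :: "planar_family \<Rightarrow> nat \<Rightarrow> diagram set" where
  "diagram_basis F k = {d \<in> diagrams k. planar k d \<and> (\<forall>b\<in>d. block_condition F b)}"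

text \<open>Formal linear combinations of diagrams.\<close>

type_synonym 'a dvec = "diagram \<Rightarrow>\<^sub>0 'a"

definition lin :: "diagram set \<Rightarrow> 'a::field dvec set" where
  "lin D = {v. Poly_Mapping.keys v \<subseteq> D}"

definition dscale :: "'a::field \<Rightarrow> 'a dvec \<Rightarrow> 'a dvec" where
  "dscale c v = Poly_Mapping.map ((*) c) v"

definition single_diagram :: "diagram \<Rightarrow> 'a::field dvec" where
  "single_diagram d = Poly_Mapping.single d 1"

definition bilinear_ext :: "(diagram \<Rightarrow> diagram \<Rightarrow> 'a dvec) \<Rightarrow> 'a::field dvec \<Rightarrow> 'a dvec \<Rightarrow> 'a dvec" where
  "bilinear_ext f a b =
     (\<Sum>d\<in>Poly_Mapping.keys a. \<Sum>t\<in>Poly_Mapping.keys b.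
        dscale (Poly_Mapping.lookup a d * Poly_Mapping.lookup b t) (f d t))"

definition alg_carrier :: "planar_family \<Rightarrow> nat \<Rightarrow> 'a::field dvec set" where
  "alg_carrier F k = lin (diagram_basis F k)"

definition alg_mult :: "'a::field \<Rightarrow> nat \<Rightarrow> 'a dvec \<Rightarrow> 'a dvec \<Rightarrow> 'a dvec" where
  "alg_mult x k =
     bilinear_ext (\<lambda>d1 d2. dscale (x ^ kappa k d1 d2) (single_diagram (compose_diagram k d1 d2)))"

definition alg_one :: "nat \<Rightarrow> 'a::field dvec" where
  "alg_one k = single_diagram (id_diagram k)"

section \<open>Modules over the planar diagram algebras\<close>

record (overloaded) ('a::zero, 'v) rep =
  rep_space :: "'v set"
  scl :: "'a \<Rightarrow> 'v \<Rightarrow> 'v"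
  act :: "'a dvec \<Rightarrow> 'v \<Rightarrow> 'v"

definition alg_module ::
  "planar_family \<Rightarrow> 'a::field \<Rightarrow> nat \<Rightarrow> ('a, 'v::ab_group_add) rep \<Rightarrow> bool" where
  "alg_module F x k M \<longleftrightarrow>
     vector_space (scl M) \<and> module.subspace (scl M) (rep_space M) \<and>
     (\<forall>a\<in>alg_carrier F k. \<forall>v\<in>rep_space M. act M a v \<in> rep_space M) \<and>
     (\<forall>a\<in>alg_carrier F k. \<forall>v\<in>rep_space M. \<forall>w\<in>rep_space M. act M a (v + w) = act M a v + act M a w) \<and>
     (\<forall>a\<in>alg_carrier F k. \<forall>b\<in>alg_carrier F k. \<forall>v\<in>rep_space M.
        act M (a + b) v = act M a v + act M b v) \<and>
     (\<forall>c. \<forall>a\<in>alg_carrier F k. \<forall>v\<in>rep_space M.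
        act M a (scl M c v) = scl M c (act M a v) \<and> act M (dscale c a) v = scl M c (act M a v)) \<and>
     (\<forall>a\<in>alg_carrier F k. \<forall>b\<in>alg_carrier F k. \<forall>v\<in>rep_space M.
        act M (alg_mult x k a b) v = act M a (act M b v)) \<and>
     (\<forall>v\<in>rep_space M. act M (alg_one k) v = v)"

definition alg_submodule ::
  "planar_family \<Rightarrow> nat \<Rightarrow> ('a::field, 'v::ab_group_add) rep \<Rightarrow> 'v set \<Rightarrow> bool" where
  "alg_submodule F k M U \<longleftrightarrow>
     U \<subseteq> rep_space M \<and> module.subspace (scl M) U \<and>
     (\<forall>a\<in>alg_carrier F k. \<forall>u\<in>U. act M a u \<in> U)"

definition alg_irreducible ::
  "planar_family \<Rightarrow> 'a::field \<Rightarrow> nat \<Rightarrow> ('a, 'v::ab_group_add) rep \<Rightarrow> bool" where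
  "alg_irreducible F x k M \<longleftrightarrow>
     alg_module F x k M \<and> rep_space M \<noteq> {0} \<and>
     (\<forall>U. alg_submodule F k M U \<longrightarrow> U = {0} \<or> U = rep_space M)"

definition alg_isomorphic ::
  "planar_family \<Rightarrow> nat \<Rightarrow> ('a::field, 'v::ab_group_add) rep \<Rightarrow> ('a, 'w::ab_group_add) rep \<Rightarrow> bool" where
  "alg_isomorphic F k M N \<longleftrightarrow>
     (\<exists>\<phi>. bij_betw \<phi> (rep_space M) (rep_space N) \<and>
        (\<forall>v\<in>rep_space M. \<forall>w\<in>rep_space M. \<phi> (v + w) = \<phi> v + \<phi> w) \<and>
        (\<forall>c. \<forall>v\<in>rep_space M. \<phi> (scl M c v) = scl N c (\<phi> v)) \<and>
        (\<forall>a\<in>alg_carrier F k. \<forall>v\<in>rep_space M. \<phi> (act M a v) = act N a (\<phi> v)))"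

definition restrict_rep :: "('a::zero, 'v) rep \<Rightarrow> 'v set \<Rightarrow> ('a, 'v) rep" where
  "restrict_rep M U = M\<lparr>rep_space := U\<rparr>"

definition alg_direct_sum ::
  "planar_family \<Rightarrow> nat \<Rightarrow> ('a::field, 'v::ab_group_add) rep \<Rightarrow> 'i set \<Rightarrow> ('i \<Rightarrow> 'v set) \<Rightarrow> bool" where
  "alg_direct_sum F k M I U \<longleftrightarrow>
     finite I \<and> (\<forall>i\<in>I. alg_submodule F k M (U i)) \<and>
     (\<forall>v\<in>rep_space M. \<exists>!u. u \<in> (\<Pi>\<^sub>E i\<in>I. U i) \<and> v = (\<Sum>i\<in>I. u i))"

definition regular_rep :: "planar_family \<Rightarrow> 'a::field \<Rightarrow> nat \<Rightarrow> ('a, 'a dvec) rep" where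
  "regular_rep F x k = \<lparr>rep_space = alg_carrier F k, scl = dscale, act = alg_mult x k\<rparr>"

definition alg_semisimple :: "planar_family \<Rightarrow> 'a::field \<Rightarrow> nat \<Rightarrow> bool" where
  "alg_semisimple F x k \<longleftrightarrow>
     (\<exists>(n::nat) U. alg_direct_sum F k (regular_rep F x k) {..<n} U \<and>
        (\<forall>i<n. alg_irreducible F x k (restrict_rep (regular_rep F x k) (U i))))"

section \<open>The labels of the irreducible modules\<close>

definition label_ok :: "planar_family \<Rightarrow> nat \<Rightarrow> nat \<Rightarrow> bool" where
  "label_ok F k r \<longleftrightarrow> r \<le> k \<and> (F = TL \<longrightarrow> r mod 2 = k mod 2)"

fun lower :: "planar_family \<Rightarrow> nat \<Rightarrow> nat" where
  "lower TL k = k - 2"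
| "lower Motzkin k = k - 1"
| "lower Planar_Rook k = k - 1"

text \<open>Used for \<open>k \<ge> 1\<close>, and for \<open>k \<ge> 2\<close> in the Temperley-Lieb case.\<close>

definition E_diagram :: "planar_family \<Rightarrow> nat \<Rightarrow> diagram" where
  "E_diagram F k = id_diagram (lower F k) \<union>
     (if F = TL then {{(0, k - 1), (0, k)}, {(1, k - 1), (1, k)}} else {{(0, k)}, {(1, k)}})"

definition e_idem :: "planar_family \<Rightarrow> 'a::field \<Rightarrow> nat \<Rightarrow> 'a dvec" where
  "e_idem F x k = dscale (1 / x) (single_diagram (E_diagram F k))"

text \<open>The inclusion of the algebra on \<open>p\<close> strands into the algebra on \<open>k \<ge> p\<close> strands.\<close>

definition extend_diagram :: "nat \<Rightarrow> nat \<Rightarrow> diagram \<Rightarrow> diagram" where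
  "extend_diagram p k d = d \<union> {{(0, i), (1, i)} | i. i \<in> {p<..k}}"

definition alg_embed :: "nat \<Rightarrow> nat \<Rightarrow> 'a::field dvec \<Rightarrow> 'a dvec" where
  "alg_embed p k a = (\<Sum>d\<in>Poly_Mapping.keys a.
     dscale (Poly_Mapping.lookup a d) (single_diagram (extend_diagram p k d)))"

text \<open>The space \<open>e\<^sub>k V\<close> as a module for the algebra on \<open>lower F k\<close> strands: \<open>a\<close> acts as
  \<open>a e\<^sub>k\<close>.\<close>

definition truncate_rep :: "planar_family \<Rightarrow> 'a::field \<Rightarrow> nat \<Rightarrow> ('a, 'v) rep \<Rightarrow> ('a, 'v) rep" where
  "truncate_rep F x k V =
     \<lparr>rep_space = act V (e_idem F x k) ` rep_space V,
      scl = scl V,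
      act = (\<lambda>a. act V (alg_mult x k (alg_embed (lower F k) k a) (e_idem F x k)))\<rparr>"

text \<open>\<open>is_simple F x k r V\<close> states that \<open>V\<close> is a copy of the irreducible module with label \<open>r\<close>.\<close>

inductive is_simple ::
  "planar_family \<Rightarrow> 'a::field \<Rightarrow> nat \<Rightarrow> nat \<Rightarrow> ('a, 'v::ab_group_add) rep \<Rightarrow> bool"
  for F :: planar_family and x :: 'a where
  top: "alg_module F x k V \<Longrightarrow>
        (\<exists>v. v \<noteq> 0 \<and> rep_space V = range (\<lambda>c. scl V c v)) \<Longrightarrow>
        (\<forall>d\<in>diagram_basis F k. diagram_rank d < k \<longrightarrow> (\<forall>v\<in>rep_space V. act V (single_diagram d) v = 0)) \<Longrightarrow>
        is_simple F x k k V"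
| step: "r < k \<Longrightarrow> label_ok F k r \<Longrightarrow> alg_irreducible F x k V \<Longrightarrow>
         is_simple F x (lower F k) r W \<Longrightarrow>
         alg_isomorphic F (lower F k) (truncate_rep F x k V) W \<Longrightarrow>
         is_simple F x k r V"

section \<open>The modules of symmetric diagrams\<close>

definition sym_diagrams :: "planar_family \<Rightarrow> nat \<Rightarrow> diagram set" where
  "sym_diagrams F k = {t \<in> diagram_basis F k. symmetric_diagram t}"

definition conj_diagram :: "'a::field \<Rightarrow> nat \<Rightarrow> diagram \<Rightarrow> diagram \<Rightarrow> 'a dvec" where
  "conj_diagram x k d t =
     (if diagram_rank (conjugate k d t) = diagram_rank t
      then dscale (x ^ kappa k d t * of_int (conj_sign k d t)) (single_diagram (conjugate k d t))
      else 0)"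

definition conj_rep :: "planar_family \<Rightarrow> 'a::field \<Rightarrow> nat \<Rightarrow> ('a, 'a dvec) rep" where
  "conj_rep F x k =
     \<lparr>rep_space = lin (sym_diagrams F k), scl = dscale, act = bilinear_ext (conj_diagram x k)\<rparr>"

definition sym_space :: "planar_family \<Rightarrow> nat \<Rightarrow> nat \<Rightarrow> 'a::field dvec set" where
  "sym_space F k r = lin {t \<in> sym_diagrams F k. diagram_rank t = r}"

definition conj_rep_rank :: "planar_family \<Rightarrow> 'a::field \<Rightarrow> nat \<Rightarrow> nat \<Rightarrow> ('a, 'a dvec) rep" where
  "conj_rep_rank F x k r = restrict_rep (conj_rep F x k) (sym_space F k r)"

end

theory Submission
  imports Defs
begin

text \<open>A symmetric planar diagram with blocks of size at most two is determined by its top half, a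
  noncrossing partial matching with marked free points, and conjugation by \<open>d\<close> carries the marked
  points along strands without crossing them. So the sign is always one, and
  \<open>d \<circ> t \<circ> d\<^sup>T = g \<circ> g\<^sup>T\<close> with \<open>g = d \<circ> t\<close>. For symmetric \<open>s, t\<close> of the same rank there is a planar
  diagram with the top half of \<open>s\<close> and the bottom half of \<open>t\<close>; it sends \<open>t\<close> to a nonzero multiple of
  \<open>s\<close>, and \<open>t\<close> itself sends every vector of the module into the line of \<open>t\<close>. Writing the unit of the
  algebra as a sum of elements of irreducible left ideals, one of these ideals therefore maps onto the
  whole module by acting on \<open>t\<close>, which makes the module irreducible.

  Adding the two halves of \<open>E\<^sub>k\<close> to a diagram on fewer strands identifies \<open>e\<^sub>k M\<^sub>k\<^sup>r\<close> with \<open>M\<^sub>p\<^sup>r\<close>,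
  and an irreducible module with \<open>e\<^sub>k V \<noteq> 0\<close> is determined by \<open>e\<^sub>k V\<close>, because an element \<open>c\<close> of the
  algebra kills a vector of \<open>e\<^sub>k V\<close> iff all \<open>e\<^sub>k b c e\<^sub>k\<close> do.\<close>

section \<open>Noncrossing diagrams\<close>

text \<open>Planarity is defined by arcs in a rectangle, but the algebra needs a combinatorial
  criterion, and in both directions: drawn diagrams must be noncrossing so that strands keep their
  order, and glued halves must be drawable so that the diagrams carrying \<open>t\<close> to
  \<open>s\<close> lie in the algebra. As blocks have at most two vertices, each is at most one arc,
  and alternation of blocks becomes interlacing of arc ends on a line.

  Closure of the basis under composition and associativity are not derived from pictures. They are
  read off from the semisimplicity hypothesis, whose summands are modules for the product. That
  gives information about loop counts only through powers of x, which is why the cocycle identity is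
  stated for such powers.

  The recursion defining the labels descends to fewer strands, where semisimplicity is not assumed.
  Both the monoid laws and the irreducibility are therefore carried from k strands down to p strands
  through the corner \<open>e_k A_k e_k\<close>.\<close>

lemma components_eqI:
  assumes part: "partition_on V P"
    and closed: "\<And>C u v. C \<in> P \<Longrightarrow> u \<in> C \<Longrightarrow> (u, v) \<in> R \<Longrightarrow> v \<in> C"
    and conn: "\<And>C u v. C \<in> P \<Longrightarrow> u \<in> C \<Longrightarrow> v \<in> C \<Longrightarrow> (u, v) \<in> R\<^sup>*"
  shows "components V R = P"
proof -
  have img: "R\<^sup>* `` {u} = C" if "C \<in> P" "u \<in> C" for C u
  proof
    have "v \<in> C" if "(u, v) \<in> R\<^sup>*" for v
      using that by (induction rule: rtrancl_induct) (use \<open>u \<in> C\<close> \<open>C \<in> P\<close> closed in auto)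
    then show "R\<^sup>* `` {u} \<subseteq> C" by auto
    show "C \<subseteq> R\<^sup>* `` {u}" using conn[OF that] by auto
  qed
  have V: "V = \<Union>P" and ne: "{} \<notin> P" using part by (auto simp: partition_on_def)
  show ?thesis
  proof
    show "components V R \<subseteq> P"
      unfolding components_def quotient_def V using img by auto
    show "P \<subseteq> components V R"
    proof
      fix C assume C: "C \<in> P"
      with ne obtain u where "u \<in> C" by (metis ex_in_conv)
      with C img[OF C this] show "C \<in> components V R"
        unfolding components_def quotient_def V by blast
    qed
  qed
qed

text \<open>The order of the keys is the cyclic order of the vertices on the boundary of the rectangle,
  starting at the upper left corner. It does not depend on the number of strands, and the
  reflection of the two rows negates it.\<close>

definition key :: "vertex \<Rightarrow> real" where
  "key = (\<lambda>(s, i). if s = 0 then - (1 / real i) else 1 / real i)"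

text \<open>Only one alternating pattern is written down, but \<open>b\<close> and \<open>c\<close>
  run over ordered pairs, so both are excluded. Cutting the boundary cycle open at a corner loses
  nothing: four points alternate on a circle exactly when they alternate on the line.\<close>

definition noncrossing :: "diagram \<Rightarrow> bool" where
  "noncrossing d \<longleftrightarrow> (\<forall>b\<in>d. \<forall>c\<in>d. b \<noteq> c \<longrightarrow> (\<forall>u\<in>b. \<forall>u'\<in>b. \<forall>v\<in>c. \<forall>v'\<in>c.
     \<not> (key u < key v \<and> key v < key u' \<and> key u' < key v')))"

lemma noncrossingD:
  "noncrossing d \<Longrightarrow> b \<in> d \<Longrightarrow> c \<in> d \<Longrightarrow> b \<noteq> c \<Longrightarrow> u \<in> b \<Longrightarrow> u' \<in> b \<Longrightarrow> v \<in> c \<Longrightarrow> v' \<in> c \<Longrightarrow>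
   key u < key v \<Longrightarrow> key v < key u' \<Longrightarrow> key u' < key v' \<Longrightarrow> False"
  unfolding noncrossing_def by blast

section \<open>From planar drawings to the noncrossing condition\<close>

text \<open>Opens the rectangle along its left edge, so that all vertices come to lie on one line.\<close>

definition unfold_point :: "real \<times> real \<Rightarrow> real^2" where
  "unfold_point = (\<lambda>(x, y). vector [(1 - 2 * y) / x, (1 - \<bar>1 - 2 * y\<bar>) / x])"

lemma unfold_point_nth [simp]:
  "unfold_point p $ 1 = (1 - 2 * snd p) / fst p"
  "unfold_point p $ 2 = (1 - \<bar>1 - 2 * snd p\<bar>) / fst p"
  by (auto simp: unfold_point_def case_prod_unfold)

lemma continuous_on_unfold_point: "continuous_on (cbox (1, 0) (r, 1)) unfold_point"
proof -
  have *: "unfold_point = (\<lambda>p. \<chi> i. if i = 1 then (1 - 2 * snd p) / fst p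
      else (1 - \<bar>1 - 2 * snd p\<bar>) / fst p)"
    by (auto simp: fun_eq_iff vec_eq_iff forall_2)
  have "continuous_on (cbox (1, 0) (r, 1)) (\<lambda>p. if i = 1 then (1 - 2 * snd p) / fst p
      else (1 - \<bar>1 - 2 * snd p\<bar>) / fst p)" for i :: 2
    by (cases "i = 1") (auto intro!: continuous_intros simp: cbox_Pair_eq)
  then show ?thesis unfolding * by (rule continuous_on_vec_lambda)
qed

text \<open>The absolute value of the first coordinate plus the second coordinate is 1/x, which
  recovers x; the first coordinate then recovers y.\<close>

lemma inj_on_unfold_point: "inj_on unfold_point (cbox (1, 0) (r, 1))"
proof
  fix p q assume p: "p \<in> cbox (1, 0) (r, 1)" and q: "q \<in> cbox (1, 0) (r, 1)"
    and eq: "unfold_point p = unfold_point q"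
  have pos: "fst p > 0" "fst q > 0" using p q by (auto simp: cbox_Pair_eq)
  have 1: "(1 - 2 * snd p) / fst p = (1 - 2 * snd q) / fst q"
    and 2: "(1 - \<bar>1 - 2 * snd p\<bar>) / fst p = (1 - \<bar>1 - 2 * snd q\<bar>) / fst q"
    using arg_cong[OF eq, of "\<lambda>v. v $ 1"] arg_cong[OF eq, of "\<lambda>v. v $ 2"] by simp_all
  have "\<bar>1 - 2 * snd p\<bar> / fst p = \<bar>(1 - 2 * snd p) / fst p\<bar>" using pos by simp
  also have "\<dots> = \<bar>1 - 2 * snd q\<bar> / fst q" unfolding 1 using pos by simp
  finally have "1 / fst p = 1 / fst q" using 2 by (simp add: diff_divide_distrib)
  then have "fst p = fst q" by simp
  with 1 pos have "snd p = snd q" by simp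
  with \<open>fst p = fst q\<close> show "p = q" by (simp add: prod_eq_iff)
qed

lemma unfold_point_image: "unfold_point ` cbox (1, 0) (r, 1) \<subseteq> cbox (vector [- 1, 0]) (vector [1, 1])"
proof
  fix z assume "z \<in> unfold_point ` cbox (1, 0) (r, 1)"
  then obtain x y where xy: "1 \<le> x" "0 \<le> y" "y \<le> 1" and z: "z = unfold_point (x, y)"
    by (auto simp: cbox_Pair_eq)
  then show "z \<in> cbox (vector [- 1, 0]) (vector [1, 1])"
    by (auto simp: mem_box_cart forall_2 field_simps)
qed

text \<open>Origin of the formula for \<open>key\<close>: on the two rows 1 - 2y is -1 or 1, so the
  second coordinate vanishes and division by x leaves -1/i or 1/i.\<close>

lemma unfold_point_position:
  assumes "v \<in> verts k"
  shows "unfold_point (position v) = vector [key v, 0]"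
  using assms by (auto simp: vec_eq_iff forall_2 position_def verts_def key_def)

text \<open>A drawing fixes the ends of an arc only as a set, so the arc may have to be reversed to
  start at the chosen vertex.\<close>

lemma arc_between:
  assumes "path g" "{pathstart g, pathfinish g} = {p, q}"
  obtains h where "path h" "pathstart h = p" "pathfinish h = q" "path_image h = path_image g"
proof (cases "pathstart g = p")
  case True
  with assms that[of g] show ?thesis by (auto simp: doubleton_eq_iff)
next
  case False
  with assms that[of "reversepath g"] show ?thesis by (auto simp: doubleton_eq_iff)
qed

text \<open>Two alternating blocks are two edges whose arcs, after unfolding, join interlaced points
  on the bottom side of a box. Such paths meet, and injectivity of the unfolding moves the common
  point back into the rectangle, where disjoint edges have disjoint arcs.\<close>

lemma planar_noncrossing:
  assumes planar: "planar k d" and d: "d \<in> diagrams k" and small: "\<And>b. b \<in> d \<Longrightarrow> card b \<le> 2"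
  shows "noncrossing d"
proof -
  obtain E :: "vertex set set" and \<gamma> :: "vertex set \<Rightarrow> real \<Rightarrow> real \<times> real"
    where drawing: "(\<forall>e\<in>E. e \<subseteq> verts k \<and> card e = 2) \<and>
     components (verts k) {(u, v). {u, v} \<in> E} = d \<and>
     (\<forall>e\<in>E. arc (\<gamma> e) \<and> {pathstart (\<gamma> e), pathfinish (\<gamma> e)} = position ` e \<and>
        path_image (\<gamma> e) \<subseteq> cbox (1, 0) (real k, 1) \<and>
        path_image (\<gamma> e) \<inter> position ` verts k = position ` e) \<and>
     (\<forall>e\<in>E. \<forall>f\<in>E. e \<noteq> f \<longrightarrow> path_image (\<gamma> e) \<inter> path_image (\<gamma> f) \<subseteq> position ` (e \<inter> f))"
    using planar unfolding planar_def by (elim exE)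
  have E: "e \<subseteq> verts k \<and> card e = 2" if "e \<in> E" for e
    using drawing that by simp
  have comp: "components (verts k) {(u, v). {u, v} \<in> E} = d"
    using drawing by simp
  have \<gamma>: "arc (\<gamma> e) \<and> {pathstart (\<gamma> e), pathfinish (\<gamma> e)} = position ` e \<and>
        path_image (\<gamma> e) \<subseteq> cbox (1, 0) (real k, 1)" if "e \<in> E" for e
    using drawing that by simp
  have disj: "path_image (\<gamma> e) \<inter> path_image (\<gamma> f) \<subseteq> position ` (e \<inter> f)"
    if "e \<in> E" "f \<in> E" "e \<noteq> f" for e f
    using drawing that by simp
  have part: "partition_on (verts k) d" using d by (simp add: diagrams_def)
  \<comment> \<open>A block is a connected component, so two distinct vertices force an edge inside
    it; with only two vertices available, that edge is the block itself.\<close>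
  have bE: "b = {u, v} \<and> {u, v} \<in> E" if b: "b \<in> d" "u \<in> b" "v \<in> b" "u \<noteq> v" for b u v
  proof -
    have fin: "finite b"
      using part b(1) unfolding partition_on_def verts_def
      by (metis Union_upper finite.emptyI finite.insertI finite_SigmaI finite_atLeastAtMost finite_subset)
    have buv: "b = {u, v}"
      using small[OF b(1)] b fin by (intro card_seteq[symmetric]) auto
    have "b \<in> verts k // {(u, v). {u, v} \<in> E}\<^sup>*" using b(1) comp by (simp add: components_def)
    then obtain w where w: "b = {(u, v). {u, v} \<in> E}\<^sup>* `` {w}" by (auto elim: quotientE)
    have "w \<in> {u, v}" using buv w by auto
    then obtain w' where w': "{w, w'} = {u, v}" "w \<noteq> w'"
      using b(4) by (metis insertE insert_commute singletonD)
    then have "(w, w') \<in> {(u, v). {u, v} \<in> E}\<^sup>*" using w buv by auto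
    then obtain y where y: "{w, y} \<in> E" using w'(2) by (auto elim: converse_rtranclE)
    then have "y \<in> b" unfolding w by auto
    moreover have "y \<noteq> w" using E[OF y] by auto
    ultimately have "{w, y} = {u, v}" using buv w' by auto
    with y buv show ?thesis by auto
  qed
  show ?thesis unfolding noncrossing_def
  proof (intro ballI impI notI)
    fix b c u u' v v'
    assume bc: "b \<in> d" "c \<in> d" "b \<noteq> c" "u \<in> b" "u' \<in> b" "v \<in> c" "v' \<in> c"
      and keys: "key u < key v \<and> key v < key u' \<and> key u' < key v'"
    have "u \<noteq> u'" "v \<noteq> v'" using keys by auto
    then have b: "b = {u, u'}" "b \<in> E" and c: "c = {v, v'}" "c \<in> E"
      using bE bc by metis+
    have vs: "u \<in> verts k" "u' \<in> verts k" "v \<in> verts k" "v' \<in> verts k"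
      using E[OF b(2)] E[OF c(2)] b(1) c(1) by auto
    have "b \<inter> c = {}" using part bc(1-3) by (auto simp: partition_on_def dest: disjointD)
    then have "path_image (\<gamma> b) \<inter> path_image (\<gamma> c) = {}" using disj[OF b(2) c(2) bc(3)] by auto
    obtain f where f: "path f" "pathstart f = position u" "pathfinish f = position u'"
      "path_image f = path_image (\<gamma> b)"
      using \<gamma>[OF b(2)] b(1) by (auto intro: arc_between[of "\<gamma> b" "position u" "position u'"] simp: arc_imp_path)
    obtain g where g: "path g" "pathstart g = position v" "pathfinish g = position v'"
      "path_image g = path_image (\<gamma> c)"
      using \<gamma>[OF c(2)] c(1) by (auto intro: arc_between[of "\<gamma> c" "position v" "position v'"] simp: arc_imp_path)
    have fg: "path_image f \<subseteq> cbox (1, 0) (real k, 1)" "path_image g \<subseteq> cbox (1, 0) (real k, 1)"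
      using \<gamma>[OF b(2)] \<gamma>[OF c(2)] f g by auto
    have "continuous_on (path_image f) unfold_point" "continuous_on (path_image g) unfold_point"
      using fg by (auto intro: continuous_on_subset[OF continuous_on_unfold_point])
    then have pf: "path (unfold_point \<circ> f)" "path (unfold_point \<circ> g)"
      using f(1) g(1) by (simp_all add: path_continuous_image)
    have box: "path_image (unfold_point \<circ> f) \<subseteq> cbox (vector [- 1, 0]) (vector [1, 1])"
      "path_image (unfold_point \<circ> g) \<subseteq> cbox (vector [- 1, 0]) (vector [1, 1])"
      using fg unfold_point_image[of "real k"] unfolding path_image_compose by blast+
    have ends: "pathstart (unfold_point \<circ> f) = vector [key u, 0]"
      "pathfinish (unfold_point \<circ> f) = vector [key u', 0]"
      "pathstart (unfold_point \<circ> g) = vector [key v, 0]"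
      "pathfinish (unfold_point \<circ> g) = vector [key v', 0]"
      using f(2,3) g(2,3) vs by (simp_all only: pathstart_compose pathfinish_compose unfold_point_position)
    obtain z where "z \<in> path_image (unfold_point \<circ> f)" "z \<in> path_image (unfold_point \<circ> g)"
      by (rule fashoda_interlace[OF pf box]) (use keys in \<open>simp_all add: ends\<close>)
    then obtain p q where "p \<in> path_image f" "q \<in> path_image g" "unfold_point p = unfold_point q"
      by (auto simp: path_image_compose)
    with fg inj_on_unfold_point[of "real k"] have "p = q" by (auto dest: inj_onD)
    with \<open>p \<in> path_image f\<close> \<open>q \<in> path_image g\<close> f(4) g(4)
      \<open>path_image (\<gamma> b) \<inter> path_image (\<gamma> c) = {}\<close> show False by auto
  qed
qed

section \<open>Drawing a noncrossing diagram with explicit arcs\<close>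

text \<open>The edge from \<open>u\<close> to \<open>v\<close> is a straight segment if \<open>u\<close> and \<open>v\<close> are in different rows. Otherwise
  it is a tent whose slope is too small to reach the segments starting outside the tent.\<close>

definition edge_curve :: "nat \<Rightarrow> vertex \<Rightarrow> vertex \<Rightarrow> real \<Rightarrow> real \<times> real" where
  "edge_curve k u v t =
     ((1 - t) * real (snd u) + t * real (snd v),
      (1 - t) * (1 - real (fst u)) + t * (1 - real (fst v)) +
      (real (fst u) + real (fst v) - 1) * (min t (1 - t) * (real (snd v) - real (snd u)) / (real k + 1)))"

text \<open>The regions contain the curves and are given by equations in x and y, so that
  disjointness of arcs becomes arithmetic without curve parameters.\<close>

definition top_tent :: "nat \<Rightarrow> nat \<Rightarrow> nat \<Rightarrow> (real \<times> real) set" where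
  "top_tent k i j = {(x, y). real i \<le> x \<and> x \<le> real j \<and> 1 - y = min (x - real i) (real j - x) / (real k + 1)}"

definition bottom_tent :: "nat \<Rightarrow> nat \<Rightarrow> nat \<Rightarrow> (real \<times> real) set" where
  "bottom_tent k i j = {(x, y). real i \<le> x \<and> x \<le> real j \<and> y = min (x - real i) (real j - x) / (real k + 1)}"

definition strut :: "nat \<Rightarrow> nat \<Rightarrow> (real \<times> real) set" where
  "strut i j = {(x, y). 0 \<le> y \<and> y \<le> 1 \<and> x = y * real i + (1 - y) * real j}"

lemma min_scale: "0 \<le> (c::real) \<Longrightarrow> min (t * c) ((1 - t) * c) = min t (1 - t) * c"
  by (simp add: min_mult_distrib_right)

lemma edge_curve_top:
  assumes "i < j" "t \<in> {0..1}"
  shows "edge_curve k (0, i) (0, j) t \<in> top_tent k i j"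
proof -
  define c where "c = real j - real i"
  have c: "c > 0" using assms by (simp add: c_def)
  have x: "(1 - t) * real i + t * real j - real i = t * c"
    "real j - ((1 - t) * real i + t * real j) = (1 - t) * c" by (simp_all add: c_def algebra_simps)
  have "0 \<le> t * c" "0 \<le> (1 - t) * c" using assms c by auto
  then have b: "real i \<le> (1 - t) * real i + t * real j" "(1 - t) * real i + t * real j \<le> real j"
    using x by linarith+
  show ?thesis unfolding edge_curve_def top_tent_def using b
    by (simp add: x min_scale c less_imp_le flip: c_def)
qed

lemma edge_curve_bottom:
  assumes "i < j" "t \<in> {0..1}"
  shows "edge_curve k (1, i) (1, j) t \<in> bottom_tent k i j"
proof -
  define c where "c = real j - real i"
  have c: "c > 0" using assms by (simp add: c_def)
  have x: "(1 - t) * real i + t * real j - real i = t * c"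
    "real j - ((1 - t) * real i + t * real j) = (1 - t) * c" by (simp_all add: c_def algebra_simps)
  have "0 \<le> t * c" "0 \<le> (1 - t) * c" using assms c by auto
  then have b: "real i \<le> (1 - t) * real i + t * real j" "(1 - t) * real i + t * real j \<le> real j"
    using x by linarith+
  show ?thesis unfolding edge_curve_def bottom_tent_def using b
    by (simp add: x min_scale c less_imp_le flip: c_def)
qed

lemma edge_curve_strut: "t \<in> {0..1} \<Longrightarrow> edge_curve k (0, i) (1, j) t \<in> strut i j"
  by (simp add: edge_curve_def strut_def)

text \<open>The slope 1/(k+1) serves two purposes: the tent stays in the upper half of the
  rectangle, away from the bottom tents, and at depth 1 - y it keeps a horizontal distance of at
  least (1 - y)(k - 1) from both of its ends.\<close>

lemma top_tent_bounds:
  assumes "(x, y) \<in> top_tent k i j" "1 \<le> i" "j \<le> k"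
  shows "1 / 2 < y" "y \<le> 1" "\<bar>1 - y\<bar> * (real k - 1) \<le> min (x - real i) (real j - x)" "real i \<le> x" "x \<le> real j"
proof -
  define m where "m = min (x - real i) (real j - x)"
  have m: "0 \<le> m" "1 - y = m / (real k + 1)" and *: "real i \<le> x" "x \<le> real j"
    using assms by (auto simp: top_tent_def m_def)
  have "2 * m \<le> real j - real i" by (auto simp: m_def min_def)
  then have "2 * m < real k + 1" using assms by linarith
  then have "m / (real k + 1) < 1 / 2" by (simp add: field_simps)
  then show "1 / 2 < y" using m by linarith
  have "0 \<le> m / (real k + 1)" using m by simp
  then show "y \<le> 1" using m by linarith
  have "m * (real k - 1) \<le> m * (real k + 1)" using m by (intro mult_left_mono) auto
  then have "m / (real k + 1) * (real k - 1) \<le> m" by (simp add: field_simps)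
  then show "\<bar>1 - y\<bar> * (real k - 1) \<le> min (x - real i) (real j - x)" using m \<open>y \<le> 1\<close> by (simp flip: m_def)
  show "real i \<le> x" "x \<le> real j" by (fact *)+
qed

lemma bottom_tent_bounds:
  assumes "(x, y) \<in> bottom_tent k i j" "1 \<le> i" "j \<le> k"
  shows "y < 1 / 2" "0 \<le> y" "y * (real k - 1) \<le> min (x - real i) (real j - x)" "real i \<le> x" "x \<le> real j"
proof -
  have "(x, 1 - y) \<in> top_tent k i j" using assms by (auto simp: top_tent_def bottom_tent_def)
  from top_tent_bounds[OF this assms(2,3)]
  show "y < 1 / 2" "0 \<le> y" "y * (real k - 1) \<le> min (x - real i) (real j - x)" "real i \<le> x" "x \<le> real j"
    by auto
qed

text \<open>At a common point the distances to the nearer end of each interval agree, which is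
  impossible when the intervals are separated or strictly nested.\<close>

lemma top_tents_disjoint:
  assumes "i < j" "i' < j'" "j < i' \<or> j' < i \<or> i < i' \<and> j' < j \<or> i' < i \<and> j < j'"
  shows "top_tent k i j \<inter> top_tent k i' j' = {}"
proof -
  have False if p: "(x, y) \<in> top_tent k i j" "(x, y) \<in> top_tent k i' j'" for x y
  proof -
    have "min (x - real i) (real j - x) / (real k + 1) = min (x - real i') (real j' - x) / (real k + 1)"
      using p by (simp add: top_tent_def)
    then have "min (x - real i) (real j - x) = min (x - real i') (real j' - x)" by simp
    with p assms show False by (auto simp: top_tent_def min_def split: if_splits)
  qed
  then show ?thesis by auto
qed

lemma bottom_tents_disjoint:
  assumes "i < j" "i' < j'" "j < i' \<or> j' < i \<or> i < i' \<and> j' < j \<or> i' < i \<and> j < j'"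
  shows "bottom_tent k i j \<inter> bottom_tent k i' j' = {}"
proof -
  have *: "(x, 1 - y) \<in> top_tent k i j \<longleftrightarrow> (x, y) \<in> bottom_tent k i j" for x y i j
    by (simp add: top_tent_def bottom_tent_def)
  show ?thesis using top_tents_disjoint[OF assms, of k] by (auto simp flip: *)
qed

lemma top_bottom_disjoint:
  assumes "1 \<le> i" "j \<le> k" "1 \<le> i'" "j' \<le> k"
  shows "top_tent k i j \<inter> bottom_tent k i' j' = {}"
  using top_tent_bounds(1)[OF _ assms(1,2)] bottom_tent_bounds(1)[OF _ assms(3,4)] by fastforce

text \<open>At depth 1 - y the segment has moved sideways by at most (1 - y)(k - 1) from its top end
  \<open>a\<close>. A common point would therefore be at least as close to \<open>a\<close> as to
  \<open>i\<close> and to \<open>j\<close>, which fails for \<open>a\<close> outside the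
  interval.\<close>

lemma top_strut_disjoint:
  assumes "i < j" "1 \<le> i" "j \<le> k" "a \<in> {1..k}" "b \<in> {1..k}" "a < i \<or> j < a"
  shows "top_tent k i j \<inter> strut a b = {}"
proof -
  have False if p: "(x, y) \<in> top_tent k i j" "(x, y) \<in> strut a b" for x y
  proof -
    note tb = top_tent_bounds[OF p(1) assms(2,3)]
    have "\<bar>x - real a\<bar> = \<bar>1 - y\<bar> * \<bar>real b - real a\<bar>"
    proof -
      have "x - real a = (1 - y) * (real b - real a)" using p(2) by (simp add: strut_def algebra_simps)
      then show ?thesis by (simp add: abs_mult)
    qed
    also have "\<dots> \<le> \<bar>1 - y\<bar> * (real k - 1)" using assms by (intro mult_left_mono) auto
    finally have "\<bar>x - real a\<bar> \<le> min (x - real i) (real j - x)" using tb by linarith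
    with tb assms(6) show False by auto
  qed
  then show ?thesis by auto
qed

lemma bottom_strut_disjoint:
  assumes "i < j" "1 \<le> i" "j \<le> k" "a \<in> {1..k}" "b \<in> {1..k}" "b < i \<or> j < b"
  shows "bottom_tent k i j \<inter> strut a b = {}"
proof -
  have 1: "(x, 1 - y) \<in> top_tent k i j \<longleftrightarrow> (x, y) \<in> bottom_tent k i j" for x y
    by (simp add: top_tent_def bottom_tent_def)
  have 2: "(x, 1 - y) \<in> strut b a \<longleftrightarrow> (x, y) \<in> strut a b" for x y
    by (auto simp: strut_def algebra_simps)
  show ?thesis using top_strut_disjoint[OF assms(1-3) assms(5,4,6)] by (auto simp flip: 1 2)
qed

lemma struts_disjoint:
  assumes "a < a'" "b < b'"
  shows "strut a b \<inter> strut a' b' = {}"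
proof -
  have False if p: "(x, y) \<in> strut a b" "(x, y) \<in> strut a' b'" for x y
  proof -
    have "0 \<le> y" "y \<le> 1" and eq: "y * (real a' - real a) + (1 - y) * (real b' - real b) = 0"
      using p by (auto simp: strut_def algebra_simps)
    moreover from this have "y * (real a' - real a) \<ge> 0" "(1 - y) * (real b' - real b) \<ge> 0"
      using assms by auto
    ultimately have "y * (real a' - real a) = 0" "(1 - y) * (real b' - real b) = 0" by linarith+
    then show False using assms by simp
  qed
  then show ?thesis by auto
qed


definition oriented :: "vertex \<Rightarrow> vertex \<Rightarrow> bool" where
  "oriented u v \<longleftrightarrow> fst u < fst v \<or> fst u = fst v \<and> snd u < snd v"

definition edge_region :: "nat \<Rightarrow> vertex \<Rightarrow> vertex \<Rightarrow> (real \<times> real) set" where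
  "edge_region k u v = (if fst u < fst v then strut (snd u) (snd v)
     else if fst u = 0 then top_tent k (snd u) (snd v) else bottom_tent k (snd u) (snd v))"

lemma edge_curve_region:
  assumes "u \<in> verts k" "v \<in> verts k" "oriented u v"
  shows "path_image (edge_curve k u v) \<subseteq> edge_region k u v"
  using assms edge_curve_top edge_curve_bottom edge_curve_strut
  by (auto simp: verts_def oriented_def edge_region_def path_image_def)

lemma arc_edge_curve:
  assumes "u \<in> verts k" "v \<in> verts k" "oriented u v"
  shows "arc (edge_curve k u v)"
  unfolding arc_def
proof
  show "path (edge_curve k u v)"
    unfolding path_def edge_curve_def by (intro continuous_intros) auto
  show "inj_on (edge_curve k u v) {0..1}"
  proof
    fix s t :: real
    assume eq: "edge_curve k u v s = edge_curve k u v t"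
    show "s = t"
    proof (cases "fst u = fst v")
      case True
      then have "real (snd v) - real (snd u) \<noteq> 0" using assms by (auto simp: oriented_def)
      moreover have "(s - t) * (real (snd v) - real (snd u)) = 0"
        using eq by (simp add: edge_curve_def algebra_simps)
      ultimately show ?thesis by simp
    next
      case False
      then have "fst u = 0" "fst v = 1" using assms by (auto simp: oriented_def verts_def)
      then show ?thesis using eq by (simp add: edge_curve_def)
    qed
  qed
qed

lemma edge_region_box:
  assumes "u \<in> verts k" "v \<in> verts k" "oriented u v"
  shows "edge_region k u v \<subseteq> cbox (1, 0) (real k, 1)"
proof
  fix p assume p: "p \<in> edge_region k u v"
  obtain x y where xy: "p = (x, y)" by (cases p)
  have uv: "1 \<le> snd u" "snd u \<le> k" "1 \<le> snd v" "snd v \<le> k"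
    using assms by (auto simp: verts_def)
  show "p \<in> cbox (1, 0) (real k, 1)"
  proof (cases "fst u < fst v")
    case True
    then have *: "0 \<le> y" "y \<le> 1" "x = y * real (snd u) + (1 - y) * real (snd v)"
      using p xy by (auto simp: edge_region_def strut_def)
    have "y * 1 + (1 - y) * 1 \<le> x" "x \<le> y * real k + (1 - y) * real k"
      unfolding *(3) using * uv by (intro add_mono mult_left_mono; simp)+
    with * show ?thesis by (simp add: xy cbox_Pair_eq algebra_simps)
  next
    case False
    then show ?thesis
      using p uv top_tent_bounds[of x y k "snd u" "snd v"] bottom_tent_bounds[of x y k "snd u" "snd v"]
      by (auto simp: xy cbox_Pair_eq edge_region_def split: if_splits)
  qed
qed

lemma edge_region_verts:
  assumes "u \<in> verts k" "v \<in> verts k" "oriented u v" "w \<in> verts k" "position w \<in> edge_region k u v"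
  shows "w \<in> {u, v}"
proof -
  obtain s i where w: "w = (s, i)" "s = 0 \<or> s = 1" using assms(4) by (auto simp: verts_def)
  have uv: "1 \<le> snd u" "snd u \<le> k" "1 \<le> snd v" "snd v \<le> k"
    using assms by (auto simp: verts_def)
  consider "fst u = 0" "fst v = 1" | "fst u = 0" "fst v = 0" "snd u < snd v" | "fst u = 1" "fst v = 1" "snd u < snd v"
    using assms(1-3) by (auto simp: verts_def oriented_def)
  then show ?thesis
  proof cases
    case 1
    then show ?thesis using assms(5) w
      by (cases u; cases v) (auto simp: edge_region_def strut_def position_def)
  next
    case 2
    then show ?thesis using assms(5) w top_tent_bounds(1)[OF _ uv(1,4), of "real i" "1 - real s"]
      by (cases u; cases v) (auto simp: edge_region_def top_tent_def position_def min_def split: if_splits)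
  next
    case 3
    then show ?thesis using assms(5) w bottom_tent_bounds(1)[OF _ uv(1,4), of "real i" "1 - real s"]
      by (cases u; cases v) (auto simp: edge_region_def bottom_tent_def position_def min_def split: if_splits)
  qed
qed

lemma key_less_iff:
  "(0, i) \<in> verts k \<Longrightarrow> (0, j) \<in> verts k \<Longrightarrow> key (0, i) < key (0, j) \<longleftrightarrow> i < j"
  "(Suc 0, i) \<in> verts k \<Longrightarrow> (Suc 0, j) \<in> verts k \<Longrightarrow> key (Suc 0, i) < key (Suc 0, j) \<longleftrightarrow> j < i"
  "(0, i) \<in> verts k \<Longrightarrow> (Suc 0, j) \<in> verts k \<Longrightarrow> key (0, i) < key (Suc 0, j)"
  by (auto simp: key_def verts_def field_simps intro: add_pos_pos)

text \<open>In each of the nine cases the configuration is one of those settled above: separated or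
  nested tents, tents in opposite rows, uncrossed segments, or a segment ending outside the tent.
  \<open>key\<close> reads the bottom row from right to left, hence the exchanged ends in the cases
  of that row.\<close>

lemma edge_regions_disjoint:
  assumes vs: "u \<in> verts k" "u' \<in> verts k" "v \<in> verts k" "v' \<in> verts k"
    and orient: "oriented u u'" "oriented v v'" and "{u, u'} \<inter> {v, v'} = {}"
    and nc: "noncrossing {{u, u'}, {v, v'}}"
  shows "edge_region k u u' \<inter> edge_region k v v' = {}"
proof -
  have ne: "{u, u'} \<noteq> {v, v'}" using assms(7) by blast
  have nc1: "\<not> (key p < key q \<and> key q < key p' \<and> key p' < key q')"
    and nc2: "\<not> (key q < key p \<and> key p < key q' \<and> key q' < key p')"
    if "p \<in> {u, u'}" "p' \<in> {u, u'}" "q \<in> {v, v'}" "q' \<in> {v, v'}" for p p' q q'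
    using noncrossingD[OF nc _ _ ne that] noncrossingD[OF nc _ _ ne[symmetric] that(3,4,1,2)] by blast+
  have cases: thesis
    if "\<And>i j. w = (0, i) \<Longrightarrow> w' = (0, j) \<Longrightarrow> i < j \<Longrightarrow> thesis"
      "\<And>i j. w = (1, i) \<Longrightarrow> w' = (1, j) \<Longrightarrow> i < j \<Longrightarrow> thesis"
      "\<And>i j. w = (0, i) \<Longrightarrow> w' = (1, j) \<Longrightarrow> thesis"
      "w \<in> verts k" "w' \<in> verts k" "oriented w w'" for w w' thesis
    using that by (cases w; cases w') (auto simp: verts_def oriented_def)
  show ?thesis
  proof (rule cases[OF _ _ _ vs(1,2) orient(1)]; rule cases[OF _ _ _ vs(3,4) orient(2)])
    fix i j i' j' assume e: "u = (0, i)" "u' = (0, j)" "i < j" "v = (0, i')" "v' = (0, j')" "i' < j'"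
    have "\<not> (i < i' \<and> i' < j \<and> j < j')" "\<not> (i' < i \<and> i < j' \<and> j' < j)"
      using nc1[of u u' v v'] nc2[of u u' v v'] vs by (auto simp: e key_less_iff)
    then show ?thesis using e assms(7) top_tents_disjoint[of i j i' j' k] by (auto simp: edge_region_def)
  next
    fix i j i' j' assume e: "u = (1, i)" "u' = (1, j)" "i < j" "v = (1, i')" "v' = (1, j')" "i' < j'"
    have "\<not> (i < i' \<and> i' < j \<and> j < j')" "\<not> (i' < i \<and> i < j' \<and> j' < j)"
      using nc1[of u' u v' v] nc2[of u' u v' v] vs by (auto simp: e key_less_iff[where k = k])
    then show ?thesis using e assms(7) bottom_tents_disjoint[of i j i' j' k] by (auto simp: edge_region_def)
  next
    fix i j i' j' assume e: "u = (0, i)" "u' = (1, j)" "v = (0, i')" "v' = (1, j')"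
    have "\<not> (i < i' \<and> j' < j)" "\<not> (i' < i \<and> j < j')"
      using nc1[of u u' v v'] nc2[of u u' v v'] vs by (auto simp: e key_less_iff[where k = k])
    then have "i < i' \<and> j < j' \<or> i' < i \<and> j' < j" using e assms(7) by auto
    then show ?thesis using e struts_disjoint[of i i' j j'] struts_disjoint[of i' i j' j]
      by (auto simp: edge_region_def)
  next
    fix i j i' j' assume e: "u = (0, i)" "u' = (0, j)" "i < j" "v = (1, i')" "v' = (1, j')" "i' < j'"
    then show ?thesis using vs top_bottom_disjoint[of i j k i' j'] by (auto simp: edge_region_def verts_def)
  next
    fix i j i' j' assume e: "u = (1, i)" "u' = (1, j)" "i < j" "v = (0, i')" "v' = (0, j')" "i' < j'"
    then show ?thesis using vs top_bottom_disjoint[of i' j' k i j] by (auto simp: edge_region_def verts_def)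
  next
    fix i j a b assume e: "u = (0, i)" "u' = (0, j)" "i < j" "v = (0, a)" "v' = (1, b)"
    have "\<not> (i < a \<and> a < j)"
      using nc1[of u u' v v'] vs by (auto simp: e key_less_iff[where k = k])
    then have "a < i \<or> j < a" using e assms(7) by auto
    then show ?thesis using e vs top_strut_disjoint[of i j k a b] by (auto simp: edge_region_def verts_def)
  next
    fix i j a b assume e: "v = (0, i)" "v' = (0, j)" "i < j" "u = (0, a)" "u' = (1, b)"
    have "\<not> (i < a \<and> a < j)"
      using nc2[of u u' v v'] vs by (auto simp: e key_less_iff[where k = k])
    then have "a < i \<or> j < a" using e assms(7) by auto
    then show ?thesis using e vs top_strut_disjoint[of i j k a b] by (auto simp: edge_region_def verts_def)
  next
    fix i j a b assume e: "u = (1, i)" "u' = (1, j)" "i < j" "v = (0, a)" "v' = (1, b)"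
    have "\<not> (i < b \<and> b < j)"
      using nc2[of u' u v v'] vs by (auto simp: e key_less_iff[where k = k])
    then have "b < i \<or> j < b" using e assms(7) by auto
    then show ?thesis using e vs bottom_strut_disjoint[of i j k a b] by (auto simp: edge_region_def verts_def)
  next
    fix i j a b assume e: "v = (1, i)" "v' = (1, j)" "i < j" "u = (0, a)" "u' = (1, b)"
    have "\<not> (i < b \<and> b < j)"
      using nc1[of u u' v' v] vs by (auto simp: e key_less_iff[where k = k])
    then have "b < i \<or> j < b" using e assms(7) by auto
    then show ?thesis using e vs bottom_strut_disjoint[of i j k a b] by (auto simp: edge_region_def verts_def)
  qed
qed

lemma noncrossing_subset: "noncrossing d \<Longrightarrow> c \<subseteq> d \<Longrightarrow> noncrossing c"
  unfolding noncrossing_def by blast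

text \<open>Singletons need no arc, and each block of two vertices becomes one edge.
  \<open>lo\<close> and \<open>hi\<close> choose a direction for it, because the region formulas
  expect oriented ends.\<close>

lemma noncrossing_planar:
  assumes nc: "noncrossing d" and d: "d \<in> diagrams k" and small: "\<And>b. b \<in> d \<Longrightarrow> card b \<le> 2"
  shows "planar k d"
proof -
  have part: "partition_on (verts k) d" using d by (simp add: diagrams_def)
  define E where "E = {b \<in> d. card b = 2}"
  have sub: "b \<subseteq> verts k" if "b \<in> d" for b using part that by (auto simp: partition_on_def)
  have fin: "finite b" if "b \<in> d" for b
    using sub[OF that] by (rule finite_subset) (simp add: verts_def)
  have "\<exists>u v. e = {u, v} \<and> oriented u v" if e: "e \<in> E" for e
  proof -
    obtain u v where uv: "e = {u, v}" "u \<noteq> v" using e by (auto simp: E_def card_2_iff)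
    then have "oriented u v \<or> oriented v u" by (auto simp: oriented_def prod_eq_iff)
    with uv show ?thesis by blast
  qed
  then obtain lo hi where lohi: "\<And>e. e \<in> E \<Longrightarrow> e = {lo e, hi e} \<and> oriented (lo e) (hi e)" by metis
  have lv: "lo e \<in> verts k" and hv: "hi e \<in> verts k" if "e \<in> E" for e
    using lohi[OF that] sub[of e] that by (auto simp: E_def)
  define \<gamma> where "\<gamma> e = edge_curve k (lo e) (hi e)" for e
  have ends: "{pathstart (\<gamma> e), pathfinish (\<gamma> e)} = position ` e" if "e \<in> E" for e
  proof -
    have "pathstart (\<gamma> e) = position (lo e)" "pathfinish (\<gamma> e) = position (hi e)"
      by (auto simp: \<gamma>_def pathstart_def pathfinish_def edge_curve_def position_def case_prod_unfold)
    moreover have "position ` e = {position (lo e), position (hi e)}"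
      using arg_cong[OF conjunct1[OF lohi[OF that]], of "image position"] by simp
    ultimately show ?thesis by simp
  qed
  have region: "path_image (\<gamma> e) \<subseteq> edge_region k (lo e) (hi e)" if "e \<in> E" for e
    unfolding \<gamma>_def using edge_curve_region lv hv lohi that by blast
  have E1: "\<forall>e\<in>E. e \<subseteq> verts k \<and> card e = 2" using sub by (auto simp: E_def)
  have E2: "components (verts k) {(u, v). {u, v} \<in> E} = d"
  proof (rule components_eqI[OF part])
    fix C u v assume "C \<in> d" "u \<in> C" "(u, v) \<in> {(u, v). {u, v} \<in> E}"
    then have "{u, v} \<in> d" "u \<in> C \<inter> {u, v}" by (auto simp: E_def)
    then have "C = {u, v}" using part \<open>C \<in> d\<close> by (auto simp: partition_on_def dest: disjointD)
    then show "v \<in> C" by simp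
  next
    fix C u v assume C: "C \<in> d" "u \<in> C" "v \<in> C"
    show "(u, v) \<in> {(u, v). {u, v} \<in> E}\<^sup>*"
    proof (cases "u = v")
      case False
      then have "C = {u, v}" using C small[of C] fin[of C] by (intro card_seteq[symmetric]) auto
      with C False show ?thesis by (auto simp: E_def)
    qed simp
  qed
  have E3: "arc (\<gamma> e) \<and> {pathstart (\<gamma> e), pathfinish (\<gamma> e)} = position ` e \<and>
        path_image (\<gamma> e) \<subseteq> cbox (1, 0) (real k, 1) \<and>
        path_image (\<gamma> e) \<inter> position ` verts k = position ` e" if e: "e \<in> E" for e
  proof (intro conjI)
    show "arc (\<gamma> e)" unfolding \<gamma>_def using arc_edge_curve lv hv lohi e by blast
    show "path_image (\<gamma> e) \<subseteq> cbox (1, 0) (real k, 1)"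
      using region[OF e] edge_region_box[OF lv[OF e] hv[OF e]] lohi[OF e] by blast
    show "path_image (\<gamma> e) \<inter> position ` verts k = position ` e"
    proof
      show "path_image (\<gamma> e) \<inter> position ` verts k \<subseteq> position ` e"
        using region[OF e] edge_region_verts[OF lv[OF e] hv[OF e]] lohi[OF e] by blast
      have "position ` e \<subseteq> path_image (\<gamma> e)"
        using pathstart_in_path_image[of "\<gamma> e"] pathfinish_in_path_image[of "\<gamma> e"]
        by (simp flip: ends[OF e])
      then show "position ` e \<subseteq> path_image (\<gamma> e) \<inter> position ` verts k" using E1 e by blast
    qed
  qed (rule ends[OF e])
  have E4: "path_image (\<gamma> e) \<inter> path_image (\<gamma> f) \<subseteq> position ` (e \<inter> f)"
    if ef: "e \<in> E" "f \<in> E" "e \<noteq> f" for e f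
  proof -
    have "e \<inter> f = {}" using ef part by (auto simp: E_def partition_on_def disjoint_def)
    moreover have "noncrossing {e, f}" using nc ef by (auto simp: E_def intro: noncrossing_subset)
    ultimately have "edge_region k (lo e) (hi e) \<inter> edge_region k (lo f) (hi f) = {}"
      using ef lv hv lohi by (intro edge_regions_disjoint) metis+
    with region[OF ef(1)] region[OF ef(2)] show ?thesis by blast
  qed
  show ?thesis unfolding planar_def
  proof (rule exI[of _ E], rule exI[of _ \<gamma>], intro conjI ballI impI)
    show "e \<subseteq> verts k" "card e = 2" if "e \<in> E" for e using E1 that by simp_all
    show "components (verts k) {(u, v). {u, v} \<in> E} = d" by (rule E2)
  qed (use E3 E4 in simp_all)
qed

section \<open>Top and bottom halves, through strands and rank\<close>

section \<open>Halves of diagrams\<close>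

text \<open>Keeps the bottom row written as \<open>1\<close>, the form in which the rules for
  \<open>flip\<close>, \<open>shift\<close> and strands are stated.\<close>

declare One_nat_def [simp del]

lemma finite_verts [simp]: "finite (verts k)"
  by (simp add: verts_def)

lemma block_condition_card_le:
  assumes "block_condition F b" "b \<subseteq> verts k"
  shows "card b \<le> 2"
proof (cases F)
  case Planar_Rook
  have fin: "finite b" using assms(2) by (rule finite_subset) simp
  have "b = b \<inter> {0} \<times> UNIV \<union> b \<inter> {1} \<times> UNIV" using assms(2) by (auto simp: verts_def)
  then have "card b \<le> card (b \<inter> {0} \<times> UNIV) + card (b \<inter> {1} \<times> UNIV)" by (metis card_Un_le)
  with assms(1) Planar_Rook show ?thesis by auto
qed (use assms in auto)

text \<open>Isolates the common ground of the three families on which counting of cups and strands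
  rests. Composites enter those lemmas through the assumption that they are slim again.\<close>

definition slim :: "nat \<Rightarrow> diagram set" where
  "slim k = {d \<in> diagrams k. \<forall>b\<in>d. card b \<le> 2}"

text \<open>The topology ends here: later arguments see planarity only as
  \<open>noncrossing\<close>.\<close>

lemma diagram_basis_iff:
  "d \<in> diagram_basis F k \<longleftrightarrow> d \<in> diagrams k \<and> noncrossing d \<and> (\<forall>b\<in>d. block_condition F b)"
proof -
  have "card b \<le> 2" if "d \<in> diagrams k" "\<forall>b\<in>d. block_condition F b" "b \<in> d" for b
    using that by (auto intro!: block_condition_card_le[of F b k] simp: diagrams_def partition_on_def)
  then show ?thesis
    unfolding diagram_basis_def using planar_noncrossing noncrossing_planar by blast
qed

lemma basis_slim: "d \<in> diagram_basis F k \<Longrightarrow> d \<in> slim k"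
  by (auto simp: diagram_basis_iff slim_def diagrams_def partition_on_def intro!: block_condition_card_le[of F _ k])

lemma basis_noncrossing: "d \<in> diagram_basis F k \<Longrightarrow> noncrossing d"
  by (simp add: diagram_basis_iff)

lemma slim_diagrams: "d \<in> slim k \<Longrightarrow> d \<in> diagrams k"
  by (simp add: slim_def)

lemma diagrams_eqD: "d \<in> diagrams k \<Longrightarrow> b \<in> d \<Longrightarrow> c \<in> d \<Longrightarrow> u \<in> b \<Longrightarrow> u \<in> c \<Longrightarrow> b = c"
  by (auto simp: diagrams_def partition_on_def dest: disjointD)

lemma diagrams_block_subset: "d \<in> diagrams k \<Longrightarrow> b \<in> d \<Longrightarrow> b \<subseteq> verts k"
  by (auto simp: diagrams_def partition_on_def)

lemma diagrams_nonempty: "d \<in> diagrams k \<Longrightarrow> b \<in> d \<Longrightarrow> b \<noteq> {}"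
  by (auto simp: diagrams_def partition_on_def)

lemma diagrams_cover: "d \<in> diagrams k \<Longrightarrow> u \<in> verts k \<Longrightarrow> \<exists>b\<in>d. u \<in> b"
  by (auto simp: diagrams_def partition_on_def)

subsection \<open>Reflection\<close>

lemma flip_simps [simp]: "flip (0, i) = (1, i)" "flip (1, i) = (0, i)"
  by (simp_all add: flip_def)

text \<open>The row number is subtracted in the natural numbers, so \<open>flip\<close> is an
  involution only on rows 0 and 1. This is the source of the vertex assumptions in the lemmas about
  reflection.\<close>

lemma flip_flip: "u \<in> verts k \<Longrightarrow> flip (flip u) = u"
  by (auto simp: verts_def)

lemma flip_verts: "u \<in> verts k \<Longrightarrow> flip u \<in> verts k"
  by (auto simp: verts_def)

lemma flip_flip_block:
  assumes "b \<subseteq> verts k"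
  shows "flip ` flip ` b = b"
proof -
  have "(\<lambda>u. flip (flip u)) ` b = (\<lambda>u. u) ` b"
    using assms flip_flip by (intro image_cong) auto
  then show ?thesis by (simp add: image_image)
qed

lemma inj_on_flip: "inj_on flip (verts k)"
  by (rule inj_on_inverseI[where g = flip]) (rule flip_flip)

lemma flip_flip_diagram:
  assumes "d \<in> diagrams k"
  shows "flip_diagram (flip_diagram d) = d"
proof -
  have "(\<lambda>b. flip ` flip ` b) ` d = (\<lambda>b. b) ` d"
    using flip_flip_block diagrams_block_subset[OF assms] by (intro image_cong) blast+
  then show ?thesis unfolding flip_diagram_def by (simp only: image_image image_ident)
qed

lemma flip_image_verts: "flip ` verts k = verts k"
proof
  show "flip ` verts k \<subseteq> verts k" using flip_verts by blast
  show "verts k \<subseteq> flip ` verts k" by (metis flip_flip flip_verts image_eqI subsetI)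
qed

lemma flip_diagrams: "d \<in> diagrams k \<Longrightarrow> flip_diagram d \<in> diagrams k"
proof -
  assume d: "d \<in> diagrams k"
  then have "partition_on (flip ` verts k) ((`) flip ` d - {{}})"
    using partition_on_inj_image[OF _ inj_on_flip] by (simp add: diagrams_def)
  moreover have "{} \<notin> (`) flip ` d" using d by (auto simp: diagrams_def partition_on_def)
  ultimately show ?thesis by (simp add: flip_image_verts diagrams_def flip_diagram_def)
qed

lemma card_flip: "b \<subseteq> verts k \<Longrightarrow> card (flip ` b) = card b"
  using inj_on_flip by (meson card_image inj_on_subset)

lemma slim_flip: "d \<in> slim k \<Longrightarrow> flip_diagram d \<in> slim k"
proof -
  assume d: "d \<in> slim k"
  then have "card (flip ` b) \<le> 2" if "b \<in> d" for b
    using that card_flip[OF diagrams_block_subset] by (auto simp: slim_def)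
  moreover have "flip_diagram d \<in> diagrams k" using d by (simp add: slim_def flip_diagrams)
  ultimately show ?thesis by (auto simp: slim_def flip_diagram_def)
qed

lemma key_flip: "u \<in> verts k \<Longrightarrow> key (flip u) = - key u"
  by (auto simp: verts_def key_def)

text \<open>Negating the keys reverses an alternating pattern, so it reappears with the two blocks
  exchanged.\<close>

lemma noncrossing_flip:
  assumes "noncrossing d" "d \<in> diagrams k"
  shows "noncrossing (flip_diagram d)"
  unfolding noncrossing_def
proof (intro ballI impI notI)
  fix b c u u' v v'
  assume "b \<in> flip_diagram d" "c \<in> flip_diagram d" "b \<noteq> c" "u \<in> b" "u' \<in> b" "v \<in> c" "v' \<in> c"
    and keys: "key u < key v \<and> key v < key u' \<and> key u' < key v'"
  then obtain b' c' where bc: "b' \<in> d" "c' \<in> d" "b = flip ` b'" "c = flip ` c'" "b' \<noteq> c'"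
    by (auto simp: flip_diagram_def)
  with \<open>u \<in> b\<close> \<open>u' \<in> b\<close> \<open>v \<in> c\<close> \<open>v' \<in> c\<close> obtain w w' z z' where
    w: "w \<in> b'" "w' \<in> b'" "z \<in> c'" "z' \<in> c'" "u = flip w" "u' = flip w'" "v = flip z" "v' = flip z'"
    by blast
  then have "w \<in> verts k" "w' \<in> verts k" "z \<in> verts k" "z' \<in> verts k"
    using bc assms(2) diagrams_block_subset by blast+
  then have "key z' < key w'" "key w' < key z" "key z < key w" using keys w by (simp_all add: key_flip)
  then show False using noncrossingD[OF assms(1) bc(2,1) bc(5)[symmetric]] w by blast
qed

lemma block_condition_flip:
  assumes "b \<subseteq> verts k"
  shows "block_condition F (flip ` b) = block_condition F b"
proof -
  have *: "flip ` b \<inter> P = flip ` (b \<inter> Q)" if "\<And>u. u \<in> b \<Longrightarrow> flip u \<in> P \<longleftrightarrow> u \<in> Q" for P Q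
    using that by blast
  have "flip ` b \<inter> {0} \<times> UNIV = flip ` (b \<inter> {1} \<times> UNIV)" "flip ` b \<inter> {1} \<times> UNIV = flip ` (b \<inter> {0} \<times> UNIV)"
    using assms by (intro *; auto simp: verts_def)+
  moreover have "card (flip ` (b \<inter> X)) = card (b \<inter> X)" for X
    using assms by (intro card_flip[of _ k]) auto
  ultimately show ?thesis by (cases F) (auto simp: card_flip[OF assms])
qed

lemma basis_flip: "d \<in> diagram_basis F k \<Longrightarrow> flip_diagram d \<in> diagram_basis F k"
proof -
  assume d: "d \<in> diagram_basis F k"
  then have "d \<in> diagrams k" by (simp add: diagram_basis_iff)
  then have "\<forall>b\<in>flip_diagram d. block_condition F b"
    using d block_condition_flip[OF diagrams_block_subset] by (auto simp: diagram_basis_iff flip_diagram_def)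
  with d noncrossing_flip flip_diagrams show ?thesis by (auto simp: diagram_basis_iff)
qed

subsection \<open>Cups and through strands\<close>

abbreviation strand :: "nat \<Rightarrow> nat \<Rightarrow> vertex set" where
  "strand i j \<equiv> {(0, i), (1, j)}"

lemma strand_eq_iff [simp]:
  "strand i j = strand i' j' \<longleftrightarrow> i = i' \<and> j = j'"
  by (auto simp: doubleton_eq_iff)

text \<open>Isolated top vertices count as cups, so this set encodes the whole top half of a
  diagram. The bottom half is always accessed as the cups of the flipped diagram.\<close>

definition cups :: "diagram \<Rightarrow> diagram" where
  "cups d = {b \<in> d. b \<subseteq> {0} \<times> UNIV}"

text \<open>These are the upper ends of the through strands: if blocks have at most two vertices, a
  top vertex outside all cups lies on a strand. The definition depends on the cups alone, so
  diagrams with equal top halves share it.\<close>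

definition tops :: "nat \<Rightarrow> diagram \<Rightarrow> nat set" where
  "tops k d = {i \<in> {1..k}. (0, i) \<notin> \<Union>(cups d)}"

lemma finite_tops [simp]: "finite (tops k d)"
  by (rule finite_subset[of _ "{1..k}"]) (auto simp only: tops_def)

lemma flip_cups_iff:
  assumes "d \<in> diagrams k" "b \<subseteq> verts k"
  shows "flip ` b \<in> cups (flip_diagram d) \<longleftrightarrow> b \<in> d \<and> b \<subseteq> {1} \<times> UNIV"
proof -
  have "b \<in> d" if fb: "flip ` b \<in> flip_diagram d"
  proof -
    obtain c where c: "c \<in> d" "flip ` b = flip ` c" using fb unfolding flip_diagram_def by (elim imageE) blast
    then have "flip ` flip ` b = flip ` flip ` c" by simp
    then have "b = c"
      unfolding flip_flip_block[OF assms(2)] flip_flip_block[OF diagrams_block_subset[OF assms(1) c(1)]] .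
    with c show ?thesis by simp
  qed
  then have "flip ` b \<in> flip_diagram d \<longleftrightarrow> b \<in> d" by (auto simp: flip_diagram_def)
  moreover have "flip u \<in> {0} \<times> UNIV \<longleftrightarrow> u \<in> {1} \<times> UNIV" if "u \<in> b" for u
    using that assms by (auto simp: verts_def)
  then have "flip ` b \<subseteq> {0} \<times> UNIV \<longleftrightarrow> b \<subseteq> {1} \<times> UNIV" unfolding image_subset_iff subset_iff[of b] by metis
  ultimately show ?thesis by (simp add: cups_def)
qed

lemma strand_block:
  assumes "d \<in> slim k" "b \<in> d" "(0, i) \<in> b" "(1, j) \<in> b"
  shows "b = strand i j"
proof -
  have "finite b" using assms(1,2) diagrams_block_subset slim_diagrams finite_subset finite_verts by metis
  moreover have "card b \<le> 2" using assms(1,2) by (auto simp: slim_def)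
  ultimately show ?thesis using assms(3,4) by (intro card_seteq[symmetric]) auto
qed

lemma tops_strand:
  assumes "d \<in> slim k" "i \<in> tops k d"
  obtains j where "strand i j \<in> d"
proof -
  have i: "(0, i) \<in> verts k" using assms(2) by (auto simp: tops_def verts_def)
  obtain b where b: "b \<in> d" "(0, i) \<in> b" using diagrams_cover[OF slim_diagrams[OF assms(1)] i] by auto
  then have "\<not> b \<subseteq> {0} \<times> UNIV" using assms(2) by (auto simp: tops_def cups_def)
  moreover have "b \<subseteq> verts k" using b assms(1) slim_diagrams diagrams_block_subset by blast
  ultimately obtain j where "(1, j) \<in> b" by (auto simp: verts_def)
  then have "b = strand i j" by (rule strand_block[OF assms(1) b])
  with b that show ?thesis by simp
qed

lemma strand_range:
  assumes "d \<in> diagrams k" "strand i j \<in> d"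
  shows "i \<in> {1..k}" "j \<in> {1..k}"
  using diagrams_block_subset[OF assms] by (auto simp: verts_def)

lemma strand_tops:
  assumes "d \<in> diagrams k" "strand i j \<in> d"
  shows "i \<in> tops k d"
proof -
  have "(0, i) \<notin> b" if "b \<in> cups d" for b
  proof
    assume "(0, i) \<in> b"
    moreover have "b \<in> d" using that by (simp add: cups_def)
    ultimately have "b = strand i j" using diagrams_eqD[OF assms(1) _ assms(2), of b "(0, i)"] by simp
    then show False using that by (auto simp: cups_def)
  qed
  then show ?thesis using strand_range[OF assms] by (auto simp: tops_def)
qed

lemma strand_flip: "strand i j \<in> d \<Longrightarrow> strand j i \<in> flip_diagram d"
proof -
  assume st: "strand i j \<in> d"
  have "flip ` strand i j = strand j i" by auto
  with st show ?thesis unfolding flip_diagram_def by (metis image_eqI)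
qed

lemma strand_flip_tops:
  assumes "d \<in> diagrams k" "strand i j \<in> d"
  shows "j \<in> tops k (flip_diagram d)"
  using strand_tops[OF flip_diagrams[OF assms(1)] strand_flip[OF assms(2)]] .

lemma tops_flip_strand:
  assumes "d \<in> slim k" "j \<in> tops k (flip_diagram d)"
  obtains i where "strand i j \<in> d"
proof -
  obtain i where "strand j i \<in> flip_diagram d" using tops_strand[OF slim_flip[OF assms(1)] assms(2)] .
  from strand_flip[OF this] that show ?thesis by (simp add: flip_flip_diagram[OF slim_diagrams[OF assms(1)]])
qed

lemma block_cases:
  assumes "d \<in> slim k" "b \<in> d"
  obtains "b \<in> cups d" | "flip ` b \<in> cups (flip_diagram d)" | i j where "b = strand i j"
proof -
  have b: "b \<subseteq> verts k" using assms slim_diagrams diagrams_block_subset by blast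
  consider "b \<subseteq> {0} \<times> UNIV" | "b \<subseteq> {1} \<times> UNIV" | i j where "(0, i) \<in> b" "(1, j) \<in> b"
  proof -
    have "b \<subseteq> {0} \<times> UNIV \<or> b \<subseteq> {1} \<times> UNIV" if "\<not> (\<exists>i j. (0, i) \<in> b \<and> (1, j) \<in> b)"
      using that b by (fastforce simp: verts_def)
    then show ?thesis using that by blast
  qed
  then show ?thesis
  proof cases
    case 1
    then show ?thesis using assms that(1) by (simp add: cups_def)
  next
    case 2
    then show ?thesis using that(2) assms flip_cups_iff[OF slim_diagrams[OF assms(1)] b] by simp
  next
    case 3
    then have "b = strand i j" by (rule strand_block[OF assms])
    then show ?thesis by (rule that(3))
  qed
qed

lemma propagating_slim:
  assumes "d \<in> slim k"
  shows "{b \<in> d. propagating b} = {strand i j | i j. strand i j \<in> d}"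
proof -
  have 1: "\<exists>i j. b = strand i j" if b: "b \<in> d" "propagating b" for b
  proof -
    obtain i j where "(0, i) \<in> b" "(1, j) \<in> b" using b(2) by (force simp: propagating_def)
    with strand_block[OF assms b(1)] show ?thesis by blast
  qed
  have 2: "propagating (strand i j)" for i j by (simp add: propagating_def)
  have "b \<in> d \<and> propagating b \<longleftrightarrow> (\<exists>i j. b = strand i j \<and> strand i j \<in> d)" for b
    using 1[of b] 2 by metis
  then show ?thesis by (rule Collect_cong)
qed

text \<open>A propagating block is a strand and is determined by its upper end. Hence the rank can
  be read off from one half of the diagram.\<close>

lemma rank_tops:
  assumes d: "d \<in> slim k"
  shows "diagram_rank d = card (tops k d)"
proof -
  define S where "S = {(i, j). strand i j \<in> d}"
  define h :: "nat \<times> nat \<Rightarrow> vertex set" where "h = (\<lambda>(i, j). strand i j)"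
  have S: "(i, j) \<in> S \<longleftrightarrow> strand i j \<in> d" for i j by (simp add: S_def)
  have "b \<in> {b \<in> d. propagating b} \<longleftrightarrow> b \<in> h ` S" for b
    unfolding propagating_slim[OF d] image_iff Bex_def by (simp add: S h_def conj_commute)
  then have "{b \<in> d. propagating b} = h ` S" by (rule set_eqI)
  moreover have "inj_on h S" by (rule inj_onI) (simp add: h_def case_prod_unfold prod_eq_iff)
  ultimately have "diagram_rank d = card S" by (simp add: diagram_rank_def card_image)
  moreover have "inj_on fst S"
  proof (rule inj_onI)
    fix p q assume "p \<in> S" "q \<in> S" "fst p = fst q"
    moreover from this obtain i j j' where pq: "p = (i, j)" "q = (i, j')" by (cases p; cases q) auto
    ultimately have "strand i j = strand i j'"
      unfolding pq S using diagrams_eqD[OF slim_diagrams[OF d], of "strand i j" "strand i j'" "(0, i)"] by simp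
    then show "p = q" by (simp add: pq)
  qed
  moreover have "fst ` S = tops k d"
  proof
    show "fst ` S \<subseteq> tops k d" using strand_tops[OF slim_diagrams[OF d]] S by force
    show "tops k d \<subseteq> fst ` S"
    proof
      fix i assume "i \<in> tops k d"
      then obtain j where "(i, j) \<in> S" unfolding S using tops_strand[OF d] by blast
      then show "i \<in> fst ` S" by force
    qed
  qed
  ultimately show ?thesis by (metis card_image)
qed

lemma propagating_flip:
  assumes "b \<subseteq> verts k"
  shows "propagating (flip ` b) = propagating b"
proof -
  have *: "fst ` flip ` b = (\<lambda>s. 1 - s) ` fst ` b" by (auto simp: flip_def image_image case_prod_unfold)
  have cases: "A = {} \<or> A = {0} \<or> A = {1} \<or> A = {0, 1}" if "A \<subseteq> {0, 1}" for A :: "nat set"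
    using that by blast
  have "fst ` b \<subseteq> {0, 1}" using assms by (auto simp: verts_def)
  from cases[OF this] show ?thesis by (elim disjE) (simp_all add: propagating_def * del: image_is_empty)
qed

lemma rank_flip:
  assumes "d \<in> diagrams k"
  shows "diagram_rank (flip_diagram d) = diagram_rank d"
proof -
  have "propagating (flip ` b) = propagating b" if "b \<in> d" for b
    using propagating_flip[OF diagrams_block_subset[OF assms that]] .
  then have "{b \<in> flip_diagram d. propagating b} = (`) flip ` {b \<in> d. propagating b}"
    by (auto simp: flip_diagram_def)
  moreover have "inj_on ((`) flip) {b \<in> d. propagating b}"
    using assms diagrams_block_subset flip_flip_block by (intro inj_on_inverseI[where g = "(`) flip"]) blast
  ultimately show ?thesis by (simp add: diagram_rank_def card_image)
qed

lemma rank_antimono: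
  assumes "c \<in> slim k" "d \<in> slim k" "cups c \<subseteq> cups d"
  shows "diagram_rank d \<le> diagram_rank c"
  unfolding rank_tops[OF assms(1)] rank_tops[OF assms(2)]
  using assms(3) by (intro card_mono) (auto simp: tops_def)

text \<open>More cups leave fewer free points, so comparable ranks force the free points to
  coincide. Every cup of \<open>d\<close> then meets some cup of \<open>c\<close>, which is a block
  of \<open>d\<close> too, and the two are equal. This turns the inclusions between halves in a
  product into equalities whenever rank is preserved.\<close>

lemma cups_eqI:
  assumes "c \<in> slim k" "d \<in> slim k" "cups c \<subseteq> cups d" "diagram_rank c \<le> diagram_rank d"
  shows "cups c = cups d"
proof
  have "tops k d \<subseteq> tops k c" using assms(3) by (auto simp: tops_def)
  then have eq: "tops k d = tops k c"
    using assms(4) unfolding rank_tops[OF assms(1)] rank_tops[OF assms(2)] by (intro card_seteq) auto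
  show "cups d \<subseteq> cups c"
  proof
    fix b assume b: "b \<in> cups d"
    then obtain u where u: "u \<in> b"
      using diagrams_nonempty[OF slim_diagrams[OF assms(2)], of b] by (auto simp: cups_def)
    have "b \<subseteq> verts k" using b diagrams_block_subset[OF slim_diagrams[OF assms(2)]] unfolding cups_def by blast
    then obtain i where i: "u = (0, i)" "i \<in> {1..k}"
    proof -
      have "u \<in> verts k" "u \<in> {0} \<times> UNIV" using u b \<open>b \<subseteq> verts k\<close> unfolding cups_def by blast+
      then show thesis using that by (auto simp: verts_def)
    qed
    then have "i \<notin> tops k d" using u b by (auto simp: tops_def)
    then obtain b' where b': "b' \<in> cups c" "u \<in> b'" using i eq by (auto simp: tops_def)
    then have "b' \<in> d" "b \<in> d" using b assms(3) unfolding cups_def by blast+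
    then have "b' = b" using diagrams_eqD[OF slim_diagrams[OF assms(2)] _ _ b'(2) u] by simp
    with b' show "b \<in> cups c" by simp
  qed
qed (rule assms(3))

lemma cups_eq_tops: "cups c = cups d \<Longrightarrow> tops k c = tops k d"
  by (simp add: tops_def)

subsection \<open>Noncrossing diagrams are determined by their halves\<close>

text \<open>The position of \<open>i\<close> in the increasing enumeration of \<open>P\<close>,
  counted from 0. Noncrossing strands preserve this position, so it replaces an explicit order
  isomorphism between free top and bottom points.\<close>

definition index_in :: "nat set \<Rightarrow> nat \<Rightarrow> nat" where
  "index_in P i = card {j \<in> P. j < i}"

lemma index_in_less: "finite P \<Longrightarrow> i \<in> P \<Longrightarrow> i < j \<Longrightarrow> index_in P i < index_in P j"
  unfolding index_in_def by (intro psubset_card_mono) auto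

lemma index_in_inj: "finite P \<Longrightarrow> i \<in> P \<Longrightarrow> j \<in> P \<Longrightarrow> index_in P i = index_in P j \<Longrightarrow> i = j"
  by (metis index_in_less less_irrefl linorder_neqE_nat)

lemma index_in_image:
  assumes "finite P"
  shows "index_in P ` P = {..<card P}"
proof -
  have "index_in P ` P \<subseteq> {..<card P}"
    using assms by (auto simp: index_in_def intro!: psubset_card_mono)
  moreover have "card (index_in P ` P) = card P"
    using index_in_inj[OF assms] by (intro card_image inj_onI) auto
  ultimately show ?thesis by (intro card_subset_eq) auto
qed

text \<open>If \<open>j'\<close> were left of \<open>j\<close>, the vertices (0, i), (0, i'), (1,
  j), (1, j') would alternate, since the bottom row is met from right to left.\<close>

lemma strands_mono:
  assumes nc: "noncrossing d" and d: "d \<in> diagrams k"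
    and st: "strand i j \<in> d" "strand i' j' \<in> d" and "i < i'"
  shows "j < j'"
proof (rule ccontr)
  assume "\<not> j < j'"
  have ne: "strand i j \<noteq> strand i' j'" using \<open>i < i'\<close> by auto
  then have "j \<noteq> j'" using diagrams_eqD[OF d st, of "(1, j)"] by blast
  with \<open>\<not> j < j'\<close> have "j' < j" by simp
  have "key (0, i) < key (0, i')" "key (0, i') < key (1, j)" "key (1, j) < key (1, j')"
    using strand_range[OF d st(1)] strand_range[OF d st(2)] \<open>i < i'\<close> \<open>j' < j\<close>
    by (auto simp: key_def field_simps intro: add_pos_pos)
  then show False using noncrossingD[OF nc st ne] by blast
qed

lemma strands_mono_iff:
  assumes nc: "noncrossing d" and d: "d \<in> diagrams k"
    and st: "strand i j \<in> d" "strand i' j' \<in> d"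
  shows "j < j' \<longleftrightarrow> i < i'"
proof -
  have "j = j'" if "i = i'" using diagrams_eqD[OF d st, of "(0, i)"] that by (auto simp: doubleton_eq_iff)
  then show ?thesis
    using strands_mono[OF nc d st] strands_mono[OF nc d st(2,1)] by (metis less_irrefl linorder_neqE_nat less_trans)
qed

text \<open>The strands to the left of the given one match the free top points before
  \<open>i\<close> bijectively with the free bottom points before \<open>j\<close>.\<close>

lemma strand_index:
  assumes nc: "noncrossing d" and d: "d \<in> slim k" and st: "strand i j \<in> d"
  shows "index_in (tops k d) i = index_in (tops k (flip_diagram d)) j"
proof -
  note D = slim_diagrams[OF d]
  have "\<forall>i\<in>tops k d. \<exists>j. strand i j \<in> d" using tops_strand[OF d] by blast
  then obtain f where f: "\<And>i. i \<in> tops k d \<Longrightarrow> strand i (f i) \<in> d" by (auto dest!: bchoice)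
  have "bij_betw f {i' \<in> tops k d. i' < i} {j' \<in> tops k (flip_diagram d). j' < j}"
    unfolding bij_betw_def
  proof
    show "inj_on f {i' \<in> tops k d. i' < i}"
    proof (rule inj_onI)
      fix a b assume "a \<in> {i' \<in> tops k d. i' < i}" "b \<in> {i' \<in> tops k d. i' < i}" "f a = f b"
      then show "a = b" using diagrams_eqD[OF D f[of a] f[of b], of "(1, f a)"] by (auto simp: doubleton_eq_iff)
    qed
    show "f ` {i' \<in> tops k d. i' < i} = {j' \<in> tops k (flip_diagram d). j' < j}"
    proof
      show "f ` {i' \<in> tops k d. i' < i} \<subseteq> {j' \<in> tops k (flip_diagram d). j' < j}"
        using strand_flip_tops[OF D f] strands_mono[OF nc D f st] by auto
      show "{j' \<in> tops k (flip_diagram d). j' < j} \<subseteq> f ` {i' \<in> tops k d. i' < i}"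
      proof clarify
        fix j' assume j': "j' \<in> tops k (flip_diagram d)" "j' < j"
        then obtain i' where i': "strand i' j' \<in> d" using tops_flip_strand[OF d] by blast
        then have t: "i' \<in> tops k d" using strand_tops[OF D] by blast
        have "f i' = j'" using diagrams_eqD[OF D f[OF t] i', of "(0, i')"] by (auto simp: doubleton_eq_iff)
        moreover have "i' < i" using strands_mono_iff[OF nc D i' st] j' by simp
        ultimately show "j' \<in> f ` {i' \<in> tops k d. i' < i}" using t by auto
      qed
    qed
  qed
  then show ?thesis unfolding index_in_def by (rule bij_betw_same_card)
qed

text \<open>Blocks within a row are prescribed by the halves. A strand starting at \<open>i\<close>
  must end at the free bottom point of the same index, so the strands leave no choice
  either.\<close>

lemma halves_subset:
  assumes d: "d \<in> diagram_basis F k" and d': "d' \<in> diagram_basis F k"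
    and halves: "cups d = cups d'" "cups (flip_diagram d) = cups (flip_diagram d')"
  shows "d \<subseteq> d'"
proof
  fix b assume b: "b \<in> d"
  note s = basis_slim[OF d] and s' = basis_slim[OF d']
  from s b show "b \<in> d'"
  proof (cases rule: block_cases)
    case 1
    then show ?thesis using halves by (auto simp: cups_def)
  next
    case 2
    then show ?thesis
      using halves flip_cups_iff[OF slim_diagrams[OF s'], of b] diagrams_block_subset[OF slim_diagrams[OF s] b] by auto
  next
    case (3 i j)
    then have st: "strand i j \<in> d" using b by simp
    then have "i \<in> tops k d'" using strand_tops[OF slim_diagrams[OF s]] cups_eq_tops[OF halves(1), of k] by auto
    then obtain j' where st': "strand i j' \<in> d'" using tops_strand[OF s'] by blast
    have "index_in (tops k (flip_diagram d)) j = index_in (tops k (flip_diagram d)) j'"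
      using strand_index[OF basis_noncrossing[OF d] s st] strand_index[OF basis_noncrossing[OF d'] s' st']
        cups_eq_tops[OF halves(1), of k] cups_eq_tops[OF halves(2), of k] by simp
    moreover have "j \<in> tops k (flip_diagram d)" "j' \<in> tops k (flip_diagram d)"
      using strand_flip_tops[OF slim_diagrams[OF s] st] strand_flip_tops[OF slim_diagrams[OF s'] st']
        cups_eq_tops[OF halves(2), of k] by auto
    ultimately have "j = j'" using index_in_inj finite_tops by blast
    with st' 3 show ?thesis by simp
  qed
qed

lemma halves_eqI:
  assumes "d \<in> diagram_basis F k" "d' \<in> diagram_basis F k"
    and "cups d = cups d'" "cups (flip_diagram d) = cups (flip_diagram d')"
  shows "d = d'"
  using halves_subset[OF assms] halves_subset[OF assms(2,1) assms(3,4)[symmetric]] by (rule equalityI)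

section \<open>Connectivity in stacks and the halves of a product\<close>

section \<open>Stacking diagrams\<close>

lemma shift_simps [simp]: "shift n (s, i) = (n + s, i)"
  by (simp add: shift_def)

lemma inj_shift: "inj (shift n)"
  by (rule injI) (simp add: shift_def case_prod_unfold prod_eq_iff)

abbreviation conn :: "diagram list \<Rightarrow> vertex \<Rightarrow> vertex \<Rightarrow> bool" where
  "conn ds u v \<equiv> (u, v) \<in> (stack_rel ds)\<^sup>*"

abbreviation component :: "diagram list \<Rightarrow> vertex \<Rightarrow> vertex set" where
  "component ds u \<equiv> (stack_rel ds)\<^sup>* `` {u}"

lemma stack_relI: "m < length ds \<Longrightarrow> b \<in> ds ! m \<Longrightarrow> u \<in> b \<Longrightarrow> v \<in> b \<Longrightarrow> (shift m u, shift m v) \<in> stack_rel ds"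
  unfolding stack_rel_def by blast

lemma stack_relE:
  assumes "(w, z) \<in> stack_rel ds"
  obtains m b u v where "m < length ds" "b \<in> ds ! m" "u \<in> b" "v \<in> b" "w = shift m u" "z = shift m v"
  using assms unfolding stack_rel_def by blast

lemma stack_rel2E:
  assumes "(w, z) \<in> stack_rel [a, b]"
  obtains c where "c \<in> a" "w \<in> c" "z \<in> c"
  | c u v where "c \<in> b" "u \<in> c" "v \<in> c" "w = shift 1 u" "z = shift 1 v"
  using assms
proof (rule stack_relE)
  fix m c u v assume m: "m < length [a, b]" and *: "c \<in> [a, b] ! m" "u \<in> c" "v \<in> c" "w = shift m u" "z = shift m v"
  from m have "m = 0 \<or> m = 1" by auto
  then show thesis
  proof
    assume "m = 0"
    with * that(1)[of c] show thesis by (cases u; cases v) simp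
  next
    assume "m = 1"
    with * that(2)[of c u v] show thesis by simp
  qed
qed

lemma stack_rel_top: "c \<in> a \<Longrightarrow> u \<in> c \<Longrightarrow> v \<in> c \<Longrightarrow> (u, v) \<in> stack_rel (a # ds)"
  using stack_relI[of 0 "a # ds" c u v] by (cases u; cases v) simp

lemma stack_rel_second: "c \<in> b \<Longrightarrow> u \<in> c \<Longrightarrow> v \<in> c \<Longrightarrow> (shift 1 u, shift 1 v) \<in> stack_rel (a # b # ds)"
  using stack_relI[of 1 "a # b # ds" c u v] by simp

lemma sym_stack_rel: "sym (stack_rel ds)"
  by (rule symI) (blast elim: stack_relE intro: stack_relI)

lemma conn_sym: "conn ds u v \<Longrightarrow> conn ds v u"
  using sym_rtrancl[OF sym_stack_rel] by (rule symD)

lemma component_eq: "conn ds u v \<Longrightarrow> component ds u = component ds v"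
proof -
  assume uv: "conn ds u v"
  have "conn ds u w \<longleftrightarrow> conn ds v w" for w
    using rtrancl_trans[OF conn_sym[OF uv]] rtrancl_trans[OF uv] by blast
  then show ?thesis by (simp add: set_eq_iff Image_singleton_iff)
qed

lemma stack_rel_range:
  assumes "\<And>d. d \<in> set ds \<Longrightarrow> d \<in> diagrams k" "(w, z) \<in> stack_rel ds"
  shows "z \<in> {..length ds} \<times> {1..k}"
  using assms(2)
proof (rule stack_relE)
  fix m b u v assume *: "m < length ds" "b \<in> ds ! m" "u \<in> b" "v \<in> b" "w = shift m u" "z = shift m v"
  then have "v \<in> verts k" using assms(1)[OF nth_mem] diagrams_block_subset by blast
  with * show ?thesis by (auto simp: verts_def)
qed

lemma conn_range:
  assumes "\<And>d. d \<in> set ds \<Longrightarrow> d \<in> diagrams k" "conn ds u v" "u \<in> {..length ds} \<times> {1..k}"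
  shows "v \<in> {..length ds} \<times> {1..k}"
  using assms(2,3) stack_rel_range[OF assms(1)] by (cases rule: rtranclE) auto

lemma conn_range2:
  assumes "a \<in> diagrams k" "b \<in> diagrams k" "conn [a, b] u v" "u \<in> {..2} \<times> {1..k}"
  shows "v \<in> {..2} \<times> {1..k}"
proof -
  have "d \<in> diagrams k" if "d \<in> set [a, b]" for d using that assms by auto
  from conn_range[OF this assms(3)] assms(4) show ?thesis by (simp add: numeral_2_eq_2)
qed

lemma component_eqI:
  assumes "u \<in> X" "\<And>v w. v \<in> X \<Longrightarrow> (v, w) \<in> stack_rel ds \<Longrightarrow> w \<in> X" "\<And>v. v \<in> X \<Longrightarrow> conn ds u v"
  shows "component ds u = X"
proof
  have "w \<in> X" if "conn ds u w" for w
    using that by (induction rule: rtrancl_induct) (use assms in auto)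
  then show "component ds u \<subseteq> X" by blast
  show "X \<subseteq> component ds u" using assms(3) by blast
qed

lemma stack_components_iff: "c \<in> stack_components k ds \<longleftrightarrow> (\<exists>u\<in>{..length ds} \<times> {1..k}. c = component ds u)"
  unfolding stack_components_def components_def quotient_def by blast

lemma outer_iff: "n \<noteq> 0 \<Longrightarrow> (s, i) \<in> outer n c \<longleftrightarrow> s = 0 \<and> (0, i) \<in> c \<or> s = 1 \<and> (n, i) \<in> c"
  unfolding outer_def by (force simp: image_iff)

definition stretch :: "vertex \<Rightarrow> vertex" where
  "stretch = (\<lambda>(s, i). (2 * s, i))"

lemma stretch_simps [simp]: "stretch (s, i) = (2 * s, i)"
  by (simp add: stretch_def)

lemma mem_outer2: "u \<in> verts k \<Longrightarrow> u \<in> outer 2 c \<longleftrightarrow> stretch u \<in> c"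
  by (auto simp: verts_def outer_iff)

text \<open>A component that is not confined to the middle row contains an outer vertex. Indexing
  the blocks by such vertices makes the deletion of middle components disappear, and blocks of a
  composite can be handled as connectivity classes before the composite is known to be a basis
  diagram.\<close>

lemma compose_iff:
  assumes "a \<in> diagrams k" "b \<in> diagrams k"
  shows "X \<in> compose_diagram k a b \<longleftrightarrow> (\<exists>u\<in>verts k. X = outer 2 (component [a, b] (stretch u)))"
proof
  assume "X \<in> compose_diagram k a b"
  then obtain c where c: "X = outer 2 c" "c \<in> stack_components k [a, b]" "\<not> c \<subseteq> {1} \<times> UNIV"
    unfolding compose_diagram_def by blast
  then obtain w where w: "w \<in> {..length [a, b]} \<times> {1..k}" and X: "X = outer 2 (component [a, b] w)"
    and mid: "\<not> component [a, b] w \<subseteq> {1} \<times> UNIV"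
    unfolding stack_components_iff by blast
  from mid obtain m i where mi: "conn [a, b] w (m, i)" "m \<noteq> 1" by auto
  then have "(m, i) \<in> {..2} \<times> {1..k}" using conn_range2[OF assms mi(1)] w by (simp add: numeral_2_eq_2)
  with mi have "m = 0 \<or> m = 2" "i \<in> {1..k}" by auto
  then have "(m div 2, i) \<in> verts k" "stretch (m div 2, i) = (m, i)" by (auto simp: verts_def)
  then show "\<exists>u\<in>verts k. X = outer 2 (component [a, b] (stretch u))"
    using X component_eq[OF mi(1)] by metis
next
  assume "\<exists>u\<in>verts k. X = outer 2 (component [a, b] (stretch u))"
  then obtain u where u: "u \<in> verts k" and X: "X = outer 2 (component [a, b] (stretch u))" by blast
  have "stretch u \<in> {..length [a, b]} \<times> {1..k}" using u by (auto simp: verts_def)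
  then have "component [a, b] (stretch u) \<in> stack_components k [a, b]"
    unfolding stack_components_iff by (rule rev_bexI) (rule refl)
  moreover have "\<not> component [a, b] (stretch u) \<subseteq> {1} \<times> UNIV"
  proof
    assume "component [a, b] (stretch u) \<subseteq> {1} \<times> UNIV"
    moreover have "stretch u \<in> component [a, b] (stretch u)" by simp
    ultimately have "stretch u \<in> {1} \<times> UNIV" by (rule subsetD)
    then show False using u by (auto simp: verts_def)
  qed
  ultimately show "X \<in> compose_diagram k a b" unfolding compose_diagram_def X by blast
qed

lemma compose_block:
  assumes "a \<in> diagrams k" "b \<in> diagrams k" "X \<in> compose_diagram k a b" "u \<in> verts k" "v \<in> verts k" "u \<in> X"
  shows "v \<in> X \<longleftrightarrow> conn [a, b] (stretch u) (stretch v)"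
proof -
  obtain w where w: "X = outer 2 (component [a, b] (stretch w))"
    using assms(3) unfolding compose_iff[OF assms(1,2)] by blast
  then have "conn [a, b] (stretch w) (stretch u)" using assms(6) by (simp add: mem_outer2[OF assms(4)])
  from component_eq[OF this] show ?thesis using w by (simp add: mem_outer2[OF assms(5)])
qed

lemma compose_cover:
  assumes "a \<in> diagrams k" "b \<in> diagrams k" "u \<in> verts k"
  obtains X where "X \<in> compose_diagram k a b" "u \<in> X"
proof (rule that)
  show "outer 2 (component [a, b] (stretch u)) \<in> compose_diagram k a b"
    unfolding compose_iff[OF assms(1,2)] using assms(3) by blast
  show "u \<in> outer 2 (component [a, b] (stretch u))" by (simp add: mem_outer2[OF assms(3)])
qed

lemma compose_subset:
  assumes "a \<in> diagrams k" "b \<in> diagrams k" "X \<in> compose_diagram k a b"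
  shows "X \<subseteq> verts k"
proof -
  obtain w where w: "w \<in> verts k" "X = outer 2 (component [a, b] (stretch w))"
    using assms(3) unfolding compose_iff[OF assms(1,2)] by blast
  have "stretch w \<in> {..2} \<times> {1..k}" using w by (auto simp: verts_def)
  then have range: "v \<in> {..2} \<times> {1..k}" if "conn [a, b] (stretch w) v" for v
    using conn_range2[OF assms(1,2) that] by simp
  show ?thesis
  proof
    fix v assume "v \<in> X"
    then have "fst v = 0 \<and> conn [a, b] (stretch w) (0, snd v) \<or> fst v = 1 \<and> conn [a, b] (stretch w) (2, snd v)"
      unfolding w(2) by (cases v) (simp add: outer_iff)
    then show "v \<in> verts k" using range[of "(0, snd v)"] range[of "(2, snd v)"]
      by (cases v) (auto simp: verts_def)
  qed
qed

subsection \<open>Reflecting a stack\<close>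

definition reflect :: "nat \<Rightarrow> vertex \<Rightarrow> vertex" where
  "reflect n = (\<lambda>(m, i). (n - m, i))"

lemma reflect_simps [simp]: "reflect n (m, i) = (n - m, i)"
  by (simp add: reflect_def)

text \<open>Flipping every diagram and reversing the list turns the stack upside down. Arbitrary
  length is kept because stacks of two give the reflection of products and stacks of three the
  reflection of conjugates.\<close>

lemma stack_rel_reflect:
  assumes "\<And>d. d \<in> set ds \<Longrightarrow> d \<in> diagrams k" "(w, z) \<in> stack_rel ds"
  shows "(reflect (length ds) w, reflect (length ds) z) \<in> stack_rel (rev (map flip_diagram ds))"
  using assms(2)
proof (rule stack_relE)
  fix m b u v assume *: "m < length ds" "b \<in> ds ! m" "u \<in> b" "v \<in> b" "w = shift m u" "z = shift m v"
  then have b: "b \<subseteq> verts k" using assms(1)[OF nth_mem] diagrams_block_subset by blast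
  have shift: "reflect (length ds) (shift m u) = shift (length ds - Suc m) (flip u)" if "u \<in> verts k" for u
    using that *(1) by (auto simp: verts_def)
  have "rev (map flip_diagram ds) ! (length ds - Suc m) = flip_diagram (ds ! m)"
    using *(1) by (simp add: rev_nth Suc_diff_Suc)
  moreover have "flip ` b \<in> flip_diagram (ds ! m)" using *(2) by (simp add: flip_diagram_def)
  ultimately have "(shift (length ds - Suc m) (flip u), shift (length ds - Suc m) (flip v))
      \<in> stack_rel (rev (map flip_diagram ds))"
    using * by (intro stack_relI[of _ _ "flip ` b"]) auto
  then show ?thesis using shift b *(3-6) by (metis subsetD)
qed

lemma conn_reflect:
  assumes "\<And>d. d \<in> set ds \<Longrightarrow> d \<in> diagrams k" "conn ds u v"
  shows "conn (rev (map flip_diagram ds)) (reflect (length ds) u) (reflect (length ds) v)"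
  using assms(2)
proof (induction rule: rtrancl_induct)
  case (step y z)
  from step(3) stack_rel_reflect[OF assms(1) step(2)] show ?case by (rule rtrancl_into_rtrancl)
qed simp

lemma conn_flip2:
  assumes "a \<in> diagrams k" "b \<in> diagrams k" "u \<in> verts k" "v \<in> verts k"
  shows "conn [flip_diagram b, flip_diagram a] (stretch (flip u)) (stretch (flip v)) \<longleftrightarrow>
    conn [a, b] (stretch u) (stretch v)"
proof -
  have *: "reflect 2 (stretch u) = stretch (flip u)" if "u \<in> verts k" for u
    using that by (auto simp: verts_def)
  have 1: "conn [flip_diagram b, flip_diagram a] (stretch (flip u)) (stretch (flip v))"
    if "a \<in> diagrams k" "b \<in> diagrams k" "u \<in> verts k" "v \<in> verts k" "conn [a, b] (stretch u) (stretch v)" for a b u v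
  proof -
    have "d \<in> diagrams k" if "d \<in> set [a, b]" for d using that \<open>a \<in> diagrams k\<close> \<open>b \<in> diagrams k\<close> by auto
    from conn_reflect[OF this \<open>conn [a, b] (stretch u) (stretch v)\<close>] show ?thesis
      using *[OF \<open>u \<in> verts k\<close>] *[OF \<open>v \<in> verts k\<close>] by (simp add: numeral_2_eq_2)
  qed
  show ?thesis
    using 1[OF assms] 1[OF flip_diagrams[OF assms(2)] flip_diagrams[OF assms(1)] flip_verts[OF assms(3)] flip_verts[OF assms(4)]]
    by (auto simp: flip_flip[OF assms(3)] flip_flip[OF assms(4)] flip_flip_diagram[OF assms(1)] flip_flip_diagram[OF assms(2)])
qed

lemma flip_compose_subset:
  assumes "a \<in> diagrams k" "b \<in> diagrams k"
  shows "flip_diagram (compose_diagram k a b) \<subseteq> compose_diagram k (flip_diagram b) (flip_diagram a)"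
proof
  fix X assume "X \<in> flip_diagram (compose_diagram k a b)"
  then obtain Y where Y: "Y \<in> compose_diagram k a b" "X = flip ` Y" by (auto simp: flip_diagram_def)
  then obtain u where u: "u \<in> verts k" "Y = outer 2 (component [a, b] (stretch u))"
    unfolding compose_iff[OF assms] by blast
  note fl = flip_diagrams[OF assms(2)] flip_diagrams[OF assms(1)]
  define Z where "Z = outer 2 (component [flip_diagram b, flip_diagram a] (stretch (flip u)))"
  have Z: "Z \<in> compose_diagram k (flip_diagram b) (flip_diagram a)"
    unfolding Z_def compose_iff[OF fl] using flip_verts[OF u(1)] by blast
  have mem: "flip v \<in> Z \<longleftrightarrow> v \<in> Y" if "v \<in> verts k" for v
    unfolding Z_def u(2) mem_outer2[OF that] mem_outer2[OF flip_verts[OF that]]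
    using conn_flip2[OF assms u(1) that] by simp
  have "X = Z"
  proof
    show "X \<subseteq> Z" unfolding Y(2) using compose_subset[OF assms Y(1)] mem by blast
    show "Z \<subseteq> X"
    proof
      fix v assume v: "v \<in> Z"
      then have "v \<in> verts k" using compose_subset[OF fl Z] by blast
      then have "flip v \<in> Y" using mem[OF flip_verts] v by (simp add: flip_flip)
      then show "v \<in> X" unfolding Y(2) using flip_flip[OF \<open>v \<in> verts k\<close>] by (metis image_eqI)
    qed
  qed
  with Z show "X \<in> compose_diagram k (flip_diagram b) (flip_diagram a)" by simp
qed

lemma flip_diagram_mono: "c \<subseteq> d \<Longrightarrow> flip_diagram c \<subseteq> flip_diagram d"
  unfolding flip_diagram_def by (rule image_mono)

lemma flip_flip_compose:
  assumes "a \<in> diagrams k" "b \<in> diagrams k"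
  shows "flip_diagram (flip_diagram (compose_diagram k a b)) = compose_diagram k a b"
proof -
  have "(\<lambda>X. flip ` flip ` X) ` compose_diagram k a b = (\<lambda>X. X) ` compose_diagram k a b"
    using flip_flip_block compose_subset[OF assms] by (intro image_cong) blast+
  then show ?thesis unfolding flip_diagram_def by (simp only: image_image image_ident)
qed

text \<open>The reverse inclusion is the proved one for the flipped factors, flipped once
  more.\<close>

lemma flip_compose:
  assumes "a \<in> diagrams k" "b \<in> diagrams k"
  shows "flip_diagram (compose_diagram k a b) = compose_diagram k (flip_diagram b) (flip_diagram a)"
proof
  note fl = flip_diagrams[OF assms(2)] flip_diagrams[OF assms(1)]
  have "flip_diagram (compose_diagram k (flip_diagram b) (flip_diagram a)) \<subseteq> compose_diagram k a b"
    using flip_compose_subset[OF fl] unfolding flip_flip_diagram[OF assms(1)] flip_flip_diagram[OF assms(2)] .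
  from flip_diagram_mono[OF this]
  show "compose_diagram k (flip_diagram b) (flip_diagram a) \<subseteq> flip_diagram (compose_diagram k a b)"
    by (simp add: flip_flip_compose[OF fl])
qed (rule flip_compose_subset[OF assms])

subsection \<open>Halves of products\<close>

text \<open>A cup of the upper diagram lies in row 0, where the lower diagram has no vertices, so
  nothing can enlarge it.\<close>

lemma component_cup:
  assumes "a \<in> diagrams k" "b \<in> diagrams k" "c \<in> cups a" "u \<in> c"
  shows "component [a, b] u = c"
proof (rule component_eqI)
  have c: "c \<in> a" "c \<subseteq> {0} \<times> UNIV" using assms(3) by (auto simp: cups_def)
  show "w \<in> c" if "v \<in> c" "(v, w) \<in> stack_rel [a, b]" for v w
    using that(2)
  proof (rule stack_rel2E)
    fix c' assume "c' \<in> a" "v \<in> c'" "w \<in> c'"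
    with diagrams_eqD[OF assms(1) c(1) \<open>c' \<in> a\<close> that(1)] show ?thesis by simp
  next
    fix x assume "v = shift 1 x"
    with subsetD[OF c(2) that(1)] show ?thesis by (cases x) simp
  qed
  show "conn [a, b] u v" if "v \<in> c" for v
    using stack_rel_top[OF c(1) assms(4) that] by blast
qed (rule assms(4))

lemma cups_compose:
  assumes "a \<in> diagrams k" "b \<in> diagrams k"
  shows "cups a \<subseteq> cups (compose_diagram k a b)"
proof
  fix c assume c: "c \<in> cups a"
  then have sub: "c \<in> a" "c \<subseteq> {0} \<times> UNIV" by (auto simp: cups_def)
  obtain u where u: "u \<in> c" "u \<in> verts k"
    using diagrams_nonempty[OF assms(1) sub(1)] diagrams_block_subset[OF assms(1) sub(1)] by blast
  have "u \<in> {0} \<times> UNIV" using u(1) sub(2) by (rule rev_subsetD)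
  then have "stretch u = u" by auto
  then have "component [a, b] (stretch u) = c" using component_cup[OF assms c u(1)] by simp
  moreover have "outer 2 c = c"
  proof (rule set_eqI)
    fix v
    have "fst v = 0" if "v \<in> c" for v using subsetD[OF sub(2) that] by auto
    then show "v \<in> outer 2 c \<longleftrightarrow> v \<in> c"
      by (cases v) (force simp: outer_iff)
  qed
  ultimately have "c \<in> compose_diagram k a b" unfolding compose_iff[OF assms] using u(2) by metis
  with sub show "c \<in> cups (compose_diagram k a b)" by (simp add: cups_def)
qed

lemma flip_cups_compose:
  assumes "a \<in> diagrams k" "b \<in> diagrams k"
  shows "cups (flip_diagram b) \<subseteq> cups (flip_diagram (compose_diagram k a b))"
  unfolding flip_compose[OF assms] by (intro cups_compose flip_diagrams assms)

text \<open>The product contains the top half of its left factor and the bottom half of its right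
  factor, and additional cups only use up free points.\<close>

lemma rank_compose_le:
  assumes "a \<in> slim k" "b \<in> slim k" "compose_diagram k a b \<in> slim k"
  shows "diagram_rank (compose_diagram k a b) \<le> diagram_rank a"
    and "diagram_rank (compose_diagram k a b) \<le> diagram_rank b"
proof -
  note D = slim_diagrams[OF assms(1)] slim_diagrams[OF assms(2)]
  show "diagram_rank (compose_diagram k a b) \<le> diagram_rank a"
    by (rule rank_antimono[OF assms(1,3) cups_compose[OF D]])
  show "diagram_rank (compose_diagram k a b) \<le> diagram_rank b"
    using rank_antimono[OF slim_flip[OF assms(2)] slim_flip[OF assms(3)] flip_cups_compose[OF D]]
    unfolding rank_flip[OF D(2)] rank_flip[OF slim_diagrams[OF assms(3)]] .
qed

text \<open>The caps of \<open>b\<close> survive below; a new one would use up two free points, or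
  one in the case of an isolated vertex, and so lower the rank.\<close>

lemma flip_cups_compose_eq:
  assumes "a \<in> slim k" "b \<in> slim k" "compose_diagram k a b \<in> slim k"
    and "diagram_rank (compose_diagram k a b) = diagram_rank b"
  shows "cups (flip_diagram (compose_diagram k a b)) = cups (flip_diagram b)"
proof -
  note D = slim_diagrams[OF assms(1)] slim_diagrams[OF assms(2)]
  show ?thesis
    using cups_eqI[OF slim_flip[OF assms(2)] slim_flip[OF assms(3)] flip_cups_compose[OF D]] assms(4)
    unfolding rank_flip[OF D(2)] rank_flip[OF slim_diagrams[OF assms(3)]] by simp
qed

text \<open>If the bottom half of \<open>h\<close> mirrors the top half of \<open>g\<close>, the middle row of the stack splits into
  the cups of \<open>g\<close> and straight connections between strands.\<close>

lemma cups_compose_matched: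
  assumes "h \<in> slim k" "g \<in> slim k" "compose_diagram k h g \<in> slim k"
    and "cups (flip_diagram h) = cups g"
  shows "cups (compose_diagram k h g) = cups h"
proof -
  note D = slim_diagrams[OF assms(1)] slim_diagrams[OF assms(2)] slim_diagrams[OF assms(3)]
  have "tops k h \<subseteq> tops k (compose_diagram k h g)"
  proof
    fix i assume "i \<in> tops k h"
    then obtain j where ij: "strand i j \<in> h" using tops_strand[OF assms(1)] by blast
    then have "j \<in> tops k g" using strand_flip_tops[OF D(1)] cups_eq_tops[OF assms(4), of k] by blast
    then obtain l where jl: "strand j l \<in> g" using tops_strand[OF assms(2)] by blast
    have "((0, i), (1, j)) \<in> stack_rel [h, g]" using stack_rel_top[OF ij] by simp
    moreover have "((1, j), (2, l)) \<in> stack_rel [h, g]"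
      using stack_rel_second[OF jl, of "(0, j)" "(1, l)" h] by simp
    ultimately have conn: "conn [h, g] (0, i) (2, l)" by (meson r_into_rtrancl rtrancl_trans)
    have vs: "(0, i) \<in> verts k" "(1, l) \<in> verts k"
      using strand_range[OF D(1) ij] strand_range[OF D(2) jl] by (auto simp: verts_def)
    have "(0, i) \<notin> X" if X: "X \<in> cups (compose_diagram k h g)" for X
    proof
      assume "(0, i) \<in> X"
      moreover have "X \<in> compose_diagram k h g" "X \<subseteq> {0} \<times> UNIV" using X by (auto simp: cups_def)
      ultimately have "(1, l) \<in> X" using compose_block[OF D(1,2) _ vs] conn by simp
      from subsetD[OF \<open>X \<subseteq> {0} \<times> UNIV\<close> this] show False by simp
    qed
    then show "i \<in> tops k (compose_diagram k h g)" using strand_range[OF D(1) ij] by (auto simp: tops_def)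
  qed
  then have "diagram_rank h \<le> diagram_rank (compose_diagram k h g)"
    unfolding rank_tops[OF assms(1)] rank_tops[OF assms(3)] by (intro card_mono) auto
  then show ?thesis using cups_eqI[OF assms(1,3) cups_compose[OF D(1,2)]] by simp
qed

text \<open>Each cup of \<open>g\<close> closes up with its mirror image in \<open>h\<close> inside
  the middle row, while a free middle point continues along a strand to row 2. So the number of
  deleted components depends only on the matched half, which later lets two loop counts
  cancel.\<close>

lemma kappa_matched:
  assumes "h \<in> slim k" "g \<in> slim k"
    and "cups (flip_diagram h) = cups g"
  shows "kappa k h g = card (cups g)"
proof -
  note D = slim_diagrams[OF assms(1)] slim_diagrams[OF assms(2)]
  have comp: "component [h, g] (shift 1 u) = shift 1 ` b" if b: "b \<in> cups g" "u \<in> b" for b u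
  proof (rule component_eqI)
    have bg: "b \<in> g" "b \<subseteq> {0} \<times> UNIV" using b(1) by (auto simp: cups_def)
    have "b \<in> cups (flip_diagram h)" using b(1) assms(3) by simp
    then have "b \<in> flip_diagram h" by (simp add: cups_def)
    then obtain b' where b': "b' \<in> h" "b = flip ` b'" unfolding flip_diagram_def by (rule imageE)
    have "b' = flip ` b" unfolding b'(2) using flip_flip_block[OF diagrams_block_subset[OF D(1) b'(1)]] by simp
    moreover have "flip v = shift 1 v" if "v \<in> b" for v
      using subsetD[OF bg(2) that] by (cases v) simp
    ultimately have h: "shift 1 ` b \<in> h" using b'(1) by (metis image_cong)
    show "w \<in> shift 1 ` b" if "v \<in> shift 1 ` b" "(v, w) \<in> stack_rel [h, g]" for v w
      using that(2)
    proof (rule stack_rel2E)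
      fix c assume "c \<in> h" "v \<in> c" "w \<in> c"
      with diagrams_eqD[OF D(1) h \<open>c \<in> h\<close> that(1)] show ?thesis by simp
    next
      fix c x y assume "c \<in> g" "x \<in> c" "y \<in> c" "v = shift 1 x" "w = shift 1 y"
      moreover from this have "x \<in> b" using that(1) by (simp add: inj_image_mem_iff[OF inj_shift])
      ultimately show ?thesis using diagrams_eqD[OF D(2) bg(1) \<open>c \<in> g\<close>, of x] by simp
    qed
    show "conn [h, g] (shift 1 u) v" if "v \<in> shift 1 ` b" for v
      using that
    proof (rule imageE)
      fix x assume "v = shift 1 x" "x \<in> b"
      then show ?thesis using stack_rel_second[OF bg(1) b(2) \<open>x \<in> b\<close>] by (simp add: r_into_rtrancl)
    qed
  qed (rule imageI[OF b(2)])
  have "{c \<in> stack_components k [h, g]. c \<subseteq> {1} \<times> UNIV} = (`) (shift 1) ` cups g"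
  proof (rule set_eqI, rule iffI)
    fix c assume "c \<in> {c \<in> stack_components k [h, g]. c \<subseteq> {1} \<times> UNIV}"
    then have "c \<in> stack_components k [h, g]" and c3: "c \<subseteq> {1} \<times> UNIV" by simp_all
    then obtain w where w: "w \<in> {..length [h, g]} \<times> {1..k}" "c = component [h, g] w"
      unfolding stack_components_iff by blast
    obtain m j where mj: "w = (m, j)" by (cases w)
    have "w \<in> c" unfolding w(2) by simp
    with c3 have m: "m = 1" unfolding mj by (meson mem_Sigma_iff singletonD subsetD)
    have c: "c = component [h, g] (m, j)" "j \<in> {1..k}" "c \<subseteq> {1} \<times> UNIV"
      using w mj c3 by auto
    have "j \<notin> tops k g"
    proof
      assume "j \<in> tops k g"
      then obtain l where jl: "strand j l \<in> g" using tops_strand[OF assms(2)] by blast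
      have "((1, j), (2, l)) \<in> stack_rel [h, g]"
        using stack_rel_second[OF jl, of "(0, j)" "(1, l)" h] by simp
      then have "(2, l) \<in> c" unfolding c(1) m by (simp add: r_into_rtrancl)
      from subsetD[OF c(3) this] show False by simp
    qed
    then obtain b where b: "b \<in> cups g" "(0, j) \<in> b" using c(2) by (auto simp: tops_def)
    then have "c = shift 1 ` b" using comp[OF b] by (simp add: c(1) m)
    with b(1) show "c \<in> (`) (shift 1) ` cups g" by (simp add: image_eqI)
  next
    fix c assume "c \<in> (`) (shift 1) ` cups g"
    then obtain b where b: "b \<in> cups g" "c = shift 1 ` b" by blast
    then have bg: "b \<in> g" "b \<subseteq> {0} \<times> UNIV" by (simp_all add: cups_def)
    obtain u where u: "u \<in> b" "u \<in> verts k"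
      using diagrams_nonempty[OF D(2) bg(1)] diagrams_block_subset[OF D(2) bg(1)] by blast
    have "shift 1 u \<in> {..length [h, g]} \<times> {1..k}" using u(2) by (auto simp: verts_def)
    then have "c \<in> stack_components k [h, g]"
      unfolding stack_components_iff by (rule rev_bexI) (simp only: b(2) comp[OF b(1) u(1)])
    moreover have "c \<subseteq> {1} \<times> UNIV" unfolding b(2)
    proof (rule image_subsetI)
      fix v assume "v \<in> b"
      from subsetD[OF bg(2) this] show "shift 1 v \<in> {1} \<times> UNIV" by (cases v) simp
    qed
    ultimately show "c \<in> {c \<in> stack_components k [h, g]. c \<subseteq> {1} \<times> UNIV}" by simp
  qed
  moreover have "inj_on ((`) (shift 1)) (cups g)" using inj_shift by (meson inj_image_eq_iff inj_onI)
  ultimately show ?thesis unfolding kappa_def by (simp add: card_image)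
qed

subsection \<open>Stacks of three diagrams\<close>

text \<open>Collapses the two upper layers of a triple stack: rows 0, 2, 3 become rows 0, 1, 2. The
  truncated value 0 - 1 = 0 is intended, and the map is applied only to vertices outside row
  1.\<close>

definition contract :: "vertex \<Rightarrow> vertex" where
  "contract = (\<lambda>(m, i). (m - 1, i))"

lemma contract_simps [simp]: "contract (m, i) = (m - 1, i)"
  by (simp add: contract_def)

lemma stack_rel3E:
  assumes "(w, z) \<in> stack_rel [a, b, c]"
  obtains "(w, z) \<in> stack_rel [a, b]"
  | x u v where "x \<in> c" "u \<in> x" "v \<in> x" "w = shift 2 u" "z = shift 2 v"
  using assms
proof (rule stack_relE)
  fix m x u v
  assume m: "m < length [a, b, c]" and *: "x \<in> [a, b, c] ! m" "u \<in> x" "v \<in> x" "w = shift m u" "z = shift m v"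
  from m have "m < 2 \<or> m = 2" by auto
  then show thesis
  proof
    assume "m < 2"
    then have "m = 0 \<or> m = 1" by linarith
    then have "[a, b, c] ! m = [a, b] ! m" by auto
    then have "(w, z) \<in> stack_rel [a, b]" using * \<open>m < 2\<close> stack_relI[of m "[a, b]" x u v] by simp
    then show thesis by (rule that(1))
  next
    assume "m = 2"
    with * that(2)[of x u v] show thesis by simp
  qed
qed

text \<open>A path in the triple stack is cut into excursions through the two upper layers and
  single steps in the third. An excursion between rows 0 and 2 stays inside one block of the
  composite, so it can be replaced by one step.\<close>

lemma conn_contract:
  assumes D: "a \<in> diagrams k" "b \<in> diagrams k" "c \<in> diagrams k"
    and conn: "conn [a, b, c] u v"
    and outer: "u \<in> {0, 2, 3} \<times> {1..k}" "v \<in> {0, 2, 3} \<times> {1..k}"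
  shows "conn [compose_diagram k a b, c] (contract u) (contract v)"
proof -
  let ?R = "conn [compose_diagram k a b, c]"
  have join: "?R (contract w) (contract z)"
    if wz: "w \<in> {0, 2, 3} \<times> {1..k}" "z \<in> {0, 2, 3} \<times> {1..k}" "conn [a, b] w z" for w z
  proof (cases "w = z")
    case False
    have "w \<in> {..2} \<times> {1..k} \<and> z \<in> {..2} \<times> {1..k}"
    proof -
      have D2: "d \<in> diagrams k" if "d \<in> set [a, b]" for d using that D by auto
      have range: "y' \<in> {..2} \<times> {1..k}" if "(y, y') \<in> stack_rel [a, b]" for y y'
        using stack_rel_range[OF D2 that] by (simp add: numeral_2_eq_2)
      have "\<exists>y. (y, z) \<in> stack_rel [a, b]" using wz(3) False by (metis rtranclE)
      moreover have "\<exists>y. (y, w) \<in> stack_rel [a, b]" using conn_sym[OF wz(3)] False by (metis rtranclE)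
      ultimately show ?thesis using range by blast
    qed
    moreover have "y \<in> {0, 2} \<times> {1..k}" if "y \<in> {..2} \<times> {1..k}" "y \<in> {0, 2, 3} \<times> {1..k}" for y :: vertex
      using that by auto
    ultimately have "w \<in> {0, 2} \<times> {1..k}" "z \<in> {0, 2} \<times> {1..k}" using wz(1,2) by blast+
    moreover have "contract y \<in> verts k \<and> y = stretch (contract y)" if "y \<in> {0, 2} \<times> {1..k}" for y :: vertex
      using that by (auto simp: verts_def)
    ultimately obtain w' z' where wz': "w' \<in> verts k" "z' \<in> verts k" "w = stretch w'" "z = stretch z'"
      "contract w = w'" "contract z = z'"
      by blast
    obtain X where X: "X \<in> compose_diagram k a b" "w' \<in> X" using compose_cover[OF D(1,2) wz'(1)] .
    then have "z' \<in> X" using compose_block[OF D(1,2) X(1) wz'(1,2) X(2)] wz(3) wz' by simp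
    from stack_rel_top[OF X this] show ?thesis unfolding wz'(5,6) by (rule r_into_rtrancl)
  qed simp
  \<comment> \<open>The path may currently be in row 1, where \<open>contract\<close> has no
    meaning. The induction therefore remembers the point \<open>w\<close> at which the current
    excursion began.\<close>
  have "\<exists>w\<in>{0, 2, 3} \<times> {1..k}. ?R (contract u) (contract w) \<and> conn [a, b] w v"
    using conn
  proof (induction rule: rtrancl_induct)
    case base
    then show ?case using outer(1) by blast
  next
    case (step y z)
    then obtain w where w: "w \<in> {0, 2, 3} \<times> {1..k}" "?R (contract u) (contract w)" "conn [a, b] w y" by blast
    from step(2) show ?case
    proof (cases rule: stack_rel3E)
      case 1
      then have "conn [a, b] w z" using w(3) by (rule rtrancl_into_rtrancl[rotated])
      with w show ?thesis by blast
    next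
      case (2 x p q)
      have pq: "p \<in> verts k" "q \<in> verts k" using diagrams_block_subset[OF D(3)] 2 by blast+
      then have yz: "y \<in> {0, 2, 3} \<times> {1..k}" "z \<in> {0, 2, 3} \<times> {1..k}" "contract y = shift 1 p" "contract z = shift 1 q"
        using 2 by (auto simp: verts_def)
      have "?R (contract u) (contract y)" using w(2) join[OF w(1) yz(1) w(3)] by (rule rtrancl_trans)
      moreover have "(contract y, contract z) \<in> stack_rel [compose_diagram k a b, c]"
        unfolding yz using stack_rel_second[OF 2(1-3)] .
      ultimately have "?R (contract u) (contract z)" by (rule rtrancl_into_rtrancl)
      then show ?thesis using yz(2) by blast
    qed
  qed
  then obtain w where w: "w \<in> {0, 2, 3} \<times> {1..k}" "?R (contract u) (contract w)" "conn [a, b] w v" by blast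
  from w(2) join[OF w(1) outer(2) w(3)] show ?thesis by (rule rtrancl_trans)
qed

section \<open>Gluing two halves of equal rank\<close>

section \<open>Diagrams with prescribed halves\<close>

lemma key_bottom_pos: "(1, i) \<in> verts k \<Longrightarrow> key (1, i) > 0"
  by (auto simp: verts_def key_def)

lemma key_top_neg: "(0, i) \<in> verts k \<Longrightarrow> key (0, i) < 0"
  by (auto simp: verts_def key_def)

lemma block_condition_strand: "block_condition F (strand i j)"
proof (cases F)
  case Planar_Rook
  have "strand i j \<inter> {0} \<times> UNIV = {(0, i)}" "strand i j \<inter> {1} \<times> UNIV = {(1, j)}" by auto
  with Planar_Rook show ?thesis by simp
qed auto

lemma cups_mem:
  assumes "d \<in> diagrams k" "b \<in> cups d" "v \<in> b"
  obtains i where "v = (0, i)" "(0, i) \<in> verts k" "i \<notin> tops k d"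
proof -
  have b: "b \<in> d" "b \<subseteq> {0} \<times> UNIV" using assms(2) by (simp_all add: cups_def)
  obtain s i where v: "v = (s, i)" by (cases v)
  have "s = 0" using subsetD[OF b(2) assms(3)] v by simp
  moreover have "v \<in> verts k" using diagrams_block_subset[OF assms(1) b(1)] assms(3) by (rule subsetD)
  moreover have "i \<notin> tops k d" using assms(2,3) v \<open>s = 0\<close> by (auto simp: tops_def)
  ultimately show ?thesis using v that by simp
qed

text \<open>The cups of \<open>s\<close>, the mirrored cups of \<open>t\<close> and order-preserving
  strands between the free points are put together; equal rank makes the two sets of free points
  equinumerous. A crossing between a cup and a new strand would already occur in \<open>s\<close>,
  or in the flipped \<open>t\<close>, with the strand that uses the same free point there.\<close>

lemma halves_exist:
  assumes s: "s \<in> diagram_basis F k" and t: "t \<in> diagram_basis F k" and rank: "diagram_rank s = diagram_rank t"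
  obtains u where "u \<in> diagram_basis F k" "cups u = cups s" "cups (flip_diagram u) = cups t"
proof -
  note sS = basis_slim[OF s] and tS = basis_slim[OF t]
  note sD = slim_diagrams[OF sS] and tD = slim_diagrams[OF tS]
  define P where "P = tops k s"
  define Q where "Q = tops k t"
  have fin: "finite P" "finite Q" by (simp_all add: P_def Q_def)
  have card: "card P = card Q" using rank unfolding P_def Q_def rank_tops[OF sS] rank_tops[OF tS] .
  \<comment> \<open>Matches free points of equal position, the only matching whose strands do not
    cross.\<close>
  define M where "M = {(i, j). i \<in> P \<and> j \<in> Q \<and> index_in P i = index_in Q j}"
  define S where "S = (\<lambda>(i, j). strand i j) ` M"
  define T where "T = (`) flip ` cups t"
  define u where "u = cups s \<union> T \<union> S"
  have M1: "\<exists>j. (i, j) \<in> M" if "i \<in> P" for i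
  proof -
    have "index_in P i \<in> index_in Q ` Q"
      unfolding index_in_image[OF fin(2)] card[symmetric] index_in_image[OF fin(1), symmetric] using that by (rule imageI)
    then show ?thesis using that by (auto simp: M_def)
  qed
  have M2: "\<exists>i. (i, j) \<in> M" if "j \<in> Q" for j
  proof -
    have "index_in Q j \<in> index_in P ` P"
      unfolding index_in_image[OF fin(1)] card index_in_image[OF fin(2), symmetric] using that by (rule imageI)
    then obtain i where "i \<in> P" "index_in P i = index_in Q j" by auto
    then show ?thesis using that by (auto simp: M_def)
  qed
  have M_inj: "i = i' \<longleftrightarrow> j = j'" if "(i, j) \<in> M" "(i', j') \<in> M" for i j i' j'
    using that index_in_inj[OF fin(1), of i i'] index_in_inj[OF fin(2), of j j'] by (auto simp: M_def)
  have M_mono: "j < j'" if "(i, j) \<in> M" "(i', j') \<in> M" "i < i'" for i j i' j'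
  proof (rule ccontr)
    assume "\<not> j < j'"
    then have "j' < j" using M_inj[OF that(1,2)] that(3) by force
    then have "index_in Q j' < index_in Q j" using index_in_less[OF fin(2), of j' j] that by (simp add: M_def)
    moreover have "index_in P i < index_in P i'" using index_in_less[OF fin(1), of i i'] that by (simp add: M_def)
    ultimately show False using that by (auto simp: M_def)
  qed
  have M_verts: "(0, i) \<in> verts k" "(1, j) \<in> verts k" if "(i, j) \<in> M" for i j
    using that by (auto simp: M_def P_def Q_def tops_def verts_def)
  have u_cases: thesis
    if b: "b \<in> u" and cases: "b \<in> cups s \<Longrightarrow> thesis" "\<And>c. b = flip ` c \<Longrightarrow> c \<in> cups t \<Longrightarrow> thesis"
      "\<And>i j. b = strand i j \<Longrightarrow> (i, j) \<in> M \<Longrightarrow> thesis" for b thesis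
    using b unfolding u_def
  proof (elim UnE)
    assume "b \<in> S"
    then obtain p where "p \<in> M" "b = (\<lambda>(i, j). strand i j) p" unfolding S_def by blast
    with cases(3) show thesis by (cases p) simp
  next
    assume "b \<in> T"
    then show thesis using cases(2) unfolding T_def by blast
  qed (rule cases(1))
  have T_mem: thesis if bc: "b = flip ` c" "c \<in> cups t" "v \<in> b"
    and result: "\<And>j. v = (1, j) \<Longrightarrow> (1, j) \<in> verts k \<Longrightarrow> j \<notin> Q \<Longrightarrow> (0, j) \<in> c \<Longrightarrow> thesis" for b c v thesis
  proof -
    obtain w where w: "w \<in> c" "v = flip w" using bc(1,3) by blast
    obtain j where "w = (0, j)" "(0, j) \<in> verts k" "j \<notin> tops k t" using cups_mem[OF tD bc(2) w(1)] .
    then show thesis using w by (intro result[of j]) (auto simp: Q_def verts_def)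
  qed
  have S_in: "strand i j \<in> u" if "(i, j) \<in> M" for i j using that unfolding u_def S_def by force
  have blk_top: "b \<in> cups s \<or> (\<exists>j. (i, j) \<in> M \<and> b = strand i j)" if "b \<in> u" "(0, i) \<in> b" for b i
    using that(1)
  proof (rule u_cases)
    fix c assume "b = flip ` c" "c \<in> cups t"
    from T_mem[OF this that(2)] show ?thesis by auto
  next
    fix i' j assume "b = strand i' j" "(i', j) \<in> M"
    with that(2) show ?thesis by auto
  qed simp
  have blk_bot: "(\<exists>c\<in>cups t. b = flip ` c \<and> (0, j) \<in> c) \<or> (\<exists>i. (i, j) \<in> M \<and> b = strand i j)" if "b \<in> u" "(1, j) \<in> b" for b j
    using that(1)
  proof (rule u_cases)
    fix c assume c: "b = flip ` c" "c \<in> cups t"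
    from T_mem[OF this that(2)] c show ?thesis by auto
  next
    fix i' j assume "b = strand i' j" "(i', j) \<in> M"
    with that(2) show ?thesis by auto
  next
    assume "b \<in> cups s"
    from cups_mem[OF sD this that(2)] show ?thesis by auto
  qed
  have sub: "b \<subseteq> verts k" if "b \<in> u" for b
    using that
  proof (rule u_cases)
    assume "b \<in> cups s"
    then show ?thesis using diagrams_block_subset[OF sD] by (simp add: cups_def)
  next
    fix c assume "b = flip ` c" "c \<in> cups t"
    from T_mem[OF this] show ?thesis by blast
  next
    fix i j assume "b = strand i j" "(i, j) \<in> M"
    with M_verts show ?thesis by auto
  qed
  have "b = c" if bc: "b \<in> u" "c \<in> u" "v \<in> b" "v \<in> c" for b c v
  proof -
    have "v \<in> verts k" using sub[OF bc(1)] bc(3) by (rule subsetD)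
    then obtain i where "v = (0, i) \<or> v = (1, i)" by (auto simp: verts_def)
    then show ?thesis
    proof
      assume v: "v = (0, i)"
      have no: False if "a \<in> cups s" "v \<in> a" "(i, j) \<in> M" for a j
        using cups_mem[OF sD that(1,2)] that(3) v by (auto simp: M_def P_def)
      show ?thesis
      proof (cases "b \<in> cups s")
        case True
        then have "c \<in> cups s" using no bc v blk_top[of c i] by blast
        with True show ?thesis using diagrams_eqD[OF sD _ _ bc(3,4)] by (simp add: cups_def)
      next
        case False
        then obtain j where j: "(i, j) \<in> M" "b = strand i j" using blk_top[of b i] bc v by blast
        have "(0, i) \<in> c" using bc(4) v by simp
        then obtain j' where j': "(i, j') \<in> M" "c = strand i j'"
          using blk_top[OF bc(2)] no[OF _ bc(4) j(1)] by metis
        have "j = j'" using M_inj[OF j(1) j'(1)] by simp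
        with j j' show ?thesis by simp
      qed
    next
      assume v: "v = (1, i)"
      have no: False if "a \<in> cups t" "(0, i) \<in> a" "(j, i) \<in> M" for a j
        using cups_mem[OF tD that(1,2)] that(3) by (auto simp: M_def Q_def)
      have vi: "(1, i) \<in> b" "(1, i) \<in> c" using bc v by auto
      consider a where "a \<in> cups t" "b = flip ` a" "(0, i) \<in> a" | j where "(j, i) \<in> M" "b = strand j i"
        using blk_bot[OF bc(1) vi(1)] by metis
      then show ?thesis
      proof cases
        case (1 a)
        then obtain a' where a': "a' \<in> cups t" "c = flip ` a'" "(0, i) \<in> a'"
          using blk_bot[OF bc(2) vi(2)] no by metis
        then have "a = a'" using 1 diagrams_eqD[OF tD _ _ 1(3) a'(3)] by (simp add: cups_def)
        with 1 a' show ?thesis by simp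
      next
        case (2 j)
        then obtain j' where j': "(j', i) \<in> M" "c = strand j' i"
          using blk_bot[OF bc(2) vi(2)] no by metis
        have "j = j'" using M_inj[OF 2(1) j'(1)] by simp
        with 2 j' show ?thesis by simp
      qed
    qed
  qed
  then have disj: "disjnt b c" if "b \<in> u" "c \<in> u" "b \<noteq> c" for b c using that by (metis disjnt_iff)
  have "\<exists>b\<in>u. v \<in> b" if v: "v \<in> verts k" for v
  proof -
    from v obtain i where "v = (0, i) \<and> i \<in> {1..k} \<or> v = (1, i) \<and> i \<in> {1..k}" by (auto simp: verts_def)
    then show ?thesis
    proof (elim disjE conjE)
      assume vi: "v = (0, i)" "i \<in> {1..k}"
      show ?thesis
      proof (cases "i \<in> P")
        case True
        then obtain j where "(i, j) \<in> M" using M1 by blast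
        from S_in[OF this] show ?thesis by (rule rev_bexI) (simp add: vi)
      next
        case False
        then obtain b where "b \<in> cups s" "(0, i) \<in> b" using vi by (auto simp: P_def tops_def)
        then show ?thesis unfolding u_def vi by blast
      qed
    next
      assume vi: "v = (1, i)" "i \<in> {1..k}"
      show ?thesis
      proof (cases "i \<in> Q")
        case True
        then obtain j where "(j, i) \<in> M" using M2 by blast
        from S_in[OF this] show ?thesis by (rule rev_bexI) (simp add: vi)
      next
        case False
        then obtain b where b: "b \<in> cups t" "(0, i) \<in> b" using vi by (auto simp: Q_def tops_def)
        have "flip ` b \<in> u" using b(1) by (simp add: u_def T_def)
        moreover have "(1, i) \<in> flip ` b" using imageI[OF b(2), of flip] by simp
        ultimately show ?thesis unfolding vi by blast
      qed
    qed
  qed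
  then have "\<Union>u = verts k" using sub by blast
  have nonempty: "b \<noteq> {}" if "b \<in> u" for b
    using that
  proof (rule u_cases)
    assume "b \<in> cups s"
    then show ?thesis using diagrams_nonempty[OF sD] by (simp add: cups_def)
  next
    fix c assume "b = flip ` c" "c \<in> cups t"
    then show ?thesis using diagrams_nonempty[OF tD] by (simp add: cups_def)
  qed simp
  have uD: "u \<in> diagrams k"
    unfolding diagrams_def mem_Collect_eq
  proof (rule partition_onI)
    show "disjnt b c" if "b \<in> u" "c \<in> u" "b \<noteq> c" for b c by (rule disj[OF that])
    show "{} \<notin> u" using nonempty by blast
  qed fact
  have nc: "noncrossing u"
    unfolding noncrossing_def
  proof (intro ballI impI notI)
    fix b c p p' q q'
    assume bc: "b \<in> u" "c \<in> u" "b \<noteq> c" "p \<in> b" "p' \<in> b" "q \<in> c" "q' \<in> c"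
      and "key p < key q \<and> key q < key p' \<and> key p' < key q'"
    then have keys: "key p < key q" "key q < key p'" "key p' < key q'" by auto
    have neg: "key v < 0" if "a \<in> cups s" "v \<in> a" for a v
      by (rule cups_mem[OF sD that]) (simp add: key_top_neg)
    have pos: "key v > 0" if "a = flip ` c" "c \<in> cups t" "v \<in> a" for a c v
      using T_mem[OF that] key_bottom_pos by metis
    have ncs: "noncrossing s" and ncf: "noncrossing (flip_diagram t)"
      using s t basis_noncrossing noncrossing_flip[OF _ tD] by blast+
    have flip_in: "flip ` a \<in> flip_diagram t" if "a \<in> cups t" for a
      using that by (simp add: cups_def flip_diagram_def)
    show False
      using bc(1)
    proof (rule u_cases)
      assume b: "b \<in> cups s"
      show False using bc(2)
      proof (rule u_cases)
        assume "c \<in> cups s"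
        with b show False using noncrossingD[OF ncs _ _ bc(3-7) keys] by (simp add: cups_def)
      next
        fix a assume "c = flip ` a" "a \<in> cups t"
        from pos[OF this bc(6)] neg[OF b bc(5)] keys show False by simp
      next
        fix i j assume c: "c = strand i j" "(i, j) \<in> M"
        have "q = (0, i)" using c bc(6) neg[OF b bc(5)] keys key_bottom_pos[OF M_verts(2)[OF c(2)]] by auto
        \<comment> \<open>The new strand from \<open>i\<close> is replaced by the strand of
          \<open>s\<close> at \<open>i\<close>. Its lower end has a positive key, beyond the
          negative keys of the cup, so the alternation persists inside \<open>s\<close>.\<close>
        obtain j' where st: "strand i j' \<in> s" using tops_strand[OF sS, of i] c(2) by (auto simp: M_def P_def)
        have "(0, i) \<notin> b" using cups_mem[OF sD b, of "(0, i)"] c(2) by (auto simp: M_def P_def)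
        then have "b \<noteq> strand i j'" by auto
        have "b \<in> s" using b by (simp add: cups_def)
        have "key p' < key (1, j')"
          using neg[OF b bc(5)] key_bottom_pos[of j' k] strand_range[OF sD st] by (auto simp: verts_def)
        then show False
          using noncrossingD[OF ncs \<open>b \<in> s\<close> st \<open>b \<noteq> strand i j'\<close> bc(4,5), of "(0, i)" "(1, j')"] keys \<open>q = (0, i)\<close> by simp
      qed
    next
      fix a assume b: "b = flip ` a" "a \<in> cups t"
      show False using bc(2)
      proof (rule u_cases)
        assume "c \<in> cups s"
        from pos[OF b bc(4)] neg[OF this bc(6)] keys show False by simp
      next
        fix a' assume c: "c = flip ` a'" "a' \<in> cups t"
        then show False using noncrossingD[OF ncf _ _ bc(3-7) keys] flip_in b by simp
      next
        fix i j assume c: "c = strand i j" "(i, j) \<in> M"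
        then show False
          using pos[OF b bc(4)] bc(6,7) keys key_top_neg[OF M_verts(1)[OF c(2)]] by auto
      qed
    next
      fix i j assume b: "b = strand i j" "(i, j) \<in> M"
      then have pq: "p = (0, i)" "p' = (1, j)"
        using bc(4,5) keys key_top_neg[OF M_verts(1)[OF b(2)]] key_bottom_pos[OF M_verts(2)[OF b(2)]] by auto
      have "key (1, j) > 0" using key_bottom_pos[OF M_verts(2)[OF b(2)]] .
      show False using bc(2)
      proof (rule u_cases)
        assume "c \<in> cups s"
        from neg[OF this bc(7)] \<open>key (1, j) > 0\<close> keys pq show False by simp
      next
        fix a assume c: "c = flip ` a" "a \<in> cups t"
        \<comment> \<open>Mirror image of the previous replacement: the flipped \<open>t\<close> has
          a strand ending at \<open>j\<close>, and its upper end has a negative key, before all keys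
          of the cap.\<close>
        obtain l where "strand j l \<in> t" using tops_strand[OF tS, of j] b(2) by (auto simp: M_def Q_def)
        then have st: "strand l j \<in> flip_diagram t" by (rule strand_flip)
        have "(1, j) \<notin> c"
        proof
          assume "(1, j) \<in> c"
          from T_mem[OF c this] b(2) show False by (auto simp: M_def)
        qed
        then have "strand l j \<noteq> c" by auto
        have "key (0, l) < key q"
          using pos[OF c bc(6)] key_top_neg[of l k] strand_range[OF flip_diagrams[OF tD] st] by (auto simp: verts_def)
        then show False
          using noncrossingD[OF ncf st flip_in[OF c(2), folded c(1)] \<open>strand l j \<noteq> c\<close> _ _ bc(6,7), of "(0, l)" "(1, j)"] keys pq
          by simp
      next
        fix i' j' assume c: "c = strand i' j'" "(i', j') \<in> M"
        have "key (0, i') < 0" using key_top_neg[OF M_verts(1)[OF c(2)]] .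
        then have q: "q' = (1, j')" "q = (0, i')" using c bc(6,7) keys pq \<open>key (1, j) > 0\<close> by auto
        have "i < i'" using keys(1) key_less_iff(1)[OF M_verts(1)[OF b(2)] M_verts(1)[OF c(2)]] pq q by simp
        from M_mono[OF b(2) c(2) this]
        have "key (1, j') < key (1, j)"
          using M_verts(2)[OF b(2)] M_verts(2)[OF c(2)] by (auto simp: key_def verts_def field_simps)
        with keys pq q show False by simp
      qed
    qed
  qed
  have "block_condition F b" if "b \<in> u" for b
    using that
  proof (rule u_cases)
    assume "b \<in> cups s"
    then show ?thesis using s by (simp add: cups_def diagram_basis_iff)
  next
    fix c assume c: "b = flip ` c" "c \<in> cups t"
    then have "c \<in> t" by (simp add: cups_def)
    then have "block_condition F c" using t by (simp add: diagram_basis_iff)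
    then show ?thesis unfolding c(1) block_condition_flip[OF diagrams_block_subset[OF tD \<open>c \<in> t\<close>]] .
  next
    fix i j assume "b = strand i j"
    then show ?thesis by (simp only: block_condition_strand)
  qed
  then have uB: "u \<in> diagram_basis F k" using uD nc by (simp add: diagram_basis_iff)
  have "cups u = cups s"
  proof
    show "cups s \<subseteq> cups u" by (auto simp: u_def cups_def)
    show "cups u \<subseteq> cups s"
    proof
      fix b assume "b \<in> cups u"
      then have b: "b \<in> u" "b \<subseteq> {0} \<times> UNIV" by (simp_all add: cups_def)
      then obtain v where v: "v \<in> b" using nonempty[OF b(1)] by (meson ex_in_conv)
      obtain i where "v = (0, i)" using subsetD[OF b(2) v] by auto
      moreover have "b \<noteq> strand i j" for j
      proof
        assume "b = strand i j"
        then have "(1, j) \<in> b" by simp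
        from subsetD[OF b(2) this] show False by simp
      qed
      ultimately show "b \<in> cups s" using blk_top[OF b(1)] v by metis
    qed
  qed
  moreover have "cups (flip_diagram u) = cups t"
  proof
    show "cups t \<subseteq> cups (flip_diagram u)"
    proof
      fix c assume c: "c \<in> cups t"
      then have "c \<in> t" "c \<subseteq> {0} \<times> UNIV" by (simp_all add: cups_def)
      have "flip ` c \<in> u" using c by (simp add: u_def T_def)
      then have "flip ` flip ` c \<in> flip_diagram u" unfolding flip_diagram_def by (rule imageI)
      then have "c \<in> flip_diagram u" unfolding flip_flip_block[OF diagrams_block_subset[OF tD \<open>c \<in> t\<close>]] .
      with \<open>c \<subseteq> {0} \<times> UNIV\<close> show "c \<in> cups (flip_diagram u)" by (simp add: cups_def)
    qed
    show "cups (flip_diagram u) \<subseteq> cups t"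
    proof
      fix b assume "b \<in> cups (flip_diagram u)"
      then have b: "b \<in> flip_diagram u" "b \<subseteq> {0} \<times> UNIV" by (simp_all add: cups_def)
      then obtain b' where b': "b' \<in> u" "b = flip ` b'" unfolding flip_diagram_def by blast
      then obtain v where v: "v \<in> b'" using nonempty[OF b'(1)] by (meson ex_in_conv)
      have row1: "\<exists>j. w = (1, j)" if "w \<in> b'" for w
      proof -
        have "w \<in> verts k" using sub[OF b'(1)] that by (rule subsetD)
        moreover have "flip w \<in> {0} \<times> UNIV" using b(2) b'(2) that by blast
        ultimately show ?thesis by (auto simp: verts_def)
      qed
      obtain j where "v = (1, j)" using row1[OF v] by blast
      moreover have "b' \<noteq> strand i j" for i using row1[of "(0, i)"] by auto
      ultimately obtain c where c: "c \<in> cups t" "b' = flip ` c" using blk_bot[OF b'(1)] v by metis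
      have "c \<subseteq> verts k" using c(1) diagrams_block_subset[OF tD] by (simp add: cups_def)
      then have "b = c" unfolding b'(2) c(2) by (rule flip_flip_block)
      with c show "b \<in> cups t" by simp
    qed
  qed
  ultimately show thesis using that uB by blast
qed

section \<open>Vertical strands of symmetric diagrams and their conjugates\<close>

section \<open>Symmetric diagrams\<close>

text \<open>The free top and bottom points are the same set, and a strand preserves the position in
  it, so it is vertical.\<close>

lemma symmetric_strand:
  assumes "t \<in> diagram_basis F k" "symmetric_diagram t" "strand i j \<in> t"
  shows "i = j"
proof -
  note s = basis_slim[OF assms(1)]
  have "index_in (tops k t) i = index_in (tops k t) j"
    using strand_index[OF basis_noncrossing[OF assms(1)] s assms(3)] assms(2) by (simp add: symmetric_diagram_def)
  moreover have "i \<in> tops k t" "j \<in> tops k t"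
    using strand_tops[OF slim_diagrams[OF s] assms(3)] strand_flip_tops[OF slim_diagrams[OF s] assms(3)] assms(2)
    by (simp_all add: symmetric_diagram_def)
  ultimately show ?thesis using index_in_inj[OF finite_tops] by blast
qed

lemma symmetric_tops_strand:
  assumes "t \<in> diagram_basis F k" "symmetric_diagram t" "i \<in> tops k t"
  shows "strand i i \<in> t"
proof -
  obtain j where "strand i j \<in> t" using tops_strand[OF basis_slim[OF assms(1)] assms(3)] .
  with symmetric_strand[OF assms(1,2) this] show ?thesis by simp
qed

lemma symmetric_eqI:
  assumes "s \<in> diagram_basis F k" "symmetric_diagram s" "t \<in> diagram_basis F k" "symmetric_diagram t" "cups s = cups t"
  shows "s = t"
  using assms by (intro halves_eqI[OF assms(1,3,5)]) (simp add: symmetric_diagram_def)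

text \<open>Reflection moves a block contained in one row to the other row, so only strands can be
  fixed, and they are vertical.\<close>

lemma fixed_blocks_symmetric:
  assumes t: "t \<in> diagram_basis F k" and sym: "symmetric_diagram t"
  shows "fixed_blocks t = (\<lambda>i. strand i i) ` tops k t"
proof
  note s = basis_slim[OF t]
  note D = slim_diagrams[OF s]
  have fl: "flip_diagram t = t" using sym by (simp add: symmetric_diagram_def)
  have no_cup: False if b: "b \<in> cups t" "flip ` b = b" for b
  proof -
    have "b \<in> t" using b by (simp add: cups_def)
    then obtain v where v: "v \<in> b" using diagrams_nonempty[OF D] by blast
    obtain i where i: "v = (0, i)" using cups_mem[OF D b(1) v] .
    have "flip v \<in> b" using imageI[OF v, of flip] b(2) by simp
    then have "(1, i) \<in> b" using i by simp
    then show False by (rule cups_mem[OF D b(1)]) simp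
  qed
  show "fixed_blocks t \<subseteq> (\<lambda>i. strand i i) ` tops k t"
  proof
    fix b assume "b \<in> fixed_blocks t"
    then have b: "b \<in> t" "flip ` b = b" by (simp_all add: fixed_blocks_def)
    from s b(1) show "b \<in> (\<lambda>i. strand i i) ` tops k t"
    proof (cases rule: block_cases)
      case (3 i j)
      with b symmetric_strand[OF t sym, of i j] have "b = strand i i" by simp
      moreover from this have "i \<in> tops k t" using strand_tops[OF D] b by simp
      ultimately show ?thesis by (rule image_eqI)
    qed (use no_cup[of b] b fl in auto)
  qed
  show "(\<lambda>i. strand i i) ` tops k t \<subseteq> fixed_blocks t"
    using symmetric_tops_strand[OF t sym] by (auto simp: fixed_blocks_def insert_commute)
qed

lemma inj_on_strand: "inj_on (\<lambda>i. strand i i) A"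
  by (rule inj_onI) simp

text \<open>\<open>fixed_list\<close> uses the class constant for sorted lists, while the
  interpretation of \<open>folding_insort_key\<close> below speaks about its locale version with an
  explicit order. This lemma and the next identify the two for the natural numbers.\<close>

lemma insort_key_nat: "linorder.insort_key (\<le>) f = insort_key (f :: 'b \<Rightarrow> nat)"
proof (rule ext, rule ext)
  show "linorder.insort_key (\<le>) f x xs = insort_key f x xs" for x xs
    by (induction xs) (simp_all add: linorder.insort_key.simps[OF linorder_class.linorder_axioms])
qed

lemma sorted_key_list_of_set_nat:
  "linorder.sorted_key_list_of_set (\<le>) f = sorted_key_list_of_set (f :: 'b \<Rightarrow> nat)"
  unfolding linorder.sorted_key_list_of_set_def[OF linorder_class.linorder_axioms] sorted_key_list_of_set_def insort_key_nat ..

lemma fixed_list_symmetric: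
  assumes t: "t \<in> diagram_basis F k" and sym: "symmetric_diagram t"
  shows "fixed_list t = map (\<lambda>i. strand i i) (sorted_list_of_set (tops k t))"
proof -
  let ?xs = "map (\<lambda>i. strand i i) (sorted_list_of_set (tops k t))"
  have min: "Min (snd ` strand i i) = i" for i by simp
  have set: "set ?xs = fixed_blocks t" using fixed_blocks_symmetric[OF t sym] by simp
  interpret folding_insort_key "(\<le>)" "(<)" "fixed_blocks t" "\<lambda>b. Min (snd ` b)"
    by unfold_locales (unfold fixed_blocks_symmetric[OF t sym] inj_on_def, clarsimp)
  have "map (\<lambda>b. Min (snd ` b)) ?xs = sorted_list_of_set (tops k t)"
    by (simp only: map_map comp_def min map_ident)
  then have "sorted (map (\<lambda>b. Min (snd ` b)) ?xs)" by simp
  moreover have "distinct ?xs" by (simp add: distinct_map inj_on_strand)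
  ultimately show ?thesis
    using idem_if_sorted_distinct[of ?xs] set by (simp add: fixed_list_def sorted_key_list_of_set_nat)
qed

text \<open>A strand of \<open>d \<circ> t\<close> gives a path from (0, j) to (2, i) in the triple
  stack. The stack is invariant under reflection, so there is also a path from (3, j) to (1, i), and
  the vertical strand of \<open>t\<close> joins the two. Thus the component of that strand reaches
  both outer rows at column \<open>j\<close>.\<close>

lemma conj_block_strand:
  assumes D: "d \<in> diagrams k" "t \<in> diagrams k" and sym: "symmetric_diagram t"
    and slim: "compose_diagram k d t \<in> slim k" "conjugate k d t \<in> slim k"
    and st: "strand j i \<in> compose_diagram k d t" "strand i i \<in> t"
  shows "conj_block d t (strand i i) = strand j j" "strand j j \<in> conjugate k d t"
proof -
  let ?ds = "[d, t, flip_diagram d]"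
  have fl: "flip_diagram t = t" using sym by (simp add: symmetric_diagram_def)
  have D3: "e \<in> diagrams k" if "e \<in> set ?ds" for e using that D flip_diagrams by auto
  have rows: "i \<in> {1..k}" "j \<in> {1..k}" using strand_range[OF slim_diagrams[OF slim(1)] st(1)] by auto
  have vs: "(0, j) \<in> verts k" "(1, i) \<in> verts k" "(1, j) \<in> verts k" using rows by (auto simp: verts_def)
  have mono: "(stack_rel [d, t])\<^sup>* \<subseteq> (stack_rel ?ds)\<^sup>*"
  proof (rule rtrancl_mono, rule subrelI)
    fix w z assume "(w, z) \<in> stack_rel [d, t]"
    then show "(w, z) \<in> stack_rel ?ds"
      using stack_rel_top[of _ d _ _ "[t, flip_diagram d]"] stack_rel_second[of _ t _ _ d "[flip_diagram d]"]
      by (elim stack_rel2E) simp_all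
  qed
  have "conn [d, t] (stretch (0, j)) (stretch (1, i))"
    using compose_block[OF D st(1) vs(1,2)] by simp
  then have c1: "conn ?ds (0, j) (2, i)" using mono by auto
  then have c2: "conn ?ds (3, j) (1, i)"
    using conn_reflect[OF D3 c1]
    by (simp add: flip_flip_diagram[OF D(1)] fl numeral_3_eq_3 numeral_2_eq_2 One_nat_def)
  have c3: "conn ?ds (1, i) (2, i)"
    using stack_rel_second[OF st(2), of "(0, i)" "(1, i)" d "[flip_diagram d]"] by (simp add: r_into_rtrancl)
  have comp: "(stack_rel ?ds)\<^sup>* `` (shift 1 ` strand i i) = component ?ds (0, j)"
  proof -
    have "R `` {u, v} = R `` {u} \<union> R `` {v}" for R :: "(vertex \<times> vertex) set" and u v by blast
    moreover have "shift 1 ` strand i i = {(1, i), (2, i)}" by simp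
    ultimately have "(stack_rel ?ds)\<^sup>* `` (shift 1 ` strand i i) = component ?ds (1, i) \<union> component ?ds (2, i)" by simp
    then show ?thesis using component_eq[OF c3] component_eq[OF c1] by simp
  qed
  have c4: "conn ?ds (0, j) (3, j)"
    using c1 conn_sym[OF c3] conn_sym[OF c2] by (meson rtrancl_trans)
  have conj: "conjugate k d t = compose_diagram k (compose_diagram k d t) (flip_diagram d)"
    by (simp add: conjugate_def)
  note D' = slim_diagrams[OF slim(1)] flip_diagrams[OF D(1)]
  obtain X where X: "X \<in> conjugate k d t" "(0, j) \<in> X" unfolding conj using compose_cover[OF D' vs(1)] .
  \<comment> \<open>The outer part of the component lies in one block \<open>X\<close> of the
    conjugate. As the conjugate is slim, the two vertices found in column \<open>j\<close> already
    exhaust \<open>X\<close>.\<close>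
  have into: "(s, l) \<in> X" if sl: "(s, l) \<in> outer 3 (component ?ds (0, j))" for s l
  proof -
    from sl obtain m where m: "conn ?ds (0, j) (m, l)" "s = 0 \<and> m = 0 \<or> s = 1 \<and> m = 3"
      by (auto simp: outer_iff)
    have "(m, l) \<in> {..length ?ds} \<times> {1..k}" using conn_range[OF D3 m(1)] rows by simp
    then have ml: "(m, l) \<in> {0, 2, 3} \<times> {1..k}" and slv: "(s, l) \<in> verts k" using m(2) by (auto simp: verts_def)
    have "conn [compose_diagram k d t, flip_diagram d] (contract (0, j)) (contract (m, l))"
      using conn_contract[OF D D'(2) m(1) _ ml] rows by simp
    then have "conn [compose_diagram k d t, flip_diagram d] (stretch (0, j)) (stretch (s, l))"
      using m(2) by auto
    then show ?thesis using compose_block[OF D' X(1)[unfolded conj] vs(1) slv X(2)] by simp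
  qed
  have out: "(0, j) \<in> outer 3 (component ?ds (0, j))" "(1, j) \<in> outer 3 (component ?ds (0, j))"
    using c4 by (simp_all add: outer_iff)
  have "X = strand j j" using strand_block[OF slim(2) X(1) into[OF out(1)] into[OF out(2)]] .
  with X(1) show "strand j j \<in> conjugate k d t" by simp
  have "outer 3 (component ?ds (0, j)) = strand j j"
  proof
    show "outer 3 (component ?ds (0, j)) \<subseteq> strand j j"
      unfolding \<open>X = strand j j\<close>[symmetric] using into by (rule subrelI)
    show "strand j j \<subseteq> outer 3 (component ?ds (0, j))" using out by simp
  qed
  then show "conj_block d t (strand i i) = strand j j" unfolding conj_block_def comp .
qed

section \<open>Conjugation through top halves, trivial signs and loop factors\<close>

section \<open>The conjugation action\<close>

text \<open>What associativity of the algebra says about single diagrams. Comparing coefficients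
  yields loop factors, not loop numbers, so the cocycle law is an identity of powers of x; for x a
  root of unity the exponents could not be recovered from it.\<close>

locale diagram_monoid =
  fixes F :: planar_family and x :: "'a::field" and k :: nat
  assumes nonzero: "x \<noteq> 0"
    and closed: "a \<in> diagram_basis F k \<Longrightarrow> b \<in> diagram_basis F k \<Longrightarrow> compose_diagram k a b \<in> diagram_basis F k"
    and assoc: "a \<in> diagram_basis F k \<Longrightarrow> b \<in> diagram_basis F k \<Longrightarrow> c \<in> diagram_basis F k \<Longrightarrow>
      compose_diagram k (compose_diagram k a b) c = compose_diagram k a (compose_diagram k b c)"
    and cocycle: "a \<in> diagram_basis F k \<Longrightarrow> b \<in> diagram_basis F k \<Longrightarrow> c \<in> diagram_basis F k \<Longrightarrow>
      x ^ kappa k a b * x ^ kappa k (compose_diagram k a b) c =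
      x ^ kappa k b c * x ^ kappa k a (compose_diagram k b c)"
begin

abbreviation comp (infixl \<open>\<odot>\<close> 70) where "a \<odot> b \<equiv> compose_diagram k a b"

abbreviation "B \<equiv> diagram_basis F k"
abbreviation "S \<equiv> sym_diagrams F k"

lemma BD: "a \<in> B \<Longrightarrow> a \<in> diagrams k"
  by (simp add: diagram_basis_iff)

lemma S_B: "t \<in> S \<Longrightarrow> t \<in> B" and S_sym: "t \<in> S \<Longrightarrow> symmetric_diagram t" and S_flip: "t \<in> S \<Longrightarrow> flip_diagram t = t"
  by (simp_all add: sym_diagrams_def symmetric_diagram_def)

lemma S_eqI: "s \<in> S \<Longrightarrow> t \<in> S \<Longrightarrow> cups s = cups t \<Longrightarrow> s = t"
  using symmetric_eqI S_B S_sym by metis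

lemma rank_comp_le:
  assumes "a \<in> B" "b \<in> B"
  shows "diagram_rank (a \<odot> b) \<le> diagram_rank a" "diagram_rank (a \<odot> b) \<le> diagram_rank b"
  using rank_compose_le[OF assms[THEN basis_slim] basis_slim[OF closed[OF assms]]] .

lemma rank_cups: "a \<in> B \<Longrightarrow> b \<in> B \<Longrightarrow> cups a = cups b \<Longrightarrow> diagram_rank a = diagram_rank b"
  using rank_tops[OF basis_slim] cups_eq_tops by metis

lemma cups_matched:
  assumes "h \<in> B" "g \<in> B" "cups (flip_diagram h) = cups g"
  shows "cups (h \<odot> g) = cups h"
  using cups_compose_matched[OF assms(1,2)[THEN basis_slim] basis_slim[OF closed[OF assms(1,2)]] assms(3)] .

lemma flip_comp: "a \<in> B \<Longrightarrow> b \<in> B \<Longrightarrow> flip_diagram (a \<odot> b) = flip_diagram b \<odot> flip_diagram a"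
  using flip_compose[OF BD BD] .

lemma flip_flip_B: "a \<in> B \<Longrightarrow> flip_diagram (flip_diagram a) = a"
  using flip_flip_diagram[OF BD] .

lemma square_S:
  assumes "g \<in> B"
  shows "g \<odot> flip_diagram g \<in> S"
proof -
  have "flip_diagram (g \<odot> flip_diagram g) = g \<odot> flip_diagram g"
    by (simp add: flip_comp[OF assms basis_flip[OF assms]] flip_flip_B[OF assms])
  with closed[OF assms basis_flip[OF assms]] show ?thesis
    by (simp add: sym_diagrams_def symmetric_diagram_def)
qed

lemma cups_square: "g \<in> B \<Longrightarrow> cups (g \<odot> flip_diagram g) = cups g"
  using cups_matched basis_flip by simp

text \<open>\<open>t \<circ> t\<close> is a diagram times its own reflection, hence symmetric, and
  it has the cups of \<open>t\<close>.\<close>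

lemma idem_S:
  assumes "t \<in> S"
  shows "t \<odot> t = t"
  using S_eqI[OF square_S[OF S_B[OF assms]] assms cups_square[OF S_B[OF assms]]] S_flip[OF assms] by simp

text \<open>Idempotency of \<open>t\<close> allows one factor of it to be given to each side of the
  product.\<close>

lemma conj_eq:
  assumes "d \<in> B" "t \<in> S"
  shows "conjugate k d t = (d \<odot> t) \<odot> flip_diagram (d \<odot> t)"
proof -
  note t = S_B[OF assms(2)] and d' = basis_flip[OF assms(1)]
  have "(d \<odot> t) \<odot> flip_diagram (d \<odot> t) = (d \<odot> t) \<odot> (t \<odot> flip_diagram d)"
    using flip_comp[OF assms(1) t] S_flip[OF assms(2)] by simp
  also have "\<dots> = ((d \<odot> t) \<odot> t) \<odot> flip_diagram d" using assoc[OF closed[OF assms(1) t] t d'] by simp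
  also have "(d \<odot> t) \<odot> t = d \<odot> t" using assoc[OF assms(1) t t] idem_S[OF assms(2)] by simp
  finally show ?thesis by (simp add: conjugate_def)
qed

lemma conj_S: "d \<in> B \<Longrightarrow> t \<in> S \<Longrightarrow> conjugate k d t \<in> S"
  using conj_eq square_S closed S_B by simp

lemma cups_conj: "d \<in> B \<Longrightarrow> t \<in> S \<Longrightarrow> cups (conjugate k d t) = cups (d \<odot> t)"
  using conj_eq cups_square closed S_B by simp

lemma rank_conj: "d \<in> B \<Longrightarrow> t \<in> S \<Longrightarrow> diagram_rank (conjugate k d t) = diagram_rank (d \<odot> t)"
  using rank_cups cups_conj conj_S closed S_B by simp

lemma flip_cups_keep:
  assumes "d \<in> B" "g \<in> B" "diagram_rank (d \<odot> g) = diagram_rank g"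
  shows "cups (flip_diagram (d \<odot> g)) = cups (flip_diagram g)"
  using flip_cups_compose_eq[OF assms(1,2)[THEN basis_slim] basis_slim[OF closed[OF assms(1,2)]] assms(3)] .

text \<open>A diagram carries the strands of \<open>t\<close> to those of the conjugate without crossings, hence in order.\<close>

lemma conj_sign_1:
  assumes d: "d \<in> B" and t: "t \<in> S" and rank: "diagram_rank (d \<odot> t) = diagram_rank t"
  shows "conj_sign k d t = 1"
proof -
  define g where "g = d \<odot> t"
  have g: "g \<in> B" unfolding g_def using closed[OF d S_B[OF t]] .
  let ?c = "conjugate k d t"
  have cS: "?c \<in> S" using conj_S[OF d t] .
  have tf: "tops k (flip_diagram g) = tops k t"
    using cups_eq_tops[OF flip_cups_keep[OF d S_B[OF t] rank]] S_flip[OF t] by (simp add: g_def)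
  have tc: "tops k ?c = tops k g" using cups_eq_tops[OF cups_conj[OF d t]] by (simp add: g_def)
  have "\<forall>i\<in>tops k t. \<exists>j. strand j i \<in> g" using tops_flip_strand[OF basis_slim[OF g]] tf by blast
  from bchoice[OF this] obtain f where f: "\<And>i. i \<in> tops k t \<Longrightarrow> strand (f i) i \<in> g" by blast
  let ?L = "sorted_list_of_set (tops k t)" and ?M = "sorted_list_of_set (tops k g)"
  have mono: "f i < f i'" if "i \<in> tops k t" "i' \<in> tops k t" "i < i'" for i i'
    using strands_mono_iff[OF basis_noncrossing[OF g] BD[OF g] f[OF that(1)] f[OF that(2)]] that(3) by simp
  have img: "f ` tops k t = tops k g"
  proof
    show "f ` tops k t \<subseteq> tops k g" using strand_tops[OF BD[OF g] f] by blast
    show "tops k g \<subseteq> f ` tops k t"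
    proof
      fix j assume "j \<in> tops k g"
      then obtain i where ji: "strand j i \<in> g" using tops_strand[OF basis_slim[OF g]] by blast
      then have i: "i \<in> tops k t" using strand_flip_tops[OF BD[OF g]] tf by blast
      have "strand j i = strand (f i) i" using diagrams_eqD[OF BD[OF g] ji f[OF i], of "(1, i)"] by simp
      with i show "j \<in> f ` tops k t" by auto
    qed
  qed
  have "sorted_wrt (<) (map f ?L)"
    unfolding sorted_wrt_map using mono
    by (intro sorted_wrt_mono_rel[OF _ strict_sorted_list_of_set]) simp_all
  then have fL: "map f ?L = ?M"
    using img by (intro strict_sorted_equal) simp_all
  have lt: "fixed_list t = map (\<lambda>i. strand i i) ?L" using fixed_list_symmetric[OF S_B[OF t] S_sym[OF t]] .
  have lc: "fixed_list ?c = map (\<lambda>i. strand i i) ?M"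
    using fixed_list_symmetric[OF S_B[OF cS] S_sym[OF cS]] unfolding tc .
  have len: "length (fixed_list ?c) = length (fixed_list t)" unfolding lt lc fL[symmetric] by simp
  have dist: "distinct (fixed_list ?c)" unfolding lc by (simp add: distinct_map inj_on_strand)
  have "conj_perm k d t n = n" for n
  proof (cases "n < length (fixed_list t)")
    case True
    then have n: "n < length ?L" unfolding lt by simp
    then have i: "?L ! n \<in> tops k t" using nth_mem[OF n] by simp
    have "fixed_list ?c ! n = strand (f (?L ! n)) (f (?L ! n))" unfolding lc fL[symmetric] using n by simp
    also have "\<dots> = conj_block d t (fixed_list t ! n)"
      using conj_block_strand(1)[OF BD[OF d] BD[OF S_B[OF t]] S_sym[OF t] basis_slim[OF g, unfolded g_def]
        basis_slim[OF S_B[OF cS]] f[OF i, unfolded g_def] symmetric_tops_strand[OF S_B[OF t] S_sym[OF t] i]] n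
      unfolding lt by simp
    finally have eq: "fixed_list ?c ! n = conj_block d t (fixed_list t ! n)" .
    have "(THE j. j < length (fixed_list ?c) \<and> fixed_list ?c ! j = conj_block d t (fixed_list t ! n)) = n"
    proof (rule the_equality)
      show "n < length (fixed_list ?c) \<and> fixed_list ?c ! n = conj_block d t (fixed_list t ! n)"
        using True len eq by simp
      fix m assume m: "m < length (fixed_list ?c) \<and> fixed_list ?c ! m = conj_block d t (fixed_list t ! n)"
      then have "fixed_list ?c ! m = fixed_list ?c ! n" using eq by simp
      then show "m = n" using nth_eq_iff_index_eq[OF dist, of m n] m True len by simp
    qed
    then show ?thesis using True by (simp add: conj_perm_def)
  qed (simp add: conj_perm_def)
  then have "conj_perm k d t = id" by (simp add: fun_eq_iff)
  then show ?thesis by (simp add: conj_sign_def)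
qed

lemma conj_diagram_eq:
  assumes "d \<in> B" "t \<in> S"
  shows "conj_diagram x k d t =
    (if diagram_rank (d \<odot> t) = diagram_rank t then dscale (x ^ kappa k d t) (single_diagram (conjugate k d t)) else 0)"
  using conj_sign_1[OF assms] by (simp add: conj_diagram_def rank_conj[OF assms])

text \<open>With g = \<open>d2 \<circ> t\<close> the conjugate is g times its reflection. As long as
  \<open>d1\<close> keeps the rank of g, multiplying by the reflection of g does not change the top
  half of \<open>d1 \<circ> g\<close>. Ranks and conjugates on both sides can thus be compared by
  top halves alone.\<close>

lemma conj_comp:
  assumes d: "d1 \<in> B" "d2 \<in> B" and t: "t \<in> S" and rank: "diagram_rank (d2 \<odot> t) = diagram_rank t"
  shows "diagram_rank (d1 \<odot> conjugate k d2 t) = diagram_rank (conjugate k d2 t) \<longleftrightarrow>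
      diagram_rank ((d1 \<odot> d2) \<odot> t) = diagram_rank t" (is "?L \<longleftrightarrow> ?R")
    and "diagram_rank ((d1 \<odot> d2) \<odot> t) = diagram_rank t \<Longrightarrow>
      conjugate k d1 (conjugate k d2 t) = conjugate k (d1 \<odot> d2) t"
    and "diagram_rank ((d1 \<odot> d2) \<odot> t) = diagram_rank t \<Longrightarrow>
      x ^ kappa k d2 t * x ^ kappa k d1 (conjugate k d2 t) = x ^ kappa k d1 d2 * x ^ kappa k (d1 \<odot> d2) t"
proof -
  define g where "g = d2 \<odot> t"
  define c where "c = conjugate k d2 t"
  have g: "g \<in> B" unfolding g_def using closed[OF d(2) S_B[OF t]] .
  have g': "flip_diagram g \<in> B" using basis_flip[OF g] .
  have h: "d1 \<odot> g \<in> B" using closed[OF d(1) g] .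
  have c_eq: "c = g \<odot> flip_diagram g" unfolding c_def g_def using conj_eq[OF d(2) t] .
  have cS: "c \<in> S" unfolding c_def using conj_S[OF d(2) t] .
  have rc: "diagram_rank c = diagram_rank t" unfolding c_def using rank_conj[OF d(2) t] rank by simp
  have rg: "diagram_rank g = diagram_rank t" unfolding g_def by (rule rank)
  have d1c: "d1 \<odot> c = (d1 \<odot> g) \<odot> flip_diagram g" unfolding c_eq using assoc[OF d(1) g g'] by simp
  have d12: "(d1 \<odot> d2) \<odot> t = d1 \<odot> g" unfolding g_def using assoc[OF d S_B[OF t]] .
  have keep: "cups (flip_diagram (d1 \<odot> g)) = cups (flip_diagram g)" if ?R
    using flip_cups_keep[OF d(1) g] that by (simp add: d12 rg)
  have cups: "cups (d1 \<odot> c) = cups (d1 \<odot> g)" if ?R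
    unfolding d1c using cups_matched[OF h g' keep[OF that]] .
  have "?R" if ?L
  proof -
    have "diagram_rank (d1 \<odot> c) = diagram_rank t" using that rc by (simp flip: c_def)
    then have "diagram_rank t \<le> diagram_rank (d1 \<odot> g)" unfolding d1c using rank_comp_le(1)[OF h g'] by simp
    then show ?thesis using rank_comp_le(2)[OF d(1) g] rg by (simp add: d12)
  qed
  moreover have "?L" if ?R
    using rank_cups[OF closed[OF d(1) S_B[OF cS]] h cups[OF that]] that rc by (simp add: d12 flip: c_def)
  ultimately show "?L \<longleftrightarrow> ?R" by blast
  show "conjugate k d1 (conjugate k d2 t) = conjugate k (d1 \<odot> d2) t" if ?R
  proof (rule S_eqI)
    show "cups (conjugate k d1 (conjugate k d2 t)) = cups (conjugate k (d1 \<odot> d2) t)"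
      using cups[OF that] cups_conj[OF d(1) cS] cups_conj[OF closed[OF d] t] by (simp add: d12 flip: c_def)
  qed (use conj_S d t closed in blast)+
  show "x ^ kappa k d2 t * x ^ kappa k d1 (conjugate k d2 t) = x ^ kappa k d1 d2 * x ^ kappa k (d1 \<odot> d2) t" if ?R
  proof -
    \<comment> \<open>The left factors have the same bottom half, matching the top half of the
      reflected \<open>g\<close>, so equally many components are deleted. Cancelling in the cocycle
      law for \<open>d1\<close>, \<open>g\<close> and the reflected \<open>g\<close> leaves the same
      loop factor for \<open>d1\<close> against \<open>g\<close> as against the conjugate.\<close>
    have "kappa k (d1 \<odot> g) (flip_diagram g) = kappa k g (flip_diagram g)"
      using kappa_matched[OF basis_slim[OF h] basis_slim[OF g'] keep[OF that]]
        kappa_matched[OF basis_slim[OF g] basis_slim[OF g'] refl] by simp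
    with cocycle[OF d(1) g g'] nonzero have "x ^ kappa k d1 g = x ^ kappa k d1 c" by (simp add: c_eq)
    then show ?thesis using cocycle[OF d S_B[OF t]] by (simp add: g_def c_def)
  qed
qed

end

section \<open>Comparison of diagrams on p and on k strands\<close>

section \<open>Adding and removing strands\<close>

lemma card_ends: "card ({s} \<times> J) = card (J :: nat set)" for s :: nat
  by (simp add: card_cartesian_product)

lemma stack_components_partition:
  assumes "a \<in> diagrams k" "b \<in> diagrams k"
  shows "partition_on ({..2} \<times> {1..k}) (stack_components k [a, b])"
proof (rule partition_onI)
  have iff: "c \<in> stack_components k [a, b] \<longleftrightarrow> (\<exists>u\<in>{..2} \<times> {1..k}. c = component [a, b] u)" for c
    unfolding stack_components_iff by (simp add: numeral_2_eq_2)
  have "component [a, b] u \<subseteq> {..2} \<times> {1..k}" if "u \<in> {..2} \<times> {1..k}" for u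
    using conn_range2[OF assms _ that] by (meson Image_singleton_iff subsetI)
  then have sub: "c \<subseteq> {..2} \<times> {1..k}" if "c \<in> stack_components k [a, b]" for c
    using that unfolding iff by metis
  have self: "u \<in> component [a, b] u" for u by simp
  show "\<Union>(stack_components k [a, b]) = {..2} \<times> {1..k}"
  proof
    show "\<Union>(stack_components k [a, b]) \<subseteq> {..2} \<times> {1..k}" by (rule Union_least) (rule sub)
    show "{..2} \<times> {1..k} \<subseteq> \<Union>(stack_components k [a, b])"
    proof
      fix u :: vertex assume "u \<in> {..2} \<times> {1..k}"
      then have "component [a, b] u \<in> stack_components k [a, b]" unfolding iff by metis
      then show "u \<in> \<Union>(stack_components k [a, b])" using self by (rule UnionI)
    qed
  qed
  show "{} \<notin> stack_components k [a, b]"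
    unfolding iff using self by (metis empty_iff)
  fix c c' assume c: "c \<in> stack_components k [a, b]" "c' \<in> stack_components k [a, b]" "c \<noteq> c'"
  then obtain u u' where u: "c = component [a, b] u" "c' = component [a, b] u'" unfolding iff by blast
  show "disjnt c c'"
    unfolding disjnt_iff
  proof (intro allI notI)
    fix v assume "v \<in> c \<and> v \<in> c'"
    then have "conn [a, b] u v" "conn [a, b] u' v" unfolding u by simp_all
    then have "c = c'" unfolding u using component_eq by metis
    with c(3) show False ..
  qed
qed

lemma stack_components_closed:
  assumes "C \<in> stack_components k ds" "u \<in> C" "(u, v) \<in> stack_rel ds"
  shows "v \<in> C"
proof -
  obtain w where "C = component ds w" using assms(1) unfolding stack_components_iff by blast
  with assms(2) rtrancl_into_rtrancl[OF _ assms(3)] show ?thesis by simp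
qed

lemma stack_components_conn:
  assumes "C \<in> stack_components k ds" "u \<in> C" "v \<in> C"
  shows "conn ds u v"
proof -
  obtain w where w: "C = component ds w" using assms(1) unfolding stack_components_iff by blast
  then have "conn ds u w" "conn ds w v" using assms(2,3) conn_sym by simp_all
  then show ?thesis by (rule rtrancl_trans)
qed

lemma stack_rel_Un:
  "(u, v) \<in> stack_rel [a \<union> a', b \<union> b'] \<longleftrightarrow> (u, v) \<in> stack_rel [a, b] \<or> (u, v) \<in> stack_rel [a', b']"
proof
  assume "(u, v) \<in> stack_rel [a \<union> a', b \<union> b']"
  then show "(u, v) \<in> stack_rel [a, b] \<or> (u, v) \<in> stack_rel [a', b']"
  proof (rule stack_rel2E)
    fix c assume "c \<in> a \<union> a'" "u \<in> c" "v \<in> c"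
    then show ?thesis using stack_rel_top by blast
  next
    fix c w z assume "c \<in> b \<union> b'" "w \<in> c" "z \<in> c" "u = shift 1 w" "v = shift 1 z"
    then show ?thesis using stack_rel_second[of c b w z a "[]"] stack_rel_second[of c b' w z a' "[]"] by auto
  qed
next
  have "(u, v) \<in> stack_rel [a \<union> a', b \<union> b']" if "(u, v) \<in> stack_rel [c, d]" "c \<subseteq> a \<union> a'" "d \<subseteq> b \<union> b'" for c d
    using that(1)
  proof (rule stack_rel2E)
    fix e assume "e \<in> c" "u \<in> e" "v \<in> e"
    then show ?thesis using stack_rel_top[of e "a \<union> a'"] that(2) by blast
  next
    fix e w z assume "e \<in> d" "w \<in> e" "z \<in> e" "u = shift 1 w" "v = shift 1 z"
    then show ?thesis using stack_rel_second[of e "b \<union> b'" w z "a \<union> a'" "[]"] that(3) by auto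
  qed
  then show "(u, v) \<in> stack_rel [a, b] \<or> (u, v) \<in> stack_rel [a', b'] \<Longrightarrow> (u, v) \<in> stack_rel [a \<union> a', b \<union> b']"
    by blast
qed

text \<open>The primed parts live in the columns beyond \<open>p\<close>, so two stacks stand side
  by side without touching. The components of the second one are supplied as \<open>P\<close>; this
  serves both for the halves of \<open>E_k\<close> on two levels and for vertical strands above
  them.\<close>

lemma stack_components_Un:
  assumes D: "a \<in> diagrams p" "b \<in> diagrams p" and "p \<le> k"
    and part: "partition_on ({..2} \<times> {p<..k}) P"
    and range: "\<And>u v. (u, v) \<in> stack_rel [a', b'] \<Longrightarrow> u \<in> {..2} \<times> {p<..k}"
    and closed: "\<And>C u v. C \<in> P \<Longrightarrow> u \<in> C \<Longrightarrow> (u, v) \<in> stack_rel [a', b'] \<Longrightarrow> v \<in> C"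
    and conn: "\<And>C u v. C \<in> P \<Longrightarrow> u \<in> C \<Longrightarrow> v \<in> C \<Longrightarrow> conn [a', b'] u v"
  shows "stack_components k [a \<union> a', b \<union> b'] = stack_components p [a, b] \<union> P"
proof -
  let ?R = "stack_rel [a \<union> a', b \<union> b']"
  have part': "partition_on ({..2} \<times> {1..p}) (stack_components p [a, b])" using stack_components_partition[OF D] .
  have sub1: "C \<subseteq> {..2} \<times> {1..p}" if "C \<in> stack_components p [a, b]" for C
    using part' that unfolding partition_on_def by (metis Union_upper)
  have sub2: "C \<subseteq> {..2} \<times> {p<..k}" if "C \<in> P" for C
    using part that unfolding partition_on_def by (metis Union_upper)
  have range': "u \<in> {..2} \<times> {1..p}" if "(u, v) \<in> stack_rel [a, b]" for u v
  proof -
    have "d \<in> diagrams p" if "d \<in> set [a, b]" for d using that D by auto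
    from stack_rel_range[OF this symD[OF sym_stack_rel that]] show ?thesis by (simp add: numeral_2_eq_2)
  qed
  have disj: "False" if "u \<in> {..2} \<times> {1..p}" "u \<in> {..2} \<times> {p<..k}" for u :: vertex
    using that by auto
  have rows: "{..2} \<times> {1..k} = {..2} \<times> {1..p} \<union> ({..2} \<times> {p<..k} :: vertex set)"
    using \<open>p \<le> k\<close> by (auto simp: Sigma_Un_distrib2[symmetric] ivl_disj_un)
  have "components ({..2} \<times> {1..k}) ?R = stack_components p [a, b] \<union> P"
  proof (rule components_eqI)
    show "partition_on ({..2} \<times> {1..k}) (stack_components p [a, b] \<union> P)"
      unfolding rows
    proof (rule partition_onI)
      show "\<Union>(stack_components p [a, b] \<union> P) = {..2} \<times> {1..p} \<union> {..2} \<times> {p<..k}"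
        using part part' by (simp add: partition_on_def)
      show "{} \<notin> stack_components p [a, b] \<union> P" using part part' by (simp add: partition_on_def)
      fix C C' assume CC: "C \<in> stack_components p [a, b] \<union> P" "C' \<in> stack_components p [a, b] \<union> P" "C \<noteq> C'"
      have mixed: "disjnt X Y" if "X \<in> stack_components p [a, b]" "Y \<in> P" for X Y
        unfolding disjnt_iff using sub1[OF that(1)] sub2[OF that(2)] disj by (meson subsetD)
      consider "C \<in> stack_components p [a, b]" "C' \<in> stack_components p [a, b]" | "C \<in> P" "C' \<in> P"
        | "C \<in> stack_components p [a, b]" "C' \<in> P" | "C \<in> P" "C' \<in> stack_components p [a, b]" using CC by blast
      then show "disjnt C C'"
      proof cases
        case 1
        with part' CC(3) show ?thesis by (simp add: partition_on_def pairwise_def)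
      next
        case 2
        with part CC(3) show ?thesis by (simp add: partition_on_def pairwise_def)
      next
        case 3
        then show ?thesis by (rule mixed)
      next
        case 4
        then show ?thesis using mixed disjnt_sym by metis
      qed
    qed
  next
    fix C u v assume C: "C \<in> stack_components p [a, b] \<union> P" "u \<in> C" and R: "(u, v) \<in> ?R"
    from R have R': "(u, v) \<in> stack_rel [a, b] \<or> (u, v) \<in> stack_rel [a', b']" unfolding stack_rel_Un .
    from C(1) show "v \<in> C"
    proof
      assume C1: "C \<in> stack_components p [a, b]"
      then have "(u, v) \<in> stack_rel [a, b]" using R' range disj subsetD[OF sub1[OF C1] C(2)] by blast
      then show ?thesis by (rule stack_components_closed[OF C1 C(2)])
    next
      assume C1: "C \<in> P"
      then have "(u, v) \<in> stack_rel [a', b']" using R' range' disj subsetD[OF sub2[OF C1] C(2)] by blast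
      then show ?thesis by (rule closed[OF C1 C(2)])
    qed
  next
    have mono: "conn [a \<union> a', b \<union> b'] u v" if "conn [a, b] u v \<or> conn [a', b'] u v" for u v
    proof -
      have "stack_rel [a, b] \<subseteq> ?R" "stack_rel [a', b'] \<subseteq> ?R" using stack_rel_Un by (blast intro!: subrelI)+
      then show ?thesis using that rtrancl_mono by blast
    qed
    fix C u v assume "C \<in> stack_components p [a, b] \<union> P" "u \<in> C" "v \<in> C"
    then show "(u, v) \<in> ?R\<^sup>*" using mono stack_components_conn conn by (metis UnE)
  qed
  then show ?thesis unfolding stack_components_def by (simp add: numeral_2_eq_2)
qed

subsection \<open>The identity diagram\<close>

lemma id_block: "strand i i \<in> id_diagram k \<longleftrightarrow> i \<in> {1..k}"
  by (auto simp: id_diagram_def)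

lemma id_blockE:
  assumes "b \<in> id_diagram k"
  obtains i where "b = strand i i" "i \<in> {1..k}"
  using assms unfolding id_diagram_def by blast

lemma id_diagrams: "id_diagram k \<in> diagrams k"
proof -
  have "v \<in> \<Union>(id_diagram k) \<longleftrightarrow> v \<in> verts k" for v
  proof
    assume "v \<in> \<Union>(id_diagram k)"
    then obtain b where "b \<in> id_diagram k" "v \<in> b" by blast
    then show "v \<in> verts k" by (elim id_blockE) (auto simp: verts_def)
  next
    assume "v \<in> verts k"
    then obtain i where "v \<in> strand i i" "i \<in> {1..k}" by (auto simp: verts_def)
    then show "v \<in> \<Union>(id_diagram k)" using id_block by blast
  qed
  then have "\<Union>(id_diagram k) = verts k" by (rule set_eqI)
  moreover have "disjnt b c" if "b \<in> id_diagram k" "c \<in> id_diagram k" "b \<noteq> c" for b c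
    using that by (elim id_blockE) (auto simp: disjnt_def)
  moreover have "{} \<notin> id_diagram k" by (auto elim: id_blockE)
  ultimately show ?thesis unfolding diagrams_def by (auto intro: partition_onI)
qed

lemma id_basis: "id_diagram k \<in> diagram_basis F k"
proof -
  have "noncrossing (id_diagram k)"
    unfolding noncrossing_def
  proof (intro ballI impI notI)
    fix b c u u' v v'
    assume bc: "b \<in> id_diagram k" "c \<in> id_diagram k" "u \<in> b" "u' \<in> b" "v \<in> c" "v' \<in> c"
      and keys: "key u < key v \<and> key v < key u' \<and> key u' < key v'"
    obtain i where i: "b = strand i i" "i \<in> {1..k}" using bc(1) by (rule id_blockE)
    obtain j where j: "c = strand j j" "j \<in> {1..k}" using bc(2) by (rule id_blockE)
    have signs: "key (0, i) < 0" "key (0, j) < 0" "key (1, i) > 0" "key (1, j) > 0"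
      using i(2) j(2) by (auto simp: key_def)
    have u: "u = (0, i)" "u' = (1, i)" using bc(3,4) i(1) keys signs by auto
    have v: "v = (0, j)" "v' = (1, j)" using bc(5,6) j(1) keys signs u by auto
    show False using keys i(2) j(2) unfolding u v by (auto simp: key_def field_simps)
  qed
  moreover have "block_condition F b" if "b \<in> id_diagram k" for b
    using that by (rule id_blockE) (simp only: block_condition_strand)
  ultimately show ?thesis by (simp add: diagram_basis_iff id_diagrams)
qed

lemma flip_id: "flip_diagram (id_diagram k) = id_diagram k"
proof -
  have "flip ` strand i i = strand i i" for i by (simp add: insert_commute)
  then have "flip ` b = b" if "b \<in> id_diagram k" for b using that by (elim id_blockE) simp
  then have "(`) flip ` id_diagram k = (\<lambda>b. b) ` id_diagram k" by (intro image_cong) simp_all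
  then show ?thesis by (simp add: flip_diagram_def)
qed

lemma id_sym: "id_diagram k \<in> sym_diagrams F k"
  by (simp add: sym_diagrams_def symmetric_diagram_def id_basis flip_id)

lemma cups_id: "cups (id_diagram k) = {}"
proof -
  have "\<not> b \<subseteq> {0} \<times> UNIV" if b: "b \<in> id_diagram k" for b
  proof
    assume sub: "b \<subseteq> {0} \<times> UNIV"
    obtain i where "b = strand i i" using b by (rule id_blockE) (rule that)
    then have "(1, i) \<in> b" by simp
    from subsetD[OF sub this] show False by simp
  qed
  then have "\<not> (b \<in> id_diagram k \<and> b \<subseteq> {0} \<times> UNIV)" for b by metis
  then show ?thesis unfolding cups_def Collect_empty_eq by metis
qed

lemma rank_id: "diagram_rank (id_diagram k) = k"
proof -
  have "tops k (id_diagram k) = {1..k}" by (simp add: tops_def cups_id set_eq_iff)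
  then show ?thesis by (simp add: rank_tops[OF basis_slim[OF id_basis]])
qed

text \<open>Full rank leaves no room for cups in either half, and halves determine the
  diagram.\<close>

lemma rank_full:
  assumes "d \<in> diagram_basis F k" "diagram_rank d = k"
  shows "d = id_diagram k"
proof (rule halves_eqI[OF assms(1) id_basis])
  have *: "cups e = {}" if "e \<in> diagram_basis F k" "diagram_rank e = k" for e
    using cups_eqI[OF basis_slim[OF id_basis] basis_slim[OF that(1)]] that(2) by (simp add: cups_id rank_id)
  show "cups d = cups (id_diagram k)" using *[OF assms] by (simp add: cups_id)
  show "cups (flip_diagram d) = cups (flip_diagram (id_diagram k))"
    using *[OF basis_flip[OF assms(1)]] assms(2) rank_flip[OF slim_diagrams[OF basis_slim[OF assms(1)]]]
    by (simp add: cups_id flip_id)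
qed

lemma rank_le: "d \<in> slim k \<Longrightarrow> diagram_rank d \<le> k"
proof -
  assume d: "d \<in> slim k"
  have "tops k d \<subseteq> {1..k}" unfolding tops_def by (rule Collect_restrict)
  from card_mono[OF _ this] show ?thesis by (simp add: rank_tops[OF d])
qed

text \<open>The component over the block \<open>b\<close> when \<open>d\<close> is stacked above the
  identity: rows 1 and 2 are both copies of the bottom row of \<open>d\<close>, hence
  \<open>min m 1\<close>.\<close>

definition fibre :: "vertex set \<Rightarrow> vertex set" where
  "fibre b = {(m, i). m \<le> 2 \<and> (min m 1, i) \<in> b}"

lemma mem_fibre: "(m, i) \<in> fibre b \<longleftrightarrow> m \<le> 2 \<and> (min m 1, i) \<in> b"
  by (simp add: fibre_def)

lemma stack_components_id:
  assumes d: "d \<in> diagrams k"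
  shows "stack_components k [d, id_diagram k] = fibre ` d"
proof -
  have "components ({..2} \<times> {1..k}) (stack_rel [d, id_diagram k]) = fibre ` d"
  proof (rule components_eqI)
    show "partition_on ({..2} \<times> {1..k}) (fibre ` d)"
    proof (rule partition_onI)
      show "\<Union>(fibre ` d) = {..2} \<times> {1..k}"
      proof (rule set_eqI)
        fix v :: vertex obtain m i where v: "v = (m, i)" by (cases v)
        have "(\<exists>b\<in>d. (min m 1, i) \<in> b) \<longleftrightarrow> (min m 1, i) \<in> verts k"
          using diagrams_cover[OF d] diagrams_block_subset[OF d] by blast
        moreover have "(min m 1, i) \<in> verts k \<longleftrightarrow> i \<in> {1..k}" by (auto simp: verts_def)
        ultimately show "v \<in> \<Union>(fibre ` d) \<longleftrightarrow> v \<in> {..2} \<times> {1..k}" unfolding v by (auto simp: mem_fibre)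
      qed
      show "disjnt B C" if BC: "B \<in> fibre ` d" "C \<in> fibre ` d" "B \<noteq> C" for B C
      proof -
        obtain b c where bc: "b \<in> d" "c \<in> d" "B = fibre b" "C = fibre c" using BC by blast
        then have "b \<noteq> c" using BC(3) by blast
        then have "\<not> (w \<in> b \<and> w \<in> c)" for w using diagrams_eqD[OF d bc(1,2)] by blast
        then show ?thesis unfolding disjnt_iff bc by (simp add: mem_fibre split_paired_all)
      qed
      have "fibre b \<noteq> {}" if b: "b \<in> d" for b
      proof -
        obtain v where "v \<in> b" using diagrams_nonempty[OF d b] by blast
        moreover have "v \<in> verts k" using diagrams_block_subset[OF d b] \<open>v \<in> b\<close> by (rule subsetD)
        ultimately have "v \<in> fibre b" by (auto simp: verts_def mem_fibre)
        then show ?thesis by blast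
      qed
      then show "{} \<notin> fibre ` d" by (metis imageE)
    qed
  next
    fix C u v assume C: "C \<in> fibre ` d" "u \<in> C" and R: "(u, v) \<in> stack_rel [d, id_diagram k]"
    then obtain b where b: "b \<in> d" "C = fibre b" by blast
    from R show "v \<in> C"
    proof (rule stack_rel2E)
      fix c assume c: "c \<in> d" "u \<in> c" "v \<in> c"
      then have "u \<in> verts k" "v \<in> verts k" using diagrams_block_subset[OF d c(1)] by blast+
      then have mem: "w \<in> fibre b \<longleftrightarrow> w \<in> b" if "w \<in> {u, v}" for w b using that by (auto simp: verts_def mem_fibre)
      then have "b = c" using diagrams_eqD[OF d b(1) c(1)] c C(2) b by simp
      then show ?thesis using mem c b by simp
    next
      fix c w z assume c: "c \<in> id_diagram k" "w \<in> c" "z \<in> c" "u = shift 1 w" "v = shift 1 z"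
      obtain i where i: "c = strand i i" using c(1) by (rule id_blockE) (rule that)
      have "u \<in> {(1, i), (2, i)}" "v \<in> {(1, i), (2, i)}" using c i by auto
      then show ?thesis using C(2) unfolding b(2) by (auto simp: mem_fibre)
    qed
  next
    fix C u v assume C: "C \<in> fibre ` d" "u \<in> C" "v \<in> C"
    then obtain b where b: "b \<in> d" "C = fibre b" by blast
    have base: "conn [d, id_diagram k] (m, i) (min m 1, i) \<and> (min m 1, i) \<in> b" if "(m, i) \<in> C" for m i
    proof
      have mb: "m \<le> 2" "(min m 1, i) \<in> b" using that unfolding b(2) mem_fibre by simp_all
      then have "(min m 1, i) \<in> verts k" using diagrams_block_subset[OF d b(1)] by blast
      then have "strand i i \<in> id_diagram k" by (auto simp: verts_def id_block)
      then have "((2, i), (1, i)) \<in> stack_rel [d, id_diagram k]"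
        using stack_rel_second[of "strand i i" "id_diagram k" "(1, i)" "(0, i)" d "[]"] by simp
      moreover have "m = 2 \<or> m = min m 1" using mb(1) by auto
      ultimately show "conn [d, id_diagram k] (m, i) (min m 1, i)" by auto
    qed (use that in \<open>simp add: b(2) mem_fibre\<close>)
    obtain m i n j where uv: "u = (m, i)" "v = (n, j)" by (cases u; cases v)
    have "((min m 1, i), (min n 1, j)) \<in> stack_rel [d, id_diagram k]"
      using stack_rel_top[OF b(1)] base C uv by blast
    then show "(u, v) \<in> (stack_rel [d, id_diagram k])\<^sup>*"
      using base C(2,3) conn_sym unfolding uv by (meson r_into_rtrancl rtrancl_trans)
  qed
  then show ?thesis unfolding stack_components_def by (simp add: numeral_2_eq_2)
qed

lemma fibre_not_middle:
  assumes "d \<in> diagrams k" "b \<in> d"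
  shows "\<not> fibre b \<subseteq> {1} \<times> UNIV"
proof
  assume sub: "fibre b \<subseteq> {1} \<times> UNIV"
  obtain v where v: "v \<in> b" using diagrams_nonempty[OF assms] by blast
  have "v \<in> verts k" using diagrams_block_subset[OF assms] v by (rule subsetD)
  then obtain i where "v = (0, i) \<or> v = (1, i)" by (auto simp: verts_def)
  then have "(0, i) \<in> fibre b \<or> (2, i) \<in> fibre b" using v by (auto simp: mem_fibre)
  then show False using sub by auto
qed

lemma outer_fibre:
  assumes "d \<in> diagrams k" "b \<in> d"
  shows "outer 2 (fibre b) = b"
proof (rule set_eqI)
  fix v :: vertex obtain s i where v: "v = (s, i)" by (cases v)
  have "s = 0 \<or> s = 1" if "(s, i) \<in> b" using subsetD[OF diagrams_block_subset[OF assms] that] by (auto simp: verts_def)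
  then show "v \<in> outer 2 (fibre b) \<longleftrightarrow> v \<in> b" unfolding v by (auto simp: outer_iff mem_fibre)
qed

lemma compose_id:
  assumes "d \<in> diagrams k"
  shows "compose_diagram k d (id_diagram k) = d"
proof -
  have "compose_diagram k d (id_diagram k) = (\<lambda>b. outer 2 (fibre b)) ` d"
    unfolding compose_diagram_def stack_components_id[OF assms] using fibre_not_middle[OF assms] by blast
  also have "\<dots> = (\<lambda>b. b) ` d" using outer_fibre[OF assms] by (intro image_cong) auto
  finally show ?thesis by simp
qed

lemma id_compose:
  assumes "d \<in> diagrams k"
  shows "compose_diagram k (id_diagram k) d = d"
proof -
  have "flip_diagram (compose_diagram k (flip_diagram d) (id_diagram k)) = compose_diagram k (id_diagram k) d"
    using flip_compose[OF flip_diagrams[OF assms] id_diagrams] by (simp add: flip_id flip_flip_diagram[OF assms])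
  then show ?thesis unfolding compose_id[OF flip_diagrams[OF assms]] flip_flip_diagram[OF assms] by simp
qed

lemma kappa_id:
  shows "kappa k (id_diagram k) d = 0"
proof -
  have "\<not> c \<subseteq> {1} \<times> UNIV" if c: "c \<in> stack_components k [id_diagram k, d]" for c
  proof
    assume mid: "c \<subseteq> {1} \<times> UNIV"
    obtain w where w: "w \<in> {..length [id_diagram k, d]} \<times> {1..k}" "c = component [id_diagram k, d] w"
      using c unfolding stack_components_iff by blast
    then have "w \<in> c" by simp
    from subsetD[OF mid this] obtain i where i: "w = (1, i)" by auto
    then have "strand i i \<in> id_diagram k" using w by (simp add: id_block)
    then have "((1, i), (0, i)) \<in> stack_rel [id_diagram k, d]" using stack_rel_top by simp
    then have "(0, i) \<in> c" unfolding w(2) i by auto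
    from subsetD[OF mid this] show False by simp
  qed
  then have none: "{c \<in> stack_components k [id_diagram k, d]. c \<subseteq> {1} \<times> UNIV} = {}" by blast
  show ?thesis unfolding kappa_def none by simp
qed

subsection \<open>Capping off the last strands\<close>

text \<open>The added blocks are isolated vertices when k - p = 1 and a cup with a cap when k - p =
  2, so all three families are treated at once. Applied to the identity on \<open>p\<close> strands
  it gives \<open>E_k\<close>.\<close>

definition hat :: "nat \<Rightarrow> nat \<Rightarrow> diagram \<Rightarrow> diagram" where
  "hat p k d = d \<union> {{0} \<times> {p<..k}, {1} \<times> {p<..k}}"

context
  fixes p k :: nat
  assumes pk: "p < k"
begin

abbreviation "J \<equiv> {p<..k}"

lemma verts_split: "verts k = verts p \<union> {0} \<times> J \<union> {1} \<times> J"
  using pk by (auto simp: verts_def)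

lemma J_nonempty: "J \<noteq> {}"
  using pk by simp

lemma verts_J: "(s, i) \<in> verts p \<Longrightarrow> i \<notin> J"
  by (auto simp: verts_def)

lemma ends_notin: "d \<in> diagrams p \<Longrightarrow> {s} \<times> J \<notin> d"
  using diagrams_block_subset[of d p "{s} \<times> J"] pk by (fastforce simp: verts_def)

lemma hat_diagrams:
  assumes d: "d \<in> diagrams p"
  shows "hat p k d \<in> diagrams k"
  unfolding diagrams_def mem_Collect_eq
proof (rule partition_onI)
  show "\<Union>(hat p k d) = verts k"
    using d unfolding hat_def verts_split diagrams_def partition_on_def by auto
  have "(s, k) \<in> {s} \<times> J" for s :: nat using pk by simp
  then have "{s} \<times> J \<noteq> {}" for s :: nat by (metis empty_iff)
  moreover have "{} \<notin> d" using d by (simp add: diagrams_def partition_on_def)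
  ultimately show "{} \<notin> hat p k d" unfolding hat_def by (metis Un_iff insert_iff empty_iff)
  have 1: "disjnt b ({s} \<times> J)" if "b \<in> d" for b s
    using diagrams_block_subset[OF d that] verts_J by (fastforce simp: disjnt_iff)
  have 2: "disjnt ({0::nat} \<times> J) ({1} \<times> J)" by (auto simp: disjnt_iff)
  have 3: "disjnt b c" if "b \<in> d" "c \<in> d" "b \<noteq> c" for b c
    using d that by (simp add: diagrams_def partition_on_def pairwise_def)
  show "disjnt b c" if "b \<in> hat p k d" "c \<in> hat p k d" "b \<noteq> c" for b c
    using that unfolding hat_def by (elim UnE insertE emptyE) (use 1 2 3 disjnt_sym in metis)+
qed

lemma hat_inj:
  assumes "d \<in> diagrams p" "d' \<in> diagrams p" "hat p k d = hat p k d'"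
  shows "d = d'"
proof -
  have "e = hat p k e - {{0} \<times> J, {1} \<times> J}" if "e \<in> diagrams p" for e
    using ends_notin[OF that] unfolding hat_def by blast
  with assms show ?thesis by metis
qed

lemma rank_hat: "diagram_rank (hat p k d) = diagram_rank d"
proof -
  have "\<not> propagating ({s} \<times> J)" for s by (auto simp: propagating_def)
  then have "b \<in> hat p k d \<and> propagating b \<longleftrightarrow> b \<in> d \<and> propagating b" for b by (auto simp: hat_def)
  then show ?thesis by (simp add: diagram_rank_def)
qed

lemma flip_hat: "flip_diagram (hat p k d) = hat p k (flip_diagram d)"
proof -
  have "flip ` ({0} \<times> J) = {1} \<times> J" "flip ` ({1} \<times> J) = {0} \<times> J" by (auto simp: image_iff)
  then have "(`) flip ` {{0} \<times> J, {1} \<times> J} = {{1} \<times> J, {0} \<times> J}" by simp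
  then show ?thesis unfolding flip_diagram_def hat_def image_Un by (simp add: insert_commute)
qed

text \<open>In either row the columns beyond \<open>p\<close> have the keys closest to 0, so each
  new block occupies consecutive places in the boundary order. No other vertex lies between two of
  its vertices, which rules out alternation.\<close>

lemma noncrossing_hat:
  assumes nc: "noncrossing d" and d: "d \<in> diagrams p"
  shows "noncrossing (hat p k d)"
proof -
  have gap: False
    if v: "v \<in> {s} \<times> J" "v' \<in> {s} \<times> J" and w: "w \<in> verts p \<or> w \<in> {1 - s} \<times> J"
      and keys: "key v < key w" "key w < key v'" and s: "s = 0 \<or> s = 1" for s v v' w
  proof -
    define r where "r i = 1 / real i" for i
    have key: "key (0, i) = - r i" "key (1, i) = r i" for i by (simp_all add: r_def key_def)
    have J: "r j < r i" if "i \<in> {1..p}" "j \<in> J" for i j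
      using that by (auto simp: r_def field_simps)
    have pos: "0 < r i" if "i \<in> {1..p} \<or> i \<in> J" for i using that by (auto simp: r_def)
    obtain j j' where j: "v = (s, j)" "v' = (s, j')" "j \<in> J" "j' \<in> J" using v by auto
    have s': "s = 0 \<and> 1 - s = 1 \<or> s = 1 \<and> 1 - s = 0" using s by auto
    from w consider i where "w = (0, i)" "i \<in> {1..p}" | i where "w = (1, i)" "i \<in> {1..p}"
      | i where "w = (1 - s, i)" "i \<in> J"
      unfolding verts_def by blast
    then show False
    proof cases
      case (1 i)
      show False using s' J[OF 1(2) j(3)] J[OF 1(2) j(4)] pos[of j] pos[of j'] pos[of i] j(3,4) 1(2) keys
        unfolding 1(1) j(1,2) by (elim disjE conjE) (simp_all add: key)
    next
      case (2 i)
      show False using s' J[OF 2(2) j(3)] J[OF 2(2) j(4)] pos[of j] pos[of j'] pos[of i] j(3,4) 2(2) keys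
        unfolding 2(1) j(1,2) by (elim disjE conjE) (simp_all add: key)
    next
      case (3 i)
      show False using s' pos[of j] pos[of j'] pos[of i] j(3,4) 3(2) keys
        unfolding 3(1) j(1,2) by (elim disjE conjE) (simp_all add: key)
    qed
  qed
  have other: "w \<in> verts p \<or> w \<in> {1 - s} \<times> J"
    if "b \<in> hat p k d" "b \<noteq> {s} \<times> J" "w \<in> b" "s = 0 \<or> s = 1" for b w s
    using that diagrams_block_subset[OF d] unfolding hat_def by fastforce
  show ?thesis unfolding noncrossing_def
  proof (intro ballI impI notI)
    fix b c u u' v v'
    assume bc: "b \<in> hat p k d" "c \<in> hat p k d" "b \<noteq> c" "u \<in> b" "u' \<in> b" "v \<in> c" "v' \<in> c"
      and "key u < key v \<and> key v < key u' \<and> key u' < key v'"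
    then have keys: "key u < key v" "key v < key u'" "key u' < key v'" by auto
    show False
    proof (cases "\<exists>s. (s = 0 \<or> s = 1) \<and> b = {s} \<times> J")
      case True
      then obtain s where s: "s = 0 \<or> s = 1" "b = {s} \<times> J" by blast
      then have "c \<noteq> {s} \<times> J" using bc(3) by simp
      from gap[OF _ _ other[OF bc(2) this bc(6) s(1)] keys(1,2) s(1)] show False using bc(4,5) s(2) by simp
    next
      case False
      then have b: "b \<in> d" using bc(1) by (auto simp: hat_def)
      show False
      proof (cases "\<exists>s. (s = 0 \<or> s = 1) \<and> c = {s} \<times> J")
        case True
        then obtain s where s: "s = 0 \<or> s = 1" "c = {s} \<times> J" by blast
        then have "b \<noteq> {s} \<times> J" using bc(3) by simp
        from gap[OF _ _ other[OF bc(1) this bc(5) s(1)] keys(2,3) s(1)] show False using bc(6,7) s(2) by simp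
      next
        case False
        then have "c \<in> d" using bc(2) by (auto simp: hat_def)
        from noncrossingD[OF nc b this bc(3-7) keys] show False .
      qed
    qed
  qed
qed

lemma stack_components_hat:
  assumes "a \<in> diagrams p" "b \<in> diagrams p"
  shows "stack_components k [hat p k a, hat p k b] =
    stack_components p [a, b] \<union> {{0} \<times> J, {1} \<times> J, {2} \<times> J}"
  unfolding hat_def
proof (rule stack_components_Un[OF assms])
  have R: "\<exists>m\<in>{0, 1, 2}. u \<in> {m} \<times> J \<and> v \<in> {m} \<times> J"
    if "(u, v) \<in> stack_rel [{{0} \<times> J, {1} \<times> J}, {{0} \<times> J, {1} \<times> J}]" for u v
    using that by (rule stack_rel2E) auto
  show "p \<le> k" using pk by simp
  show "partition_on ({..2} \<times> J) {{0 :: nat} \<times> J, {1} \<times> J, {2} \<times> J}"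
  proof (rule partition_onI)
    have "m \<le> 2 \<longleftrightarrow> m = 0 \<or> m = 1 \<or> m = 2" for m :: nat by auto
    then show "\<Union>{{0 :: nat} \<times> J, {1} \<times> J, {2} \<times> J} = {..2} \<times> J" by auto
    show "{} \<notin> {{0 :: nat} \<times> J, {1} \<times> J, {2} \<times> J}" using J_nonempty by (simp add: eq_commute[of "{}"])
  qed (auto simp: disjnt_iff)
  show "u \<in> {..2} \<times> J" if "(u, v) \<in> stack_rel [{{0} \<times> J, {1} \<times> J}, {{0} \<times> J, {1} \<times> J}]" for u v
    using R[OF that] by auto
  show "v \<in> C" if "C \<in> {{0} \<times> J, {1} \<times> J, {2} \<times> J}" "u \<in> C"
    "(u, v) \<in> stack_rel [{{0} \<times> J, {1} \<times> J}, {{0} \<times> J, {1} \<times> J}]" for C u v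
    using that(1,2) R[OF that(3)] by auto
  show "conn [{{0} \<times> J, {1} \<times> J}, {{0} \<times> J, {1} \<times> J}] u v"
    if C: "C \<in> {{0} \<times> J, {1} \<times> J, {2} \<times> J}" "u \<in> C" "v \<in> C" for C u v
  proof -
    obtain m i j where uv: "u = (m, i)" "v = (m, j)" "m \<in> {0, 1, 2}" "i \<in> J" "j \<in> J" using C by auto
    have "m = 0 \<or> m = 1 \<or> m = 2" using uv(3) by simp
    then have "(u, v) \<in> stack_rel [{{0} \<times> J, {1} \<times> J}, {{0} \<times> J, {1} \<times> J}]"
      using stack_rel_top[of "{m} \<times> J" "{{0} \<times> J, {1} \<times> J}" u v]
        stack_rel_second[of "{1} \<times> J" "{{0} \<times> J, {1} \<times> J}" "(1, i)" "(1, j)" "{{0} \<times> J, {1} \<times> J}" "[]"] uv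
      by (elim disjE) simp_all
    then show ?thesis by (rule r_into_rtrancl)
  qed
qed

lemma outer_row: "outer 2 ({0} \<times> J) = {0} \<times> J" "outer 2 ({2} \<times> J) = {1} \<times> J" "outer 2 ({0, 1} \<times> J) = {0} \<times> J"
  by (auto simp: outer_iff)

lemma row_middle:
  "\<not> {0} \<times> J \<subseteq> {1 :: nat} \<times> UNIV" "\<not> {2} \<times> J \<subseteq> {1 :: nat} \<times> UNIV" "\<not> {0, 1} \<times> J \<subseteq> {1 :: nat} \<times> UNIV"
proof -
  have *: "\<not> A \<subseteq> B" if "z \<in> A" "z \<notin> B" for A B :: "vertex set" and z using that by blast
  have k: "k \<in> J" using pk by simp
  show "\<not> {0} \<times> J \<subseteq> {1 :: nat} \<times> UNIV" by (rule *[of "(0, k)"]) (simp_all add: k[simplified])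
  show "\<not> {2} \<times> J \<subseteq> {1 :: nat} \<times> UNIV" by (rule *[of "(2, k)"]) (simp_all add: k[simplified])
  show "\<not> {0, 1} \<times> J \<subseteq> {1 :: nat} \<times> UNIV" by (rule *[of "(0, k)"]) (simp_all add: k[simplified])
qed

lemma compose_hat:
  assumes "a \<in> diagrams p" "b \<in> diagrams p"
  shows "compose_diagram k (hat p k a) (hat p k b) = hat p k (compose_diagram p a b)"
proof -
  have "X \<in> compose_diagram k (hat p k a) (hat p k b) \<longleftrightarrow> X \<in> hat p k (compose_diagram p a b)" for X
  proof -
    have "X \<in> compose_diagram k (hat p k a) (hat p k b) \<longleftrightarrow>
      (\<exists>c. X = outer 2 c \<and> (c \<in> stack_components p [a, b] \<or> c = {0} \<times> J \<or> c = {1} \<times> J \<or> c = {2} \<times> J) \<and> \<not> c \<subseteq> {1} \<times> UNIV)"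
      unfolding compose_diagram_def stack_components_hat[OF assms]
      by (simp only: mem_Collect_eq Un_iff insert_iff empty_iff simp_thms)
    also have "\<dots> \<longleftrightarrow> X \<in> compose_diagram p a b \<or> X = {0} \<times> J \<or> X = {1} \<times> J"
    proof -
      have "{1} \<times> J \<subseteq> {1} \<times> UNIV" by auto
      then show ?thesis unfolding compose_diagram_def mem_Collect_eq using row_middle outer_row by metis
    qed
    finally show ?thesis
      unfolding hat_def[of p k "compose_diagram p a b"] by (simp only: Un_iff insert_iff empty_iff simp_thms)
  qed
  then show ?thesis by (rule set_eqI)
qed

text \<open>The additional deleted component consists of the lower half of one copy of
  \<open>E_k\<close> and the upper half of the next. It produces the factor x that the 1/x in
  \<open>e_idem\<close> cancels.\<close>

lemma kappa_hat:
  assumes "a \<in> diagrams p" "b \<in> diagrams p"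
  shows "kappa k (hat p k a) (hat p k b) = Suc (kappa p a b)"
proof -
  have part: "partition_on ({..2} \<times> {1..p}) (stack_components p [a, b])" using stack_components_partition[OF assms] .
  then have fin: "finite (stack_components p [a, b])" by (rule finite_elements[rotated]) simp
  have notin: "{1} \<times> J \<notin> stack_components p [a, b]"
  proof
    assume "{1} \<times> J \<in> stack_components p [a, b]"
    then have sub: "{1} \<times> J \<subseteq> {..2 :: nat} \<times> {1..p}" using part unfolding partition_on_def by (metis Union_upper)
    have "(1, k) \<in> {1 :: nat} \<times> J" using pk by simp
    from subsetD[OF sub this] show False using pk by simp
  qed
  have "c \<in> stack_components k [hat p k a, hat p k b] \<and> c \<subseteq> {1} \<times> UNIV \<longleftrightarrow>
      c \<in> insert ({1} \<times> J) {c \<in> stack_components p [a, b]. c \<subseteq> {1} \<times> UNIV}" for c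
  proof -
    have "{1} \<times> J \<subseteq> {1} \<times> UNIV" by auto
    then show ?thesis unfolding stack_components_hat[OF assms] using row_middle by auto
  qed
  then have "{c \<in> stack_components k [hat p k a, hat p k b]. c \<subseteq> {1} \<times> UNIV} =
      insert ({1} \<times> J) {c \<in> stack_components p [a, b]. c \<subseteq> {1} \<times> UNIV}" by blast
  then show ?thesis unfolding kappa_def using fin notin by simp
qed

text \<open>The vertical strands beyond \<open>p\<close> tie the upper half of \<open>E_k\<close> in
  the middle row to row 0. It becomes the upper half of the product, and nothing is deleted.\<close>

lemma stack_components_extend:
  assumes d: "d \<in> diagrams p"
  shows "stack_components k [extend_diagram p k d, hat p k (id_diagram p)] = fibre ` d \<union> {{0, 1} \<times> J, {2} \<times> J}"
  unfolding extend_diagram_def hat_def stack_components_id[OF d, symmetric]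
proof (rule stack_components_Un[OF d id_diagrams])
  let ?v = "{strand i i | i. i \<in> J}"
  let ?e = "{{0} \<times> J, {1} \<times> J}"
  have R: "u \<in> {0, 1} \<times> J \<and> v \<in> {0, 1} \<times> J \<or> u \<in> {2} \<times> J \<and> v \<in> {2} \<times> J"
    if "(u, v) \<in> stack_rel [?v, ?e]" for u v
    using that by (rule stack_rel2E) auto
  show "p \<le> k" using pk by simp
  show "partition_on ({..2} \<times> J) {{0 :: nat, 1} \<times> J, {2} \<times> J}"
  proof (rule partition_onI)
    have "m \<le> 2 \<longleftrightarrow> m = 0 \<or> m = 1 \<or> m = 2" for m :: nat by auto
    then show "\<Union>{{0 :: nat, 1} \<times> J, {2} \<times> J} = {..2} \<times> J" by auto
    show "{} \<notin> {{0 :: nat, 1} \<times> J, {2} \<times> J}" using J_nonempty by (simp add: eq_commute[of "{}"])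
  qed (auto simp: disjnt_iff)
  show "u \<in> {..2} \<times> J" if "(u, v) \<in> stack_rel [?v, ?e]" for u v
    using R[OF that] by auto
  show "v \<in> C" if "C \<in> {{0, 1} \<times> J, {2} \<times> J}" "u \<in> C" "(u, v) \<in> stack_rel [?v, ?e]" for C u v
    using that(1,2) R[OF that(3)] by auto
  show "conn [?v, ?e] u v" if C: "C \<in> {{0, 1} \<times> J, {2} \<times> J}" "u \<in> C" "v \<in> C" for C u v
  proof -
    have mid: "conn [?v, ?e] (1, i) (1, j)" if "i \<in> J" "j \<in> J" for i j
      using stack_rel_second[of "{0} \<times> J" ?e "(0, i)" "(0, j)" ?v "[]"] that by (simp add: r_into_rtrancl)
    have low: "conn [?v, ?e] (2, i) (2, j)" if "i \<in> J" "j \<in> J" for i j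
      using stack_rel_second[of "{1} \<times> J" ?e "(1, i)" "(1, j)" ?v "[]"] that by (simp add: r_into_rtrancl)
    have vert: "conn [?v, ?e] (m, i) (1, i)" if "i \<in> J" "m = 0 \<or> m = 1" for m i
    proof -
      have "strand i i \<in> ?v" using that(1) by blast
      from stack_rel_top[OF this, of "(0, i)" "(1, i)"] show ?thesis using that(2) by auto
    qed
    obtain m i n j where uv: "u = (m, i)" "v = (n, j)" by (cases u; cases v)
    consider "m = 0 \<or> m = 1" "n = 0 \<or> n = 1" "i \<in> J" "j \<in> J" | "m = 2" "n = 2" "i \<in> J" "j \<in> J"
      using C uv by auto
    then show ?thesis
    proof cases
      case 1
      have "conn [?v, ?e] (m, i) (1, j)" using vert[OF 1(3,1)] mid[OF 1(3,4)] by (rule rtrancl_trans)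
      then show ?thesis unfolding uv using conn_sym[OF vert[OF 1(4,2)]] by (rule rtrancl_trans)
    next
      case 2
      then show ?thesis unfolding uv using low by simp
    qed
  qed
qed

lemma compose_extend:
  assumes d: "d \<in> diagrams p"
  shows "compose_diagram k (extend_diagram p k d) (hat p k (id_diagram p)) = hat p k d"
proof -
  have "X \<in> compose_diagram k (extend_diagram p k d) (hat p k (id_diagram p)) \<longleftrightarrow> X \<in> hat p k d" for X
  proof -
    have "X \<in> compose_diagram k (extend_diagram p k d) (hat p k (id_diagram p)) \<longleftrightarrow>
      (\<exists>c. X = outer 2 c \<and> (c \<in> fibre ` d \<or> c = {0, 1} \<times> J \<or> c = {2} \<times> J) \<and> \<not> c \<subseteq> {1} \<times> UNIV)"
      unfolding compose_diagram_def stack_components_extend[OF d]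
      by (simp only: mem_Collect_eq Un_iff insert_iff empty_iff simp_thms)
    also have "\<dots> \<longleftrightarrow> (\<exists>b\<in>d. X = outer 2 (fibre b)) \<or> X = {0} \<times> J \<or> X = {1} \<times> J"
    proof -
      have split: "(\<exists>c. P c \<and> (c \<in> fibre ` d \<or> c = A \<or> c = A') \<and> Q c) \<longleftrightarrow>
          (\<exists>b\<in>d. P (fibre b) \<and> Q (fibre b)) \<or> P A \<and> Q A \<or> P A' \<and> Q A'" for P Q A A' by blast
      have "(\<exists>b\<in>d. X = outer 2 (fibre b) \<and> \<not> fibre b \<subseteq> {1} \<times> UNIV) \<longleftrightarrow> (\<exists>b\<in>d. X = outer 2 (fibre b))"
        using fibre_not_middle[OF d] by metis
      then show ?thesis unfolding split using row_middle outer_row by metis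
    qed
    also have "(\<exists>b\<in>d. X = outer 2 (fibre b)) \<longleftrightarrow> X \<in> d" using outer_fibre[OF d] by metis
    finally show ?thesis
      unfolding hat_def[of p k d] by (simp only: Un_iff insert_iff empty_iff simp_thms)
  qed
  then show ?thesis by (rule set_eqI)
qed

lemma kappa_extend:
  assumes d: "d \<in> diagrams p"
  shows "kappa k (extend_diagram p k d) (hat p k (id_diagram p)) = 0"
proof -
  have "\<not> c \<subseteq> {1} \<times> UNIV" if "c \<in> fibre ` d \<union> {{0, 1} \<times> J, {2} \<times> J}" for c
    using that fibre_not_middle[OF d] row_middle by (elim UnE insertE imageE) simp_all
  then have none: "{c \<in> stack_components k [extend_diagram p k d, hat p k (id_diagram p)]. c \<subseteq> {1} \<times> UNIV} = {}"
    unfolding stack_components_extend[OF d] by blast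
  show ?thesis unfolding kappa_def none by simp
qed

lemma unhat:
  assumes c: "c \<in> diagrams k" "{0} \<times> J \<in> c" "{1} \<times> J \<in> c"
  obtains d where "d \<in> diagrams p" "c = hat p k d" "d \<subseteq> c"
proof -
  define d where "d = c - {{0} \<times> J, {1} \<times> J}"
  have sub: "b \<subseteq> verts p" if b: "b \<in> d" for b
  proof
    fix v assume v: "v \<in> b"
    have "b \<in> c" "b \<noteq> {0} \<times> J" "b \<noteq> {1} \<times> J" using b by (simp_all add: d_def)
    then have "v \<notin> {0} \<times> J" "v \<notin> {1} \<times> J" using diagrams_eqD[OF c(1) \<open>b \<in> c\<close> _ v] c(2,3) by metis+
    moreover have "v \<in> verts k" using diagrams_block_subset[OF c(1) \<open>b \<in> c\<close>] v by (rule subsetD)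
    ultimately show "v \<in> verts p" unfolding verts_split by blast
  qed
  have "d \<in> diagrams p"
    unfolding diagrams_def mem_Collect_eq
  proof (rule partition_onI)
    have "\<exists>b\<in>d. v \<in> b" if v: "v \<in> verts p" for v
    proof -
      have "v \<in> verts k" using v unfolding verts_split by blast
      then obtain b where b: "b \<in> c" "v \<in> b" using diagrams_cover[OF c(1)] by blast
      have "v \<notin> {s} \<times> J" for s using verts_J[of "fst v" "snd v"] v by auto
      then have "b \<in> d" using b unfolding d_def by blast
      with b show ?thesis by blast
    qed
    then show "\<Union>d = verts p" using sub by blast
    show "disjnt a b" if "a \<in> d" "b \<in> d" "a \<noteq> b" for a b
      using c(1) that by (simp add: d_def diagrams_def partition_on_def pairwise_def)
    show "{} \<notin> d" using c(1) by (simp add: d_def diagrams_def partition_on_def)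
  qed
  moreover have "c = hat p k d" "d \<subseteq> c" using c(2,3) by (auto simp: d_def hat_def)
  ultimately show ?thesis by (rule that)
qed

end

text \<open>Says that the subtraction in \<open>lower\<close> is not truncated: k is at least 2 for
  Temperley-Lieb and at least 1 otherwise.\<close>

definition reducible :: "planar_family \<Rightarrow> nat \<Rightarrow> bool" where
  "reducible F k \<longleftrightarrow> k = lower F k + (if F = TL then 2 else 1)"

lemma reducible_less: "reducible F k \<Longrightarrow> lower F k < k"
  by (auto simp: reducible_def split: if_splits)

lemma block_condition_end:
  assumes "reducible F k" "s = 0 \<or> s = 1"
  shows "block_condition F ({s} \<times> {lower F k<..k})"
proof (cases F)
  case TL
  then show ?thesis using assms by (auto simp: reducible_def card_ends)
next
  case Motzkin
  then show ?thesis using assms by (auto simp: reducible_def card_ends)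
next
  case Planar_Rook
  have "{s} \<times> {lower F k<..k} \<inter> {t} \<times> UNIV \<subseteq> {t} \<times> {lower F k<..k}" for t by auto
  from card_mono[OF _ this] have "card ({s} \<times> {lower F k<..k} \<inter> {t} \<times> UNIV) \<le> k - lower F k" for t
    by (simp add: card_ends)
  moreover have "k - lower F k = 1" using assms(1) Planar_Rook by (auto simp: reducible_def)
  ultimately show ?thesis using Planar_Rook by simp
qed

lemma hat_basis:
  assumes "reducible F k" "d \<in> diagram_basis F (lower F k)"
  shows "hat (lower F k) k d \<in> diagram_basis F k"
proof -
  note pk = reducible_less[OF assms(1)]
  have d: "d \<in> diagrams (lower F k)" "noncrossing d" "\<And>b. b \<in> d \<Longrightarrow> block_condition F b"
    using assms(2) by (auto simp: diagram_basis_iff)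
  have "block_condition F b" if "b \<in> hat (lower F k) k d" for b
    using that d(3) block_condition_end[OF assms(1)] unfolding hat_def by blast
  then show ?thesis by (simp add: diagram_basis_iff hat_diagrams[OF pk d(1)] noncrossing_hat[OF pk d(2,1)])
qed

lemma unhat_basis:
  assumes "reducible F k" "c \<in> diagram_basis F k" "{0} \<times> {lower F k<..k} \<in> c" "{1} \<times> {lower F k<..k} \<in> c"
  obtains d where "d \<in> diagram_basis F (lower F k)" "c = hat (lower F k) k d"
proof -
  have c: "c \<in> diagrams k" "noncrossing c" "\<And>b. b \<in> c \<Longrightarrow> block_condition F b"
    using assms(2) by (auto simp: diagram_basis_iff)
  obtain d where d: "d \<in> diagrams (lower F k)" "c = hat (lower F k) k d" "d \<subseteq> c"
    using unhat[OF reducible_less[OF assms(1)] c(1) assms(3,4)] .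
  have "d \<in> diagram_basis F (lower F k)"
    using d c(3) noncrossing_subset[OF c(2) d(3)] by (auto simp: diagram_basis_iff)
  then show ?thesis using d(2) by (rule that)
qed

lemma hat_sym:
  assumes "reducible F k" "t \<in> sym_diagrams F (lower F k)"
  shows "hat (lower F k) k t \<in> sym_diagrams F k"
  using assms hat_basis flip_hat[OF reducible_less[OF assms(1)]]
  by (simp add: sym_diagrams_def symmetric_diagram_def)

lemma hat_sym_iff:
  assumes "reducible F k" "d \<in> diagram_basis F (lower F k)"
  shows "hat (lower F k) k d \<in> sym_diagrams F k \<longleftrightarrow> d \<in> sym_diagrams F (lower F k)"
proof
  note pk = reducible_less[OF assms(1)]
  have D: "d \<in> diagrams (lower F k)" using assms(2) by (simp add: diagram_basis_iff)
  assume "hat (lower F k) k d \<in> sym_diagrams F k"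
  then have "hat (lower F k) k (flip_diagram d) = hat (lower F k) k d"
    by (simp add: sym_diagrams_def symmetric_diagram_def flip_hat[OF pk])
  from hat_inj[OF pk flip_diagrams[OF D] D this] show "d \<in> sym_diagrams F (lower F k)"
    using assms(2) by (simp add: sym_diagrams_def symmetric_diagram_def)
qed (rule hat_sym[OF assms(1)])

lemma E_hat:
  assumes "reducible F k"
  shows "E_diagram F k = hat (lower F k) k (id_diagram (lower F k))"
proof (cases F)
  case TL
  then have "2 \<le> k" using assms by (auto simp: reducible_def)
  then have J: "{lower F k<..k} = {k - 1, k}" using TL by auto
  have "{s} \<times> {k - 1, k} = {(s, k - 1), (s, k)}" for s :: nat by auto
  with J TL show ?thesis by (simp add: E_diagram_def hat_def)
next
  case Motzkin
  then have J: "{lower F k<..k} = {k}" using assms by (auto simp: reducible_def)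
  have "{s} \<times> {k} = {(s, k)}" for s :: nat by auto
  with J Motzkin show ?thesis by (simp add: E_diagram_def hat_def)
next
  case Planar_Rook
  then have J: "{lower F k<..k} = {k}" using assms by (auto simp: reducible_def)
  have "{s} \<times> {k} = {(s, k)}" for s :: nat by auto
  with J Planar_Rook show ?thesis by (simp add: E_diagram_def hat_def)
qed

lemma label_reducible:
  assumes "label_ok F k r" "r < k"
  shows "reducible F k" "label_ok F (lower F k) r"
proof -
  show red: "reducible F k"
  proof (cases F)
    case TL
    have "k \<noteq> 1" using assms TL by (auto simp: label_ok_def)
    with TL assms(2) show ?thesis by (auto simp: reducible_def)
  qed (use assms(2) in \<open>auto simp: reducible_def\<close>)
  show "label_ok F (lower F k) r"
  proof (cases F)
    case TL
    then have k: "k = lower F k + 2" using red by (simp add: reducible_def)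
    have parity: "r mod 2 = k mod 2" using assms(1) TL by (simp add: label_ok_def)
    then have "r mod 2 = lower F k mod 2" using k by (metis mod_add_self2)
    moreover have "r \<le> lower F k"
    proof (rule ccontr)
      assume "\<not> r \<le> lower F k"
      then have "k = r + 1" using assms(2) k by linarith
      moreover have "even r \<longleftrightarrow> even k" using parity by (simp add: even_iff_mod_2_eq_zero)
      ultimately show False by simp
    qed
    ultimately show ?thesis using TL by (simp add: label_ok_def)
  qed (use assms red in \<open>auto simp: label_ok_def reducible_def\<close>)
qed

text \<open>The identity on r strands has rank r, and adding the two halves of \<open>E_k\<close>
  repeatedly keeps symmetry and rank.\<close>

lemma sym_exists:
  assumes "label_ok F k r"
  shows "\<exists>t\<in>sym_diagrams F k. diagram_rank t = r"
  using assms
proof (induction k rule: less_induct)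
  case (less k)
  show ?case
  proof (cases "r = k")
    case True
    then show ?thesis using id_sym rank_id by blast
  next
    case False
    then have "r < k" using less.prems by (simp add: label_ok_def)
    note red = label_reducible[OF less.prems this]
    obtain t where t: "t \<in> sym_diagrams F (lower F k)" "diagram_rank t = r"
      using less.IH[OF reducible_less[OF red(1)] red(2)] by blast
    have "diagram_rank (hat (lower F k) k t) = r" using rank_hat[OF reducible_less[OF red(1)]] t(2) by simp
    with hat_sym[OF red(1) t(1)] show ?thesis by blast
  qed
qed

text \<open>All Temperley-Lieb cups have two vertices, so the number of top vertices that are not
  free is even.\<close>

lemma rank_parity:
  assumes d: "d \<in> diagram_basis TL k"
  shows "diagram_rank d mod 2 = k mod 2"
proof -
  note D = slim_diagrams[OF basis_slim[OF d]]
  have sub: "b \<subseteq> verts k" if "b \<in> cups d" for b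
    using diagrams_block_subset[OF D] that by (simp add: cups_def)
  have "card (\<Union>(cups d)) = sum card (cups d)"
  proof (rule card_Union_disjoint)
    show "disjoint (cups d)" using D by (auto simp: cups_def diagrams_def partition_on_def pairwise_def)
    show "finite b" if "b \<in> cups d" for b using sub[OF that] finite_verts by (rule finite_subset)
  qed
  also have "\<dots> = sum (\<lambda>_. 2) (cups d)" using d by (intro sum.cong) (simp_all add: cups_def diagram_basis_iff)
  finally have card: "card (\<Union>(cups d)) = 2 * card (cups d)" by simp
  let ?X = "{i \<in> {1..k}. (0, i) \<in> \<Union>(cups d)}"
  have "\<Union>(cups d) = Pair 0 ` ?X"
  proof (rule set_eqI)
    fix v
    show "v \<in> \<Union>(cups d) \<longleftrightarrow> v \<in> Pair 0 ` ?X"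
    proof
      assume v: "v \<in> \<Union>(cups d)"
      then obtain b where b: "b \<in> cups d" "v \<in> b" by blast
      obtain i where i: "v = (0, i)" "(0, i) \<in> verts k" using cups_mem[OF D b] .
      then have "i \<in> ?X" using v by (simp add: verts_def)
      then show "v \<in> Pair 0 ` ?X" unfolding i(1) by (rule imageI)
    next
      assume "v \<in> Pair 0 ` ?X"
      then obtain i where "v = (0, i)" "i \<in> ?X" by blast
      then show "v \<in> \<Union>(cups d)" by simp
    qed
  qed
  from arg_cong[OF this, of card] have "card (Pair (0 :: nat) ` ?X) = 2 * card (cups d)" using card by simp
  moreover have "card (Pair (0 :: nat) ` ?X) = card ?X" by (rule card_image) (rule inj_onI, simp)
  ultimately have X: "card ?X = 2 * card (cups d)" by (rule trans[OF sym, rotated])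
  have "{1..k} = tops k d \<union> ?X" "tops k d \<inter> ?X = {}" unfolding tops_def by blast+
  moreover have "finite ?X" by (rule finite_subset[of _ "{1..k}"]) (blast, simp)
  ultimately have "card {1..k} = card (tops k d) + card ?X" by (metis card_Un_disjoint finite_tops)
  then have "k = diagram_rank d + 2 * card (cups d)"
    unfolding X rank_tops[OF basis_slim[OF d]] by simp
  then show ?thesis by (metis mod_mult_self2)
qed

section \<open>Linear extension from basis diagrams\<close>

section \<open>Formal linear combinations of diagrams\<close>

abbreviation coef :: "'a::field dvec \<Rightarrow> diagram \<Rightarrow> 'a" where
  "coef \<equiv> Poly_Mapping.lookup"

lemma coef_dscale [simp]: "coef (dscale c v) d = c * coef v d"
  by (simp add: dscale_def map.rep_eq when_def)

lemma coef_single: "coef (single_diagram d) e = (if d = e then 1 else 0)"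
  by (simp add: single_diagram_def lookup_single when_def)

lemma dvec_eqI: "(\<And>d. coef v d = coef w d) \<Longrightarrow> v = w"
  by (rule poly_mapping_eqI)

lemma vector_space_dscale: "vector_space (dscale :: 'a::field \<Rightarrow> 'a dvec \<Rightarrow> 'a dvec)"
  by unfold_locales (auto intro!: dvec_eqI simp: lookup_add algebra_simps)

interpretation dvec: vector_space dscale
  by (rule vector_space_dscale)

lemma lin_iff: "v \<in> lin D \<longleftrightarrow> (\<forall>d. d \<notin> D \<longrightarrow> coef v d = 0)"
  unfolding lin_def by (auto simp: in_keys_iff)

lemma lin_zero: "0 \<in> lin D" and lin_add: "v \<in> lin D \<Longrightarrow> w \<in> lin D \<Longrightarrow> v + w \<in> lin D"
  and lin_dscale: "v \<in> lin D \<Longrightarrow> dscale c v \<in> lin D"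
  by (simp_all add: lin_iff lookup_add)

lemma lin_subspace: "module.subspace dscale (lin D)"
  unfolding dvec.subspace_def using lin_zero lin_add lin_dscale by blast

lemma lin_sum: "(\<And>i. i \<in> I \<Longrightarrow> f i \<in> lin D) \<Longrightarrow> sum f I \<in> lin D"
  by (rule dvec.subspace_sum[OF lin_subspace])

lemma lin_single: "d \<in> D \<Longrightarrow> single_diagram d \<in> lin D"
  by (auto simp: lin_iff coef_single)

lemma lin_mono: "D \<subseteq> D' \<Longrightarrow> lin D \<subseteq> lin D'"
  unfolding lin_def by blast

lemma single_nonzero: "single_diagram d \<noteq> (0 :: 'a::field dvec)"
  using coef_single[of d d, where 'a = 'a] by (metis lookup_zero zero_neq_one)

lemma dvec_expand: "v = (\<Sum>d\<in>Poly_Mapping.keys v. dscale (coef v d) (single_diagram d))"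
proof (rule dvec_eqI)
  fix e
  have "coef (\<Sum>d\<in>Poly_Mapping.keys v. dscale (coef v d) (single_diagram d)) e =
      (\<Sum>d\<in>Poly_Mapping.keys v. if d = e then coef v d else 0)"
    by (simp add: lookup_sum coef_single if_distrib cong: if_cong)
  also have "\<dots> = coef v e" by (simp add: sum.delta' in_keys_iff)
  finally show "coef v e = coef (\<Sum>d\<in>Poly_Mapping.keys v. dscale (coef v d) (single_diagram d)) e" ..
qed

lemma lin_singleton: "v \<in> lin {d} \<Longrightarrow> v = dscale (coef v d) (single_diagram d)"
  by (rule dvec_eqI) (auto simp: lin_iff coef_single)

definition dlinear :: "('a::field dvec \<Rightarrow> 'a dvec) \<Rightarrow> bool" where
  "dlinear f \<longleftrightarrow> (\<forall>v w. f (v + w) = f v + f w) \<and> (\<forall>c v. f (dscale c v) = dscale c (f v))"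

lemma dlinear_add: "dlinear f \<Longrightarrow> f (v + w) = f v + f w" and dlinear_scale: "dlinear f \<Longrightarrow> f (dscale c v) = dscale c (f v)"
  by (simp_all add: dlinear_def)

lemma dlinear_zero: "dlinear f \<Longrightarrow> f 0 = 0"
  using dlinear_scale[of f 0 0] by simp

lemma dlinear_sum: "dlinear f \<Longrightarrow> f (sum g I) = (\<Sum>i\<in>I. f (g i))"
  by (induction I rule: infinite_finite_induct) (simp_all add: dlinear_zero dlinear_add)

lemma dlinear_comp: "dlinear f \<Longrightarrow> dlinear g \<Longrightarrow> dlinear (\<lambda>v. f (g v))"
  by (simp add: dlinear_def)

lemma dlinear_dscale: "dlinear (dscale c)"
  by (simp add: dlinear_def dvec.scale_right_distrib mult.commute)

lemma dlinear_eq: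
  assumes "dlinear f" "dlinear g" "v \<in> lin D" "\<And>d. d \<in> D \<Longrightarrow> f (single_diagram d) = g (single_diagram d)"
  shows "f v = g v"
proof -
  have "f (single_diagram d) = g (single_diagram d)" if "d \<in> Poly_Mapping.keys v" for d
    using assms(3,4) that by (auto simp: lin_def)
  then have "(\<Sum>d\<in>Poly_Mapping.keys v. f (dscale (coef v d) (single_diagram d))) =
      (\<Sum>d\<in>Poly_Mapping.keys v. g (dscale (coef v d) (single_diagram d)))"
    by (intro sum.cong) (simp_all add: dlinear_scale assms(1,2))
  then show ?thesis
    by (subst (1 2) dvec_expand) (simp add: dlinear_sum assms(1,2))
qed

lemma dlinear_lin:
  assumes "dlinear f" "v \<in> lin D" "\<And>d. d \<in> D \<Longrightarrow> f (single_diagram d) \<in> lin D'"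
  shows "f v \<in> lin D'"
proof -
  have "f (single_diagram d) \<in> lin D'" if "d \<in> Poly_Mapping.keys v" for d
    using assms(2,3) that by (auto simp: lin_def)
  then have "(\<Sum>d\<in>Poly_Mapping.keys v. f (dscale (coef v d) (single_diagram d))) \<in> lin D'"
    by (intro lin_sum) (simp add: dlinear_scale[OF assms(1)] lin_dscale)
  then show ?thesis by (subst dvec_expand) (simp add: dlinear_sum[OF assms(1)])
qed

definition lin_ext :: "(diagram \<Rightarrow> 'a dvec) \<Rightarrow> 'a::field dvec \<Rightarrow> 'a dvec" where
  "lin_ext g v = (\<Sum>d\<in>Poly_Mapping.keys v. dscale (coef v d) (g d))"

lemma lin_ext_superset:
  assumes "finite A" "Poly_Mapping.keys v \<subseteq> A"
  shows "lin_ext g v = (\<Sum>d\<in>A. dscale (coef v d) (g d))"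
  unfolding lin_ext_def using assms by (intro sum.mono_neutral_left) (auto simp: in_keys_iff)

lemma dlinear_lin_ext: "dlinear (lin_ext g)"
  unfolding dlinear_def
proof (intro conjI allI)
  fix v w :: "'a dvec" and c :: 'a
  let ?A = "Poly_Mapping.keys v \<union> Poly_Mapping.keys w"
  have "Poly_Mapping.keys (v + w) \<subseteq> ?A" by (rule keys_add)
  then show "lin_ext g (v + w) = lin_ext g v + lin_ext g w"
    by (simp add: lin_ext_superset[of ?A] lookup_add dvec.scale_left_distrib sum.distrib)
  have "Poly_Mapping.keys (dscale c v) \<subseteq> Poly_Mapping.keys v" by (auto simp: in_keys_iff)
  then show "lin_ext g (dscale c v) = dscale c (lin_ext g v)"
    by (simp add: lin_ext_superset[of "Poly_Mapping.keys v"] dvec.scale_sum_right)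
qed

lemma lin_ext_single [simp]: "lin_ext g (single_diagram d) = g d"
  by (simp add: lin_ext_def single_diagram_def)

text \<open>This iterated form and its counterpart for the left argument reduce linearity in each
  argument to that of \<open>lin_ext\<close>.\<close>

lemma bilinear_ext_right: "bilinear_ext f a b = lin_ext (\<lambda>t. lin_ext (\<lambda>d. f d t) a) b"
proof -
  have "bilinear_ext f a b = (\<Sum>d\<in>Poly_Mapping.keys a. \<Sum>t\<in>Poly_Mapping.keys b. dscale (coef b t) (dscale (coef a d) (f d t)))"
    by (simp add: bilinear_ext_def mult.commute)
  also have "\<dots> = (\<Sum>t\<in>Poly_Mapping.keys b. \<Sum>d\<in>Poly_Mapping.keys a. dscale (coef b t) (dscale (coef a d) (f d t)))"
    by (rule sum.swap)
  finally show ?thesis by (simp add: lin_ext_def dvec.scale_sum_right)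
qed

lemma bilinear_ext_left: "bilinear_ext f a b = lin_ext (\<lambda>d. lin_ext (f d) b) a"
  by (simp add: bilinear_ext_def lin_ext_def dvec.scale_sum_right)

lemma dlinear_bilinear_ext:
  "dlinear (bilinear_ext f a)" "dlinear (\<lambda>a. bilinear_ext f a b)"
proof -
  have "bilinear_ext f a = lin_ext (\<lambda>t. lin_ext (\<lambda>d. f d t) a)" by (rule ext) (rule bilinear_ext_right)
  then show "dlinear (bilinear_ext f a)" by (simp only: dlinear_lin_ext)
  have "(\<lambda>a. bilinear_ext f a b) = lin_ext (\<lambda>d. lin_ext (f d) b)" by (rule ext) (rule bilinear_ext_left)
  then show "dlinear (\<lambda>a. bilinear_ext f a b)" by (simp only: dlinear_lin_ext)
qed

lemma bilinear_ext_single [simp]: "bilinear_ext f (single_diagram d) (single_diagram t) = f d t"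
  by (simp add: bilinear_ext_left)

lemma alg_embed_lin_ext: "alg_embed p k = lin_ext (\<lambda>d. single_diagram (extend_diagram p k d))"
  by (simp add: fun_eq_iff alg_embed_def lin_ext_def)

lemma dlinear_mult: "dlinear (alg_mult x k a)" "dlinear (\<lambda>a. alg_mult x k a b)"
  unfolding alg_mult_def by (rule dlinear_bilinear_ext)+

lemma mult_single:
  "alg_mult x k (single_diagram a) (single_diagram b) = dscale (x ^ kappa k a b) (single_diagram (compose_diagram k a b))"
  by (simp add: alg_mult_def)

section \<open>Modules\<close>

locale alg_mod =
  fixes F :: planar_family and x :: "'a::field" and k :: nat and M :: "('a, 'v::ab_group_add) rep"
  assumes M: "alg_module F x k M"
begin

sublocale vs: vector_space "scl M"
  using M by (simp add: alg_module_def)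

lemma space: "vs.subspace (rep_space M)"
  using M by (simp add: alg_module_def)

lemma act_in: "a \<in> alg_carrier F k \<Longrightarrow> v \<in> rep_space M \<Longrightarrow> act M a v \<in> rep_space M"
  and add_act: "a \<in> alg_carrier F k \<Longrightarrow> b \<in> alg_carrier F k \<Longrightarrow> v \<in> rep_space M \<Longrightarrow> act M (a + b) v = act M a v + act M b v"
  and act_scl: "a \<in> alg_carrier F k \<Longrightarrow> v \<in> rep_space M \<Longrightarrow> act M a (scl M c v) = scl M c (act M a v)"
  and scl_act: "a \<in> alg_carrier F k \<Longrightarrow> v \<in> rep_space M \<Longrightarrow> act M (dscale c a) v = scl M c (act M a v)"
  and mult_act: "a \<in> alg_carrier F k \<Longrightarrow> b \<in> alg_carrier F k \<Longrightarrow> v \<in> rep_space M \<Longrightarrow> act M (alg_mult x k a b) v = act M a (act M b v)"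
  and one_act: "v \<in> rep_space M \<Longrightarrow> act M (alg_one k) v = v"
  using M by (simp_all add: alg_module_def)

lemma zero_in: "0 \<in> rep_space M"
  by (rule vs.subspace_0[OF space])

lemma act_zero: "a \<in> alg_carrier F k \<Longrightarrow> act M a 0 = 0"
  using act_scl[of a 0 0] zero_in by simp

lemma zero_act: "v \<in> rep_space M \<Longrightarrow> act M 0 v = 0"
  using scl_act[of 0 v 0] by (simp add: alg_carrier_def lin_zero)

lemma sum_act:
  assumes "\<And>i. i \<in> I \<Longrightarrow> f i \<in> alg_carrier F k" "v \<in> rep_space M"
  shows "act M (sum f I) v = (\<Sum>i\<in>I. act M (f i) v)"
  using assms(1)
proof (induction I rule: infinite_finite_induct)
  case (insert i I)
  then show ?case using lin_sum[of I f] add_act[OF _ _ assms(2)] by (simp add: alg_carrier_def)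
qed (simp_all add: zero_act[OF assms(2)])

lemma act_expand:
  assumes "a \<in> alg_carrier F k" "v \<in> rep_space M"
  shows "act M a v = (\<Sum>d\<in>Poly_Mapping.keys a. scl M (coef a d) (act M (single_diagram d) v))"
proof -
  have keys: "(single_diagram d :: 'a dvec) \<in> alg_carrier F k" if "d \<in> Poly_Mapping.keys a" for d
    using assms(1) that lin_single by (auto simp: alg_carrier_def lin_def)
  have scaled: "dscale c (single_diagram d) \<in> alg_carrier F k" if "d \<in> Poly_Mapping.keys a" for c :: 'a and d
    using keys[OF that] by (simp add: alg_carrier_def lin_dscale)
  have "act M a v = act M (\<Sum>d\<in>Poly_Mapping.keys a. dscale (coef a d) (single_diagram d)) v"
    using dvec_expand[of a] by simp
  also have "\<dots> = (\<Sum>d\<in>Poly_Mapping.keys a. act M (dscale (coef a d) (single_diagram d)) v)"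
    by (rule sum_act[OF scaled assms(2)])
  also have "\<dots> = (\<Sum>d\<in>Poly_Mapping.keys a. scl M (coef a d) (act M (single_diagram d) v))"
    by (rule sum.cong[OF refl scl_act[OF keys assms(2)]])
  finally show ?thesis .
qed

end

lemma irreducible_module: "alg_irreducible F x k M \<Longrightarrow> alg_mod F x k M"
  by (simp add: alg_irreducible_def alg_mod_def)

section \<open>The module axioms, the grading by rank and the matrix units\<close>

section \<open>The conjugation module\<close>

context diagram_monoid
begin

abbreviation "A \<equiv> alg_carrier F k :: 'a dvec set"
abbreviation "cact \<equiv> bilinear_ext (conj_diagram x k)"

lemma single_A: "d \<in> B \<Longrightarrow> single_diagram d \<in> A"
  by (simp add: alg_carrier_def lin_single)

lemma one_A: "alg_one k \<in> A"
  unfolding alg_one_def by (rule single_A[OF id_basis])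

lemma A_add: "a \<in> A \<Longrightarrow> b \<in> A \<Longrightarrow> a + b \<in> A" and A_dscale: "a \<in> A \<Longrightarrow> dscale c a \<in> A"
  by (simp_all add: alg_carrier_def lin_add lin_dscale)

lemma A_mult:
  assumes "a \<in> A" "b \<in> A"
  shows "alg_mult x k a b \<in> A"
proof -
  have "alg_mult x k (single_diagram d) b \<in> lin B" if "d \<in> B" for d
    by (rule dlinear_lin[OF dlinear_mult(1) assms(2)[unfolded alg_carrier_def]])
      (simp add: mult_single closed[OF that] lin_dscale lin_single)
  then show ?thesis
    using dlinear_lin[OF dlinear_mult(2) assms(1)[unfolded alg_carrier_def]] by (simp add: alg_carrier_def)
qed

lemma conj_diagram_lin: "d \<in> B \<Longrightarrow> t \<in> S \<Longrightarrow> conj_diagram x k d t \<in> lin {s \<in> S. diagram_rank s = diagram_rank t}"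
  using conj_S rank_conj by (simp add: conj_diagram_eq lin_zero lin_dscale lin_single)

text \<open>\<open>D\<close> stands for any set of symmetric diagrams that is a union of rank
  classes, so the whole module and a single rank are covered together.\<close>

lemma cact_lin:
  assumes "a \<in> A" "v \<in> lin D" "D \<subseteq> S" "\<And>s t. s \<in> S \<Longrightarrow> t \<in> D \<Longrightarrow> diagram_rank s = diagram_rank t \<Longrightarrow> s \<in> D"
  shows "cact a v \<in> lin D"
proof -
  have "cact (single_diagram d) v \<in> lin D" if d: "d \<in> B" for d
  proof (rule dlinear_lin[OF dlinear_bilinear_ext(1) assms(2)])
    fix t assume t: "t \<in> D"
    have "{s \<in> S. diagram_rank s = diagram_rank t} \<subseteq> D" using assms(4)[OF _ t] by blast
    from subsetD[OF lin_mono[OF this] conj_diagram_lin[OF d]] t assms(3)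
    show "cact (single_diagram d) (single_diagram t) \<in> lin D" by auto
  qed
  then show ?thesis
    using dlinear_lin[OF dlinear_bilinear_ext(2) assms(1)[unfolded alg_carrier_def]] by blast
qed

lemma conj_diagram_comp:
  assumes d: "d1 \<in> B" "d2 \<in> B" and t: "t \<in> S"
  shows "cact (single_diagram d1) (conj_diagram x k d2 t) = dscale (x ^ kappa k d1 d2) (conj_diagram x k (d1 \<odot> d2) t)"
proof (cases "diagram_rank (d2 \<odot> t) = diagram_rank t")
  case True
  let ?c = "conjugate k d2 t"
  have c: "?c \<in> S" using conj_S[OF d(2) t] .
  have 1: "cact (single_diagram d1) (conj_diagram x k d2 t) = dscale (x ^ kappa k d2 t) (conj_diagram x k d1 ?c)"
    using True by (simp add: conj_diagram_eq[OF d(2) t] dlinear_scale[OF dlinear_bilinear_ext(1)])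
  show ?thesis
    unfolding 1 conj_diagram_eq[OF d(1) c] conj_diagram_eq[OF closed[OF d] t]
    using conj_comp[OF d t True] by simp
next
  case False
  \<comment> \<open>Rank lost under \<open>d2\<close> cannot be regained by multiplying with
    \<open>d1\<close>, so both sides vanish.\<close>
  then have "diagram_rank ((d1 \<odot> d2) \<odot> t) \<noteq> diagram_rank t"
    using rank_comp_le[OF d(1) closed[OF d(2) S_B[OF t]]] rank_comp_le[OF d(2) S_B[OF t]] assoc[OF d S_B[OF t]] by simp
  with False show ?thesis
    by (simp add: conj_diagram_eq[OF d(2) t] conj_diagram_eq[OF closed[OF d] t] dlinear_zero[OF dlinear_bilinear_ext(1)])
qed

lemma cact_mult:
  assumes "a \<in> A" "b \<in> A" "v \<in> lin S"
  shows "cact (alg_mult x k a b) v = cact a (cact b v)"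
proof -
  note lr = dlinear_bilinear_ext[of "conj_diagram x k"]
  have 1: "cact (alg_mult x k (single_diagram d1) (single_diagram d2)) v = cact (single_diagram d1) (cact (single_diagram d2) v)"
    if d: "d1 \<in> B" "d2 \<in> B" for d1 d2
  proof (rule dlinear_eq[OF lr(1) dlinear_comp[OF lr(1) lr(1)] assms(3)])
    fix t assume "t \<in> S"
    then show "cact (alg_mult x k (single_diagram d1) (single_diagram d2)) (single_diagram t) =
        cact (single_diagram d1) (cact (single_diagram d2) (single_diagram t))"
      using conj_diagram_comp[OF d] by (simp add: mult_single dlinear_scale[OF lr(2)])
  qed
  have 2: "cact (alg_mult x k (single_diagram d1) b) v = cact (single_diagram d1) (cact b v)" if d: "d1 \<in> B" for d1
    by (rule dlinear_eq[OF dlinear_comp[OF lr(2) dlinear_mult(1)] dlinear_comp[OF lr(1) lr(2)] assms(2)[unfolded alg_carrier_def]])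
      (rule 1[OF d])
  show ?thesis
    by (rule dlinear_eq[OF dlinear_comp[OF lr(2) dlinear_mult(2)] lr(2) assms(1)[unfolded alg_carrier_def]]) (rule 2)
qed

lemma cact_one:
  assumes "v \<in> lin S"
  shows "cact (alg_one k) v = v"
proof (rule dlinear_eq[OF dlinear_bilinear_ext(1) _ assms])
  show "dlinear (\<lambda>v :: 'a dvec. v)" by (simp add: dlinear_def)
  fix t assume t: "t \<in> S"
  have id: "id_diagram k \<odot> t = t" using id_compose[OF BD[OF S_B[OF t]]] .
  then have "conjugate k (id_diagram k) t = t"
    using S_eqI[OF conj_S[OF id_basis t] t] cups_conj[OF id_basis t] by simp
  then show "cact (alg_one k) (single_diagram t) = single_diagram t"
    by (simp add: alg_one_def conj_diagram_eq[OF id_basis t] id kappa_id)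
qed

lemma conj_module:
  assumes "D \<subseteq> S" "\<And>s t. s \<in> S \<Longrightarrow> t \<in> D \<Longrightarrow> diagram_rank s = diagram_rank t \<Longrightarrow> s \<in> D"
  shows "alg_module F x k \<lparr>rep_space = lin D, scl = dscale, act = cact\<rparr>"
proof -
  have sub: "lin D \<subseteq> lin S" using assms(1) by (rule lin_mono)
  have "cact a v \<in> lin D" if "a \<in> A" "v \<in> lin D" for a v
    using cact_lin[OF that assms(1)] assms(2) by blast
  moreover have "cact (alg_mult x k a b) v = cact a (cact b v)" if "a \<in> A" "b \<in> A" "v \<in> lin D" for a b v
    using cact_mult[OF that(1,2)] that(3) sub by blast
  moreover have "cact (alg_one k) v = v" if "v \<in> lin D" for v
    using cact_one that sub by blast
  ultimately show ?thesis
    unfolding alg_module_def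
    by (simp add: vector_space_dscale lin_subspace dlinear_add[OF dlinear_bilinear_ext(1)] dlinear_add[OF dlinear_bilinear_ext(2)]
        dlinear_scale[OF dlinear_bilinear_ext(1)] dlinear_scale[OF dlinear_bilinear_ext(2)])
qed

lemma conj_rep_module: "alg_module F x k (conj_rep F x k)"
  unfolding conj_rep_def by (rule conj_module) simp_all

abbreviation "R r \<equiv> {t \<in> S. diagram_rank t = r}"

lemma conj_rep_rank_eq: "conj_rep_rank F x k r = \<lparr>rep_space = lin (R r), scl = dscale, act = cact\<rparr>"
  by (simp add: conj_rep_rank_def restrict_rep_def conj_rep_def sym_space_def)

lemma rank_module: "alg_module F x k (conj_rep_rank F x k r)"
  unfolding conj_rep_rank_eq by (rule conj_module) auto

lemma rank_submodule: "alg_submodule F k (conj_rep F x k) (sym_space F k r)"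
  unfolding alg_submodule_def conj_rep_def sym_space_def
  using lin_mono[of "R r" S] lin_subspace cact_lin[of _ _ "R r"] by auto

lemma conj_direct_sum: "alg_direct_sum F k (conj_rep F x k) {0..k} (sym_space F k)"
  unfolding alg_direct_sum_def
proof (intro conjI ballI)
  show "alg_submodule F k (conj_rep F x k) (sym_space F k r)" for r by (rule rank_submodule)
  fix v assume "v \<in> rep_space (conj_rep F x k)"
  then have v: "v \<in> lin S" by (simp add: conj_rep_def)
  \<comment> \<open>The rank-r part of \<open>v\<close>; its coefficients are those of
    \<open>v\<close> on diagrams of rank r and 0 elsewhere.\<close>
  define part where "part r = lin_ext (\<lambda>t. if diagram_rank t = r then single_diagram t else 0) v" for r
  have part: "coef (part r) t = (if diagram_rank t = r then coef v t else 0)" for r t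
  proof -
    have "coef (part r) t = (\<Sum>s\<in>Poly_Mapping.keys v. if s = t then (if diagram_rank t = r then coef v t else 0) else 0)"
      unfolding part_def lin_ext_def lookup_sum by (intro sum.cong) (auto simp: coef_single)
    then show ?thesis by (simp add: in_keys_iff)
  qed
  have rank: "diagram_rank t \<le> k" if "t \<in> S" for t using rank_le[OF basis_slim[OF S_B[OF that]]] .
  have val: "coef (u (diagram_rank t)) t = coef v t"
    if u: "u \<in> (\<Pi>\<^sub>E r\<in>{0..k}. sym_space F k r)" "v = (\<Sum>r\<in>{0..k}. u r)" and t: "t \<in> S" for u t
  proof -
    have "coef v t = (\<Sum>r\<in>{0..k}. coef (u r) t)" using u(2) by (simp add: lookup_sum)
    also have "\<dots> = (\<Sum>r\<in>{0..k}. if r = diagram_rank t then coef (u r) t else 0)"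
    proof (rule sum.cong)
      fix r assume "r \<in> {0..k}"
      then have "u r \<in> lin (R r)" using u(1) by (auto simp: sym_space_def)
      then show "coef (u r) t = (if r = diagram_rank t then coef (u r) t else 0)" by (auto simp: lin_iff)
    qed simp
    also have "\<dots> = coef (u (diagram_rank t)) t" using rank[OF t] by simp
    finally show ?thesis ..
  qed
  have outside: "coef (u r) t = 0"
    if u: "u \<in> (\<Pi>\<^sub>E r\<in>{0..k}. sym_space F k r)" "r \<in> {0..k}" "t \<notin> S \<or> diagram_rank t \<noteq> r" for u :: "nat \<Rightarrow> 'a dvec" and r t
  proof -
    have "u r \<in> lin (R r)" using u(1,2) by (auto simp: sym_space_def)
    with u(3) show ?thesis by (auto simp: lin_iff)
  qed
  show "\<exists>!u. u \<in> (\<Pi>\<^sub>E r\<in>{0..k}. sym_space F k r) \<and> v = (\<Sum>r\<in>{0..k}. u r)"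
  proof (rule ex1I)
    have "v = (\<Sum>r\<in>{0..k}. part r)"
    proof (rule dvec_eqI)
      fix t
      have "coef (\<Sum>r\<in>{0..k}. part r) t = (if diagram_rank t \<le> k then coef v t else 0)"
        by (simp add: lookup_sum part)
      then show "coef v t = coef (\<Sum>r\<in>{0..k}. part r) t" using rank v by (auto simp: lin_iff)
    qed
    moreover have "part r \<in> sym_space F k r" for r using v by (auto simp: sym_space_def lin_iff part)
    \<comment> \<open>Uniqueness is claimed in the extensional product, whose elements are
      \<open>undefined\<close> outside \<open>{0..k}\<close>; hence the restriction.\<close>
    ultimately show "restrict part {0..k} \<in> (\<Pi>\<^sub>E r\<in>{0..k}. sym_space F k r) \<and> v = (\<Sum>r\<in>{0..k}. restrict part {0..k} r)"
      by simp
    fix u assume u: "u \<in> (\<Pi>\<^sub>E r\<in>{0..k}. sym_space F k r) \<and> v = (\<Sum>r\<in>{0..k}. u r)"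
    show "u = restrict part {0..k}"
    proof (rule ext)
      fix r
      show "u r = restrict part {0..k} r"
      proof (cases "r \<in> {0..k}")
        case True
        have "u r = part r"
        proof (rule dvec_eqI)
          fix t show "coef (u r) t = coef (part r) t"
          proof (cases "t \<in> S \<and> diagram_rank t = r")
            case True
            then show ?thesis using val[of u t] u by (simp add: part)
          next
            case False
            then show ?thesis using outside[OF conjunct1[OF u] True, of t] v by (auto simp: part lin_iff)
          qed
        qed
        with True show ?thesis by simp
      next
        case False
        then show ?thesis using PiE_arb[OF conjunct1[OF u] False] by (simp only: restrict_def if_False)
      qed
    qed
  qed
qed simp

subsection \<open>Matrix units\<close>

lemma act_to:
  assumes s: "s \<in> R r" and t: "t \<in> R r"
  obtains u where "u \<in> B" "cact (single_diagram u) (single_diagram t) = dscale (x ^ kappa k u t) (single_diagram s)"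
proof -
  have sB: "s \<in> S" "t \<in> S" "diagram_rank s = diagram_rank t" using s t by auto
  obtain u where u: "u \<in> B" "cups u = cups s" "cups (flip_diagram u) = cups t"
    using halves_exist[OF S_B[OF sB(1)] S_B[OF sB(2)] sB(3)] .
  have cups: "cups (u \<odot> t) = cups s" using cups_matched[OF u(1) S_B[OF sB(2)] u(3)] u(2) by simp
  then have "diagram_rank (u \<odot> t) = diagram_rank t"
    using rank_cups[OF closed[OF u(1) S_B[OF sB(2)]] S_B[OF sB(1)]] sB(3) by simp
  moreover have "conjugate k u t = s"
    using S_eqI[OF conj_S[OF u(1) sB(2)] sB(1)] cups_conj[OF u(1) sB(2)] cups by simp
  ultimately have "cact (single_diagram u) (single_diagram t) = dscale (x ^ kappa k u t) (single_diagram s)"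
    by (simp add: conj_diagram_eq[OF u(1) sB(2)])
  with u(1) show ?thesis by (rule that)
qed

lemma act_self:
  assumes "t \<in> S"
  shows "cact (single_diagram t) (single_diagram t) = dscale (x ^ kappa k t t) (single_diagram t)"
proof -
  have "conjugate k t t = t"
    using S_eqI[OF conj_S[OF S_B[OF assms] assms] assms] cups_conj[OF S_B[OF assms] assms] by (simp add: idem_S[OF assms])
  then show ?thesis by (simp add: conj_diagram_eq[OF S_B[OF assms] assms] idem_S[OF assms])
qed

text \<open>If \<open>t \<circ> s\<close> keeps the rank r, its cups contain those of
  \<open>t\<close> and the ranks agree, so they are the cups of \<open>t\<close>; the conjugate is
  then symmetric with that top half, hence equal to \<open>t\<close>. Otherwise the action gives
  0.\<close>

lemma act_line:
  assumes t: "t \<in> R r" and v: "v \<in> lin (R r)"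
  obtains c where "cact (single_diagram t) v = dscale c (single_diagram t)"
proof -
  have tS: "t \<in> S" "diagram_rank t = r" using t by auto
  have "cact (single_diagram t) v \<in> lin {t}"
  proof (rule dlinear_lin[OF dlinear_bilinear_ext(1) v])
    fix s assume "s \<in> R r"
    then have s: "s \<in> S" "diagram_rank s = r" by auto
    note tB = S_B[OF tS(1)] and sB = S_B[OF s(1)]
    have "conjugate k t s = t" if "diagram_rank (t \<odot> s) = diagram_rank s"
    proof -
      have "cups t = cups (t \<odot> s)"
        using cups_eqI[OF basis_slim[OF tB] basis_slim[OF closed[OF tB sB]] cups_compose[OF BD[OF tB] BD[OF sB]]]
          that s tS by simp
      then show ?thesis using S_eqI[OF conj_S[OF tB s(1)] tS(1)] cups_conj[OF tB s(1)] by simp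
    qed
    then show "cact (single_diagram t) (single_diagram s) \<in> lin {t}"
      by (simp add: conj_diagram_eq[OF tB s(1)] lin_zero lin_dscale lin_single)
  qed
  from lin_singleton[OF this] show ?thesis by (rule that)
qed

lemma act_cyclic:
  assumes t: "t \<in> R r" and v: "v \<in> lin (R r)"
  obtains a where "a \<in> A" "cact a (single_diagram t) = v"
proof -
  have "\<forall>s\<in>R r. \<exists>u. u \<in> B \<and> cact (single_diagram u) (single_diagram t) = dscale (x ^ kappa k u t) (single_diagram s)"
  proof
    fix s assume "s \<in> R r"
    from act_to[OF this t] show "\<exists>u. u \<in> B \<and> cact (single_diagram u) (single_diagram t) = dscale (x ^ kappa k u t) (single_diagram s)"
      by metis
  qed
  from bchoice[OF this] obtain u where "\<forall>s\<in>R r. u s \<in> B \<and>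
      cact (single_diagram (u s)) (single_diagram t) = dscale (x ^ kappa k (u s) t) (single_diagram s)" by blast
  then have u': "u s \<in> B \<and> cact (single_diagram (u s)) (single_diagram t) = dscale (x ^ kappa k (u s) t) (single_diagram s)"
    if "s \<in> R r" for s
    using that by (rule bspec)
  note u = conjunct1[OF u'] conjunct2[OF u']
  \<comment> \<open>The factor \<open>1 / x ^ kappa\<close> removes the loops that arise when
    \<open>u s\<close> carries \<open>t\<close> to \<open>s\<close>.\<close>
  define a where "a = lin_ext (\<lambda>s. dscale (1 / x ^ kappa k (u s) t) (single_diagram (u s))) v"
  have "a \<in> A"
    unfolding a_def alg_carrier_def
    by (rule dlinear_lin[OF dlinear_lin_ext v]) (simp add: u(1) lin_dscale lin_single)
  moreover have "cact a (single_diagram t) = v"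
    unfolding a_def
  proof (rule dlinear_eq[OF dlinear_comp[OF dlinear_bilinear_ext(2) dlinear_lin_ext] _ v])
    show "dlinear (\<lambda>v :: 'a dvec. v)" by (simp add: dlinear_def)
    fix s assume s: "s \<in> R r"
    show "cact (lin_ext (\<lambda>s. dscale (1 / x ^ kappa k (u s) t) (single_diagram (u s))) (single_diagram s)) (single_diagram t) =
        single_diagram s"
      using nonzero by (simp only: lin_ext_single dlinear_scale[OF dlinear_bilinear_ext(2)] u(2)[OF s]) simp
  qed
  ultimately show ?thesis by (rule that)
qed

end

section \<open>From semisimplicity to the monoid laws and irreducibility\<close>

section \<open>Semisimplicity\<close>

lemma semisimple_decompose:
  assumes "alg_semisimple F x k"
  obtains n :: nat and U where
    "\<And>i. i < n \<Longrightarrow> alg_irreducible F x k (restrict_rep (regular_rep F x k) (U i))"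
    "\<And>i. i < n \<Longrightarrow> U i \<subseteq> alg_carrier F k"
    "\<And>v. v \<in> alg_carrier F k \<Longrightarrow> \<exists>u. (\<forall>i<n. u i \<in> U i) \<and> v = (\<Sum>i<n. u i)"
proof -
  obtain n :: nat and U where U: "alg_direct_sum F k (regular_rep F x k) {..<n} U"
    "\<forall>i<n. alg_irreducible F x k (restrict_rep (regular_rep F x k) (U i))"
    using assms unfolding alg_semisimple_def by blast
  show ?thesis
  proof (rule that)
    show "U i \<subseteq> alg_carrier F k" if "i < n" for i
      using U(1) that by (auto simp: alg_direct_sum_def alg_submodule_def regular_rep_def)
    show "\<exists>u. (\<forall>i<n. u i \<in> U i) \<and> v = (\<Sum>i<n. u i)" if "v \<in> alg_carrier F k" for v
    proof -
      have "\<exists>u. u \<in> (\<Pi>\<^sub>E i\<in>{..<n}. U i) \<and> v = (\<Sum>i<n. u i)"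
        using U(1) that unfolding alg_direct_sum_def regular_rep_def by (simp, metis)
      then show ?thesis by (auto simp: PiE_iff)
    qed
  qed (use U(2) in blast)
qed

text \<open>The summands of the regular representation are modules, so semisimplicity as defined includes
  that the planar diagrams are closed under composition and that their product is associative.\<close>

lemma semisimple_diagram_monoid:
  assumes x: "x \<noteq> 0" and ss: "alg_semisimple F x k"
  shows "diagram_monoid F x k"
proof -
  obtain n :: nat and U where irr: "\<And>i. i < n \<Longrightarrow> alg_irreducible F x k (restrict_rep (regular_rep F x k) (U i))"
    and sub: "\<And>i. i < n \<Longrightarrow> U i \<subseteq> alg_carrier F k"
    and dec: "\<And>v. v \<in> alg_carrier F k \<Longrightarrow> \<exists>u. (\<forall>i<n. u i \<in> U i) \<and> v = (\<Sum>i<n. u i)"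
    using semisimple_decompose[OF ss] by metis
  have mod: "alg_mod F x k (restrict_rep (regular_rep F x k) (U i))" if "i < n" for i
    using irreducible_module[OF irr[OF that]] .
  have rr: "rep_space (restrict_rep (regular_rep F x k) W) = W" "act (restrict_rep (regular_rep F x k) W) = alg_mult x k" for W
    by (simp_all add: restrict_rep_def regular_rep_def)
  have in_U: "alg_mult x k a u \<in> U i" if "i < n" "a \<in> alg_carrier F k" "u \<in> U i" for i a u
    using alg_mod.act_in[OF mod[OF that(1)] that(2)] that(3) unfolding rr by blast
  have assoc_U: "alg_mult x k (alg_mult x k a b) u = alg_mult x k a (alg_mult x k b u)"
    if "i < n" "a \<in> alg_carrier F k" "b \<in> alg_carrier F k" "u \<in> U i" for i a b u
    using alg_mod.mult_act[OF mod[OF that(1)] that(2,3)] that(4) unfolding rr by blast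
  have in_A: "alg_mult x k a v \<in> alg_carrier F k" if a: "a \<in> alg_carrier F k" and v: "v \<in> alg_carrier F k" for a v
  proof -
    obtain u where u: "\<forall>i<n. u i \<in> U i" "v = (\<Sum>i<n. u i)" using dec[OF v] by blast
    have "alg_mult x k a v = (\<Sum>i<n. alg_mult x k a (u i))" unfolding u(2) by (rule dlinear_sum[OF dlinear_mult(1)])
    moreover have "alg_mult x k a (u i) \<in> lin (diagram_basis F k)" if "i < n" for i
      using in_U[OF that a] sub[OF that] u(1) that by (auto simp: alg_carrier_def)
    ultimately show ?thesis unfolding alg_carrier_def by (metis lessThan_iff lin_sum)
  qed
  have assoc_A: "alg_mult x k (alg_mult x k a b) v = alg_mult x k a (alg_mult x k b v)"
    if ab: "a \<in> alg_carrier F k" "b \<in> alg_carrier F k" and v: "v \<in> alg_carrier F k" for a b v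
  proof -
    obtain u where u: "\<forall>i<n. u i \<in> U i" "v = (\<Sum>i<n. u i)" using dec[OF v] by blast
    show ?thesis unfolding u(2) using u(1) assoc_U ab by (simp add: dlinear_sum[OF dlinear_mult(1)])
  qed
  have single: "single_diagram d \<in> alg_carrier F k" if "d \<in> diagram_basis F k" for d :: diagram
    using that by (simp add: alg_carrier_def lin_single)
  have closed: "compose_diagram k a b \<in> diagram_basis F k" if ab: "a \<in> diagram_basis F k" "b \<in> diagram_basis F k" for a b
  proof -
    have "dscale (x ^ kappa k a b) (single_diagram (compose_diagram k a b)) \<in> lin (diagram_basis F k)"
      using in_A[OF single[OF ab(1)] single[OF ab(2)]] unfolding mult_single by (simp add: alg_carrier_def)
    \<comment> \<open>The coefficient of the composite is a power of x and hence nonzero, so the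
      composite must belong to the support allowed by the carrier.\<close>
    then show ?thesis using x unfolding lin_iff by (auto simp: coef_single split: if_splits)
  qed
  have both: "compose_diagram k (compose_diagram k a b) c = compose_diagram k a (compose_diagram k b c) \<and>
      x ^ kappa k a b * x ^ kappa k (compose_diagram k a b) c = x ^ kappa k b c * x ^ kappa k a (compose_diagram k b c)"
    if "a \<in> diagram_basis F k" "b \<in> diagram_basis F k" "c \<in> diagram_basis F k" for a b c
  proof -
    let ?l = "compose_diagram k (compose_diagram k a b) c" and ?r = "compose_diagram k a (compose_diagram k b c)"
    have eq: "dscale (x ^ kappa k a b * x ^ kappa k (compose_diagram k a b) c) (single_diagram ?l) =
        dscale (x ^ kappa k b c * x ^ kappa k a (compose_diagram k b c)) (single_diagram ?r)"
      using assoc_A[OF single[OF that(1)] single[OF that(2)] single[OF that(3)]]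
      by (simp add: mult_single dlinear_scale[OF dlinear_mult(1)] dlinear_scale[OF dlinear_mult(2)])
    \<comment> \<open>Both sides are nonzero multiples of single diagrams. Evaluating at
      \<open>?l\<close> forces the diagrams to agree, and evaluating again gives the equality of the
      loop factors.\<close>
    have "?l = ?r"
    proof (rule ccontr)
      assume "?l \<noteq> ?r"
      then show False using arg_cong[OF eq, of "\<lambda>v. coef v ?l"] x by (simp add: coef_single)
    qed
    then show ?thesis using arg_cong[OF eq, of "\<lambda>v. coef v ?l"] by (simp add: coef_single)
  qed
  show ?thesis by unfold_locales (use x closed both in blast)+
qed

text \<open>An irreducible left ideal \<open>U i\<close> that maps onto the module under w \<mapsto>
  w\<tau> transfers its irreducibility, since submodules of the image pull back to submodules of
  \<open>U i\<close>.\<close>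

lemma (in diagram_monoid) semisimple_irreducible:
  assumes ss: "alg_semisimple F x k" and ok: "label_ok F k r"
  shows "alg_irreducible F x k (conj_rep_rank F x k r)"
proof -
  obtain n :: nat and U where irr: "\<And>i. i < n \<Longrightarrow> alg_irreducible F x k (restrict_rep (regular_rep F x k) (U i))"
    and sub: "\<And>i. i < n \<Longrightarrow> U i \<subseteq> alg_carrier F k"
    and dec: "\<And>v. v \<in> alg_carrier F k \<Longrightarrow> \<exists>u. (\<forall>i<n. u i \<in> U i) \<and> v = (\<Sum>i<n. u i)"
    using semisimple_decompose[OF ss] by metis
  obtain t where t: "t \<in> R r" using sym_exists[OF ok] by auto
  then have tS: "t \<in> S" by simp
  define \<tau> :: "'a dvec" where "\<tau> = single_diagram t"
  have \<tau>: "\<tau> \<in> lin (R r)" unfolding \<tau>_def using t by (rule lin_single)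
  have RS: "lin (R r) \<subseteq> lin S" by (rule lin_mono) simp
  have \<tau>S: "\<tau> \<in> lin S" using \<tau> RS by blast
  have tA: "single_diagram t \<in> A" using single_A[OF S_B[OF tS]] .
  have closed_R: "cact a v \<in> lin (R r)" if "a \<in> A" "v \<in> lin (R r)" for a v
    using cact_lin[OF that] by auto
  obtain u where u: "\<forall>i<n. u i \<in> U i" "alg_one k = (\<Sum>i<n. u i)" using dec[OF one_A] by blast
  have uA: "u i \<in> A" if "i < n" for i using u(1) sub that by blast
  \<comment> \<open>The unit fixes \<tau>, and \<open>t\<close> sends \<tau> to a nonzero multiple
    of itself. Hence some summand \<open>u i\<close> of the unit gives a vector that
    \<open>t\<close> does not kill.\<close>
  have "(\<Sum>i<n. cact (single_diagram t) (cact (u i) \<tau>)) = cact (single_diagram t) (cact (alg_one k) \<tau>)"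
    unfolding u(2) by (simp add: dlinear_sum[OF dlinear_bilinear_ext(1)] dlinear_sum[OF dlinear_bilinear_ext(2)])
  also have "\<dots> = dscale (x ^ kappa k t t) \<tau>"
    unfolding cact_one[OF \<tau>S] unfolding \<tau>_def by (rule act_self[OF tS])
  also have "\<dots> \<noteq> 0" unfolding \<tau>_def using nonzero by (simp add: single_nonzero)
  finally have "(\<Sum>i<n. cact (single_diagram t) (cact (u i) \<tau>)) \<noteq> 0" .
  then obtain j where "j \<in> {..<n}" "cact (single_diagram t) (cact (u j) \<tau>) \<noteq> 0"
    by (rule sum.not_neutral_contains_not_neutral)
  then obtain i where i: "i < n" "cact (single_diagram t) (cact (u i) \<tau>) \<noteq> 0" by blast
  \<comment> \<open>As \<open>t\<close> maps everything into the line of \<tau>, that nonzero value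
    is c\<tau>; dividing by c later brings \<tau> back.\<close>
  obtain c where c: "cact (single_diagram t) (cact (u i) \<tau>) = dscale c \<tau>"
    using act_line[OF t closed_R[OF uA[OF i(1)] \<tau>]] unfolding \<tau>_def by blast
  have "c \<noteq> 0" using i(2) c by auto
  let ?W = "restrict_rep (regular_rep F x k) (U i)"
  have W: "rep_space ?W = U i" "act ?W = alg_mult x k" "scl ?W = dscale"
    by (simp_all add: restrict_rep_def regular_rep_def)
  interpret W: alg_mod F x k ?W by (rule irreducible_module[OF irr[OF i(1)]])
  have U_mult: "alg_mult x k a w \<in> U i" if "a \<in> A" "w \<in> U i" for a w
    using W.act_in[OF that(1)] that(2) unfolding W by blast
  have U_sub: "module.subspace dscale (U i)" using W.space unfolding W .
  have reach: "\<exists>w\<in>U i. cact w \<tau> = v" if v: "v \<in> lin (R r)" for v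
  proof -
    obtain b where b: "b \<in> A" "cact b \<tau> = v" using act_cyclic[OF t v] unfolding \<tau>_def by blast
    \<comment> \<open>Multiplying \<open>u i\<close> by \<open>t\<close> and dividing by c gives an
      element of the ideal that fixes \<tau>; then \<open>b\<close> moves \<tau> on to
      \<open>v\<close>.\<close>
    let ?w = "dscale (1 / c) (alg_mult x k b (alg_mult x k (single_diagram t) (u i)))"
    have ui: "u i \<in> U i" using u(1) i(1) by blast
    have "?w \<in> U i" using dvec.subspace_scale[OF U_sub U_mult[OF b(1) U_mult[OF tA ui]]] .
    moreover have "cact ?w \<tau> = v"
    proof -
      have "cact ?w \<tau> = dscale (1 / c) (cact b (cact (single_diagram t) (cact (u i) \<tau>)))"
        using cact_mult[OF b(1) A_mult[OF tA uA[OF i(1)]] \<tau>S] cact_mult[OF tA uA[OF i(1)] \<tau>S]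
        by (simp add: dlinear_scale[OF dlinear_bilinear_ext(2)])
      also have "\<dots> = v" unfolding c using b(2) \<open>c \<noteq> 0\<close> by (simp add: dlinear_scale[OF dlinear_bilinear_ext(1)])
      finally show ?thesis .
    qed
    ultimately show ?thesis by blast
  qed
  show ?thesis
    unfolding alg_irreducible_def
  proof (intro conjI allI impI)
    show "alg_module F x k (conj_rep_rank F x k r)" by (rule rank_module)
    show "rep_space (conj_rep_rank F x k r) \<noteq> {0}"
      unfolding conj_rep_rank_eq using \<tau> single_nonzero[of t, where 'a = 'a] by (auto simp: \<tau>_def)
    fix V assume "alg_submodule F k (conj_rep_rank F x k r) V"
    then have V: "V \<subseteq> lin (R r)" "module.subspace dscale V" "\<And>a v. a \<in> A \<Longrightarrow> v \<in> V \<Longrightarrow> cact a v \<in> V"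
      unfolding alg_submodule_def conj_rep_rank_eq by auto
    \<comment> \<open>The preimage of the submodule \<open>V\<close> under w \<mapsto> w\<tau>, a
      left ideal inside \<open>U i\<close>.\<close>
    let ?P = "{w \<in> U i. cact w \<tau> \<in> V}"
    have "alg_submodule F k ?W ?P"
      unfolding alg_submodule_def W
    proof (intro conjI ballI)
      show "module.subspace dscale ?P"
        unfolding dvec.subspace_def
        using U_sub V(2) unfolding dvec.subspace_def
        by (auto simp: dlinear_zero[OF dlinear_bilinear_ext(2)] dlinear_add[OF dlinear_bilinear_ext(2)]
            dlinear_scale[OF dlinear_bilinear_ext(2)])
      fix a w assume "a \<in> A" "w \<in> ?P"
      then show "alg_mult x k a w \<in> ?P"
        using U_mult cact_mult[OF _ _ \<tau>S] V(3) subsetD[OF sub[OF i(1)]] by auto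
    qed blast
    then have "?P = {0} \<or> ?P = U i" using irr[OF i(1)] unfolding alg_irreducible_def W by blast
    then show "V = {0} \<or> V = rep_space (conj_rep_rank F x k r)"
    proof
      assume P: "?P = {0}"
      have "v = 0" if v: "v \<in> V" for v
      proof -
        obtain w where w: "w \<in> U i" "cact w \<tau> = v" using reach[of v] V(1) v by blast
        then have "w = 0" using P v by blast
        then show ?thesis using w(2) by (simp add: dlinear_zero[OF dlinear_bilinear_ext(2)])
      qed
      then show ?thesis using dvec.subspace_0[OF V(2)] by blast
    next
      assume P: "?P = U i"
      have "lin (R r) \<subseteq> V" using reach P by blast
      then show ?thesis using V(1) unfolding conj_rep_rank_eq by simp
    qed
  qed
qed

section \<open>The corner algebra and the truncated module\<close>

section \<open>Truncation\<close>

text \<open>\<open>hat\<close> commutes with composition and is injective, so closure and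
  associativity descend from k to p strands. Each composition of hats creates one extra loop; both
  sides of the cocycle law gain two factors of x, which cancel.\<close>

lemma diagram_monoid_lower:
  assumes "diagram_monoid F x k" and red: "reducible F k"
  shows "diagram_monoid F x (lower F k)"
proof -
  interpret diagram_monoid F x k by fact
  let ?p = "lower F k"
  let ?h = "hat ?p k"
  note pk = reducible_less[OF red]
  have D: "a \<in> diagrams ?p" if "a \<in> diagram_basis F ?p" for a using that by (simp add: diagram_basis_iff)
  have cl: "compose_diagram ?p a b \<in> diagram_basis F ?p" if ab: "a \<in> diagram_basis F ?p" "b \<in> diagram_basis F ?p" for a b
  proof -
    have eq: "?h a \<odot> ?h b = ?h (compose_diagram ?p a b)" using compose_hat[OF pk D[OF ab(1)] D[OF ab(2)]] .
    have "?h (compose_diagram ?p a b) \<in> B"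
      using closed[OF hat_basis[OF red ab(1)] hat_basis[OF red ab(2)]] unfolding eq .
    from unhat_basis[OF red this] obtain d where d: "d \<in> diagram_basis F ?p" "?h (compose_diagram ?p a b) = ?h d"
      unfolding hat_def by blast
    have "{s} \<times> {?p<..k} \<notin> compose_diagram ?p a b" for s
    proof
      assume "{s} \<times> {?p<..k} \<in> compose_diagram ?p a b"
      then have "{s} \<times> {?p<..k} \<subseteq> verts ?p" by (rule compose_subset[OF D[OF ab(1)] D[OF ab(2)]])
      then have "(s, k) \<in> verts ?p" by (rule subsetD) (simp add: pk)
      with pk show False by (simp add: verts_def)
    qed
    moreover have "{s} \<times> {?p<..k} \<notin> d" for s by (rule ends_notin[OF pk D[OF d(1)]])
    moreover have "X = Y" if "X \<union> {P, Q} = Y \<union> {P, Q}" "P \<notin> X" "Q \<notin> X" "P \<notin> Y" "Q \<notin> Y"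
      for X Y :: diagram and P Q using that by blast
    ultimately have "compose_diagram ?p a b = d" using d(2) unfolding hat_def by metis
    with d(1) show ?thesis by simp
  qed
  show ?thesis
  proof
    show "x \<noteq> 0" by (rule nonzero)
    fix a b assume ab: "a \<in> diagram_basis F ?p" "b \<in> diagram_basis F ?p"
    show "compose_diagram ?p a b \<in> diagram_basis F ?p" by (rule cl[OF ab])
    fix c assume c: "c \<in> diagram_basis F ?p"
    note D3 = D[OF ab(1)] D[OF ab(2)] D[OF c] and h = hat_basis[OF red ab(1)] hat_basis[OF red ab(2)] hat_basis[OF red c]
    note Dc = D[OF cl[OF ab]] D[OF cl[OF ab(2) c]]
    have "?h (compose_diagram ?p (compose_diagram ?p a b) c) = ?h (compose_diagram ?p a (compose_diagram ?p b c))"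
      using assoc[OF h] by (simp only: compose_hat[OF pk] D3 Dc)
    then show "compose_diagram ?p (compose_diagram ?p a b) c = compose_diagram ?p a (compose_diagram ?p b c)"
      by (rule hat_inj[OF pk D[OF cl[OF cl[OF ab] c]] D[OF cl[OF ab(1) cl[OF ab(2) c]]]])
    show "x ^ kappa ?p a b * x ^ kappa ?p (compose_diagram ?p a b) c =
        x ^ kappa ?p b c * x ^ kappa ?p a (compose_diagram ?p b c)"
      using cocycle[OF h] nonzero by (simp add: compose_hat[OF pk] kappa_hat[OF pk] D3 Dc)
  qed
qed

locale diagram_truncation = diagram_monoid +
  assumes red: "reducible F k"
begin

abbreviation "p \<equiv> lower F k"

lemma pk: "p < k"
  by (rule reducible_less[OF red])

sublocale low: diagram_monoid F x p
  by (rule diagram_monoid_lower[OF diagram_monoid_axioms red])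

abbreviation hatv :: "'a dvec \<Rightarrow> 'a dvec" where
  "hatv \<equiv> lin_ext (\<lambda>d. single_diagram (hat p k d))"

definition trunc :: "'a dvec \<Rightarrow> 'a dvec" where
  "trunc a = alg_mult x k (alg_embed p k a) (e_idem F x k)"

lemma e_hat: "e_idem F x k = dscale (1 / x) (single_diagram (hat p k (id_diagram p)))"
  by (simp add: e_idem_def E_hat[OF red])

lemma dlinear_trunc: "dlinear trunc"
proof -
  have "trunc = (\<lambda>a. alg_mult x k (alg_embed p k a) (e_idem F x k))" by (rule ext) (rule trunc_def)
  then show ?thesis unfolding alg_embed_lin_ext by (simp only: dlinear_comp[OF dlinear_mult(2) dlinear_lin_ext])
qed

text \<open>Turns the isomorphism a \<mapsto> \<open>a e_k\<close> onto the corner into diagrams: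
  vertical strands followed by \<open>E_k\<close> give the hat without a loop, so only the 1/x of
  the idempotent remains.\<close>

lemma trunc_eq:
  assumes "a \<in> low.A"
  shows "trunc a = dscale (1 / x) (hatv a)"
proof (rule dlinear_eq[OF dlinear_trunc dlinear_comp[OF dlinear_dscale dlinear_lin_ext] assms[unfolded alg_carrier_def]])
  fix d assume "d \<in> low.B"
  then have d: "d \<in> diagrams p" by (rule low.BD)
  show "trunc (single_diagram d) = dscale (1 / x) (hatv (single_diagram d))"
    by (simp add: trunc_def alg_embed_lin_ext e_hat dlinear_scale[OF dlinear_mult(1)] mult_single
        compose_extend[OF pk d] kappa_extend[OF pk d])
qed

lemma hatv_lin: "v \<in> lin D \<Longrightarrow> hatv v \<in> lin (hat p k ` D)"
  by (erule dlinear_lin[OF dlinear_lin_ext]) (simp add: lin_single)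

lemma hatv_A: "a \<in> low.A \<Longrightarrow> hatv a \<in> A"
  using hatv_lin[of a low.B] lin_mono[of "hat p k ` low.B" B] hat_basis[OF red] by (auto simp: alg_carrier_def)

lemma trunc_A: "a \<in> low.A \<Longrightarrow> trunc a \<in> A"
  unfolding trunc_eq by (rule A_dscale[OF hatv_A])

lemma trunc_one: "trunc (alg_one p) = e_idem F x k"
  unfolding trunc_eq[OF low.one_A] e_hat by (simp add: alg_one_def)

lemma e_A: "e_idem F x k \<in> A"
  using trunc_A[OF low.one_A] by (simp only: trunc_one)

lemma hatv_surj:
  assumes v: "v \<in> lin (hat p k ` D)"
  obtains w where "w \<in> lin D" "hatv w = v"
proof -
  have "\<forall>h\<in>hat p k ` D. \<exists>d. d \<in> D \<and> h = hat p k d" by blast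
  from bchoice[OF this] obtain g where "\<forall>h\<in>hat p k ` D. g h \<in> D \<and> h = hat p k (g h)" by blast
  then have g: "g h \<in> D \<and> h = hat p k (g h)" if "h \<in> hat p k ` D" for h using that by (rule bspec)
  let ?w = "lin_ext (\<lambda>h. single_diagram (g h)) v"
  have "?w \<in> lin D" by (rule dlinear_lin[OF dlinear_lin_ext v]) (use g in \<open>simp add: lin_single\<close>)
  moreover have "hatv ?w = v"
  proof (rule dlinear_eq[OF dlinear_comp[OF dlinear_lin_ext dlinear_lin_ext] _ v])
    show "dlinear (\<lambda>v :: 'a dvec. v)" by (simp add: dlinear_def)
    fix h assume "h \<in> hat p k ` D"
    from conjunct2[OF g[OF this]] show "hatv (lin_ext (\<lambda>h. single_diagram (g h)) (single_diagram h)) = single_diagram h"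
      by (simp only: lin_ext_single)
  qed
  ultimately show ?thesis by (rule that)
qed

lemma hatv_coef:
  assumes v: "v \<in> lin (diagrams p)" and d: "d \<in> diagrams p"
  shows "coef (hatv v) (hat p k d) = coef v d"
proof -
  have "coef (hatv v) (hat p k d) = (\<Sum>e\<in>Poly_Mapping.keys v. if e = d then coef v d else 0)"
    unfolding lin_ext_def lookup_sum
  proof (rule sum.cong)
    fix e assume "e \<in> Poly_Mapping.keys v"
    then have "e \<in> diagrams p" using v by (auto simp: lin_def)
    then show "coef (dscale (coef v e) (single_diagram (hat p k e))) (hat p k d) = (if e = d then coef v d else 0)"
      using hat_inj[OF pk _ d, of e] by (auto simp: coef_single)
  qed simp
  then show ?thesis by (simp add: in_keys_iff)
qed

lemma hatv_zero_iff:
  assumes "v \<in> lin (diagrams p)"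
  shows "hatv v = 0 \<longleftrightarrow> v = 0"
proof
  assume "hatv v = 0"
  then have "coef v d = 0" for d
    using hatv_coef[OF assms, of d] assms by (cases "d \<in> diagrams p") (auto simp: lin_iff)
  then show "v = 0" by (intro dvec_eqI) simp
qed (simp add: dlinear_zero[OF dlinear_lin_ext])

lemma low_R_diagrams: "lin (low.R r) \<subseteq> lin (diagrams p)"
  by (rule lin_mono) (auto intro: low.BD low.S_B)

lemma hat_R: "hat p k ` low.R r \<subseteq> R r"
  using hat_sym[OF red] rank_hat[OF pk] by auto

lemma hatv_R: "v \<in> lin (low.R r) \<Longrightarrow> hatv v \<in> lin (R r)"
  using hatv_lin lin_mono[OF hat_R] by blast

text \<open>The factor x is the loop between the added halves of the two diagrams; the conjugation
  action counts only the loops of \<open>d\<close> against \<open>t\<close>, so it occurs once. The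
  1/x in \<open>trunc\<close> cancels it.\<close>

lemma conj_hat:
  assumes d: "d \<in> low.B" and t: "t \<in> low.S"
  shows "conj_diagram x k (hat p k d) (hat p k t) = dscale x (hatv (conj_diagram x p d t))"
proof -
  note D = low.BD[OF d] low.BD[OF low.S_B[OF t]]
  note DT = low.BD[OF low.closed[OF d low.S_B[OF t]]]
  have c: "hat p k d \<odot> hat p k t = hat p k (compose_diagram p d t)" by (rule compose_hat[OF pk D])
  have "conjugate k (hat p k d) (hat p k t) = hat p k (conjugate p d t)"
    unfolding conjugate_def c flip_hat[OF pk] by (rule compose_hat[OF pk DT flip_diagrams[OF D(1)]])
  then show ?thesis
    by (simp add: conj_diagram_eq[OF hat_basis[OF red d] hat_sym[OF red t]] low.conj_diagram_eq[OF d t] c rank_hat[OF pk]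
        kappa_hat[OF pk D] dlinear_scale[OF dlinear_lin_ext] dlinear_zero[OF dlinear_lin_ext])
qed

lemma trunc_act:
  assumes a: "a \<in> low.A" and v: "v \<in> lin low.S"
  shows "cact (trunc a) (hatv v) = hatv (low.cact a v)"
proof -
  note lr = dlinear_bilinear_ext
  have 1: "cact (hatv (single_diagram d)) (hatv v) = dscale x (hatv (low.cact (single_diagram d) v))" if d: "d \<in> low.B" for d
  proof (rule dlinear_eq[OF dlinear_comp[OF lr(1) dlinear_lin_ext]
        dlinear_comp[OF dlinear_dscale dlinear_comp[OF dlinear_lin_ext lr(1)]] v])
    fix t assume "t \<in> low.S"
    then show "cact (hatv (single_diagram d)) (hatv (single_diagram t)) =
        dscale x (hatv (low.cact (single_diagram d) (single_diagram t)))"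
      by (simp add: conj_hat[OF d])
  qed
  have "cact (hatv a) (hatv v) = dscale x (hatv (low.cact a v))"
    by (rule dlinear_eq[OF dlinear_comp[OF lr(2) dlinear_lin_ext]
          dlinear_comp[OF dlinear_dscale dlinear_comp[OF dlinear_lin_ext lr(2)]] a[unfolded alg_carrier_def]]) (rule 1)
  then show ?thesis using nonzero by (simp add: trunc_eq[OF a] dlinear_scale[OF lr(2)])
qed

lemma e_trunc:
  assumes a: "a \<in> low.A"
  shows "alg_mult x k (e_idem F x k) (trunc a) = trunc a"
proof -
  have "alg_mult x k (single_diagram (hat p k (id_diagram p))) (hatv a) = dscale x (hatv a)"
  proof (rule dlinear_eq[OF dlinear_comp[OF dlinear_mult(1) dlinear_lin_ext] dlinear_comp[OF dlinear_dscale dlinear_lin_ext] a[unfolded alg_carrier_def]])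
    fix d assume "d \<in> low.B"
    then have d: "d \<in> diagrams p" by (rule low.BD)
    show "alg_mult x k (single_diagram (hat p k (id_diagram p))) (hatv (single_diagram d)) = dscale x (hatv (single_diagram d))"
      by (simp add: mult_single compose_hat[OF pk id_diagrams d] kappa_hat[OF pk id_diagrams d] id_compose[OF d] kappa_id)
  qed
  then show ?thesis
    using nonzero by (simp add: trunc_eq[OF a] e_hat dlinear_scale[OF dlinear_mult(1)] dlinear_scale[OF dlinear_mult(2)])
qed

lemma ends_in_E: "{0} \<times> {p<..k} \<in> cups (hat p k d)"
  by (auto simp: cups_def hat_def)

lemma bottom_end:
  assumes c: "c \<in> B" and top: "{0} \<times> {p<..k} \<in> cups (flip_diagram c)"
  shows "{1} \<times> {p<..k} \<in> c"
proof -
  have fl: "flip ` ({1} \<times> {p<..k}) = {0} \<times> {p<..k}" by (auto simp: image_iff)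
  have "{1} \<times> {p<..k} \<subseteq> verts k" by (auto simp: verts_def)
  from flip_cups_iff[OF BD[OF c] this] show ?thesis using top unfolding fl by simp
qed

text \<open>\<open>E \<circ> (d \<circ> E)\<close> inherits the upper half of \<open>E\<close> from
  the left factor and the lower half from the right one, so both added blocks are present and it is
  the hat of a diagram on p strands.\<close>

lemma corner:
  assumes c: "c \<in> A"
  obtains a where "a \<in> low.A" "alg_mult x k (e_idem F x k) (alg_mult x k c (e_idem F x k)) = trunc a"
proof -
  let ?E = "hat p k (id_diagram p)"
  have E: "?E \<in> B" by (rule hat_basis[OF red id_basis])
  have fE: "flip_diagram ?E = ?E" by (simp add: flip_hat[OF pk] flip_id)
  have in_hat: "?E \<odot> (d \<odot> ?E) \<in> hat p k ` low.B" if d: "d \<in> B" for d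
  proof -
    let ?c = "?E \<odot> (d \<odot> ?E)"
    have cB: "?c \<in> B" using closed[OF E closed[OF d E]] .
    have "cups ?E \<subseteq> cups ?c" using cups_compose[OF BD[OF E] BD[OF closed[OF d E]]] .
    then have top: "{0} \<times> {p<..k} \<in> ?c" using ends_in_E by (auto simp: cups_def)
    have "cups ?E \<subseteq> cups (flip_diagram (d \<odot> ?E))" using flip_cups_compose[OF BD[OF d] BD[OF E]] fE by simp
    also have "\<dots> \<subseteq> cups (flip_diagram ?c)" by (rule flip_cups_compose[OF BD[OF E] BD[OF closed[OF d E]]])
    finally have "{0} \<times> {p<..k} \<in> cups (flip_diagram ?c)" using ends_in_E by (rule subsetD)
    then have "{1} \<times> {p<..k} \<in> ?c" by (rule bottom_end[OF cB])
    from unhat_basis[OF red cB top this] obtain d' where "d' \<in> low.B" "?c = hat p k d'" .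
    then show ?thesis by (simp only: imageI)
  qed
  let ?f = "\<lambda>c. alg_mult x k (single_diagram ?E) (alg_mult x k c (single_diagram ?E))"
  have "?f c \<in> lin (hat p k ` low.B)"
  proof (rule dlinear_lin[OF dlinear_comp[OF dlinear_mult(1) dlinear_mult(2)] c[unfolded alg_carrier_def]])
    fix d assume "d \<in> B"
    then show "?f (single_diagram d) \<in> lin (hat p k ` low.B)"
      using in_hat by (simp add: mult_single dlinear_scale[OF dlinear_mult(1)] lin_dscale lin_single)
  qed
  then obtain w where w: "w \<in> lin low.B" "hatv w = ?f c" by (rule hatv_surj)
  have "alg_mult x k (e_idem F x k) (alg_mult x k c (e_idem F x k)) = dscale (1 / x * (1 / x)) (?f c)"
    by (simp add: e_hat dlinear_scale[OF dlinear_mult(1)] dlinear_scale[OF dlinear_mult(2)])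
  also have "\<dots> = dscale (1 / x) (hatv (dscale (1 / x) w))"
    by (simp add: w(2)[symmetric] dlinear_scale[OF dlinear_lin_ext])
  finally have eq: "alg_mult x k (e_idem F x k) (alg_mult x k c (e_idem F x k)) = dscale (1 / x) (hatv (dscale (1 / x) w))" .
  have "dscale (1 / x) w \<in> low.A" using w(1) by (simp add: alg_carrier_def lin_dscale)
  with eq show ?thesis unfolding trunc_eq[symmetric, OF \<open>dscale (1 / x) w \<in> low.A\<close>] by (intro that)
qed

lemma e_fix: "v \<in> lin (low.R r) \<Longrightarrow> cact (e_idem F x k) (hatv v) = hatv v"
proof -
  assume v: "v \<in> lin (low.R r)"
  then have "v \<in> lin low.S" using lin_mono[of "low.R r" low.S] by blast
  then show ?thesis using trunc_act[OF low.one_A] low.cact_one by (simp add: trunc_one)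
qed

text \<open>Conjugation by \<open>E\<close> puts the upper half of \<open>E\<close> among the cups
  of the result, and symmetry supplies the lower half. So each diagram that survives is a hat of a
  symmetric diagram.\<close>

lemma e_image:
  assumes v: "v \<in> lin (R r)"
  shows "cact (e_idem F x k) v \<in> lin (hat p k ` low.R r)"
proof -
  let ?E = "hat p k (id_diagram p)"
  have E: "?E \<in> B" by (rule hat_basis[OF red id_basis])
  have "cact (single_diagram ?E) v \<in> lin (hat p k ` low.R r)"
  proof (rule dlinear_lin[OF dlinear_bilinear_ext(1) v])
    fix t assume "t \<in> R r"
    then have t: "t \<in> S" "diagram_rank t = r" by auto
    let ?c = "conjugate k ?E t"
    have cS: "?c \<in> S" by (rule conj_S[OF E t(1)])
    have "cups ?E \<subseteq> cups ?c" using cups_compose[OF BD[OF E] BD[OF S_B[OF t(1)]]] cups_conj[OF E t(1)] by simp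
    then have top: "{0} \<times> {p<..k} \<in> cups ?c" using ends_in_E by blast
    have bot: "{1} \<times> {p<..k} \<in> ?c"
      using top by (intro bottom_end[OF S_B[OF cS]]) (simp only: S_flip[OF cS])
    have "{0} \<times> {p<..k} \<in> ?c" using top by (simp add: cups_def)
    from unhat_basis[OF red S_B[OF cS] this bot] obtain d where d: "d \<in> low.B" "?c = hat p k d" .
    have "d \<in> low.S" using cS hat_sym_iff[OF red d(1)] d(2) by simp
    moreover have "diagram_rank d = r" if "diagram_rank (?E \<odot> t) = diagram_rank t"
      using that rank_conj[OF E t(1)] rank_hat[OF pk, of d] d(2) t(2) by simp
    ultimately show "cact (single_diagram ?E) (single_diagram t) \<in> lin (hat p k ` low.R r)"
      using d(2) by (simp add: conj_diagram_eq[OF E t(1)] lin_zero lin_dscale lin_single)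
  qed
  then show ?thesis by (simp add: e_hat dlinear_scale[OF dlinear_bilinear_ext(2)] lin_dscale)
qed

lemma truncate_eq:
  "truncate_rep F x k (conj_rep_rank F x k r) =
    \<lparr>rep_space = hatv ` lin (low.R r), scl = dscale, act = (\<lambda>a. cact (trunc a))\<rparr>"
proof -
  have "cact (e_idem F x k) ` lin (R r) = hatv ` lin (low.R r)"
  proof
    show "cact (e_idem F x k) ` lin (R r) \<subseteq> hatv ` lin (low.R r)"
    proof (rule image_subsetI)
      fix v :: "'a dvec" assume "v \<in> lin (R r)"
      from e_image[OF this] obtain w where w: "w \<in> lin (low.R r)" "hatv w = cact (e_idem F x k) v" by (rule hatv_surj)
      show "cact (e_idem F x k) v \<in> hatv ` lin (low.R r)" 
        unfolding w(2)[symmetric] by (rule imageI[OF w(1)])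
    qed
    show "hatv ` lin (low.R r) \<subseteq> cact (e_idem F x k) ` lin (R r)"
    proof (rule image_subsetI)
      fix v :: "'a dvec" assume v: "v \<in> lin (low.R r)"
      show "hatv v \<in> cact (e_idem F x k) ` lin (R r)"
        using imageI[OF hatv_R[OF v], of "cact (e_idem F x k)"] by (simp only: e_fix[OF v])
    qed
  qed
  then show ?thesis by (simp add: truncate_rep_def conj_rep_rank_eq trunc_def[abs_def])
qed

lemma hatv_inj: "inj_on hatv (lin (low.R r))"
proof (rule inj_onI)
  fix v w assume v: "v \<in> lin (low.R r)" and w: "w \<in> lin (low.R r)" and eq: "hatv v = hatv w"
  have D: "v \<in> lin (diagrams p)" "w \<in> lin (diagrams p)" using v w low_R_diagrams by blast+
  have "coef v d = coef w d" for d
  proof (cases "d \<in> diagrams p")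
    case True
    show ?thesis using hatv_coef[OF D(1) True] hatv_coef[OF D(2) True] eq by simp
  qed (use D in \<open>simp add: lin_iff\<close>)
  then show "v = w" by (rule dvec_eqI)
qed

lemma truncate_iso:
  "alg_isomorphic F p (truncate_rep F x k (conj_rep_rank F x k r)) (conj_rep_rank F x p r)"
  unfolding alg_isomorphic_def truncate_eq low.conj_rep_rank_eq rep.simps
proof (intro exI conjI ballI allI)
  let ?L = "lin (low.R r)"
  let ?g = "the_inv_into ?L hatv"
  have g: "?g (hatv v) = v" if "v \<in> ?L" for v by (rule the_inv_into_f_f[OF hatv_inj that])
  show "bij_betw ?g (hatv ` ?L) ?L"
    by (rule bij_betw_the_inv_into) (simp add: bij_betw_def hatv_inj)
  fix v' assume "v' \<in> hatv ` ?L"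
  then obtain v where v: "v \<in> ?L" "v' = hatv v" by blast
  show "?g (dscale c v') = dscale c (?g v')" for c
    using g[OF lin_dscale[OF v(1)], of c] by (simp add: v(2) g[OF v(1)] dlinear_scale[OF dlinear_lin_ext])
  show "?g (cact (trunc a) v') = low.cact a (?g v')" if a: "a \<in> low.A" for a
  proof -
    have "v \<in> lin low.S" using v(1) lin_mono[of "low.R r" low.S] by blast
    moreover have "low.cact a v \<in> ?L" using low.cact_lin[OF a v(1)] by auto
    ultimately show ?thesis using g by (simp add: v g[OF v(1)] trunc_act[OF a])
  qed
  fix w' assume "w' \<in> hatv ` ?L"
  then obtain w where w: "w \<in> ?L" "w' = hatv w" by blast
  show "?g (v' + w') = ?g v' + ?g w'"
    using g[OF lin_add[OF v(1) w(1)]] by (simp add: v(2) w(2) g[OF v(1)] g[OF w(1)] dlinear_add[OF dlinear_lin_ext])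
qed

end

section \<open>Reconstructing irreducible modules from their corners\<close>

section \<open>Irreducible modules\<close>

context diagram_monoid
begin

lemma irreducible_cyclic:
  assumes irr: "alg_irreducible F x k M" and m: "m \<in> rep_space M" "m \<noteq> 0" and v: "v \<in> rep_space M"
  obtains a where "a \<in> A" "act M a m = v"
proof -
  interpret alg_mod F x k M by (rule irreducible_module[OF irr])
  let ?U = "(\<lambda>a. act M a m) ` A"
  have "alg_submodule F k M ?U"
    unfolding alg_submodule_def
  proof (intro conjI ballI)
    show "?U \<subseteq> rep_space M" using act_in m(1) by blast
    show "vs.subspace ?U"
      unfolding vs.subspace_def
    proof (intro conjI ballI allI)
      show "0 \<in> ?U" using zero_act[OF m(1)] lin_zero unfolding alg_carrier_def by (metis image_eqI)
      show "u + w \<in> ?U" if uw: "u \<in> ?U" "w \<in> ?U" for u w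
      proof -
        obtain a b where "a \<in> A" "b \<in> A" "u = act M a m" "w = act M b m" using uw by blast
        then show ?thesis using add_act[OF _ _ m(1)] A_add by (metis image_eqI)
      qed
      show "scl M c u \<in> ?U" if u: "u \<in> ?U" for c u
      proof -
        obtain a where "a \<in> A" "u = act M a m" using u by blast
        then show ?thesis using scl_act[OF _ m(1)] A_dscale by (metis image_eqI)
      qed
    qed
    show "act M a u \<in> ?U" if au: "a \<in> A" "u \<in> ?U" for a u
    proof -
      obtain b where b: "b \<in> A" "u = act M b m" using au(2) by blast
      have "act M a u = act M (alg_mult x k a b) m" unfolding b(2) by (rule mult_act[OF au(1) b(1) m(1), symmetric])
      then show ?thesis using A_mult[OF au(1) b(1)] by (rule image_eqI)
    qed
  qed
  then have "?U = {0} \<or> ?U = rep_space M" using irr unfolding alg_irreducible_def by blast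
  moreover have "m \<in> ?U" using one_act[OF m(1)] one_A by (metis image_eqI)
  ultimately have "v \<in> ?U" using m(2) v by blast
  then show ?thesis using that by blast
qed

text \<open>If \<open>c\<close> kills \<open>m\<close> but not \<open>v\<close>, then some \<open>e b c e\<close> kills \<open>m\<close> and fixes \<open>v\<close>.\<close>

lemma kill_transfer:
  fixes M :: "('a, 'm::ab_group_add) rep" and V :: "('a, 'n::ab_group_add) rep"
  assumes M: "alg_irreducible F x k M" and V: "alg_irreducible F x k V"
    and e: "e \<in> A" and m: "m \<in> rep_space M" "act M e m = m" and v: "v \<in> rep_space V" "act V e v = v" "v \<noteq> 0"
    and corner: "\<And>c. c \<in> A \<Longrightarrow> act M (alg_mult x k e (alg_mult x k c e)) m = 0 \<Longrightarrow>
      act V (alg_mult x k e (alg_mult x k c e)) v = 0"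
    and c: "c \<in> A" "act M c m = 0"
  shows "act V c v = 0"
proof (rule ccontr)
  interpret M: alg_mod F x k M by (rule irreducible_module[OF M])
  interpret V: alg_mod F x k V by (rule irreducible_module[OF V])
  assume "act V c v \<noteq> 0"
  then obtain b where b: "b \<in> A" "act V b (act V c v) = v"
    using irreducible_cyclic[OF V V.act_in[OF c(1) v(1)] _ v(1)] by blast
  have bc: "alg_mult x k b c \<in> A" by (rule A_mult[OF b(1) c(1)])
  have "act M (alg_mult x k e (alg_mult x k (alg_mult x k b c) e)) m = 0"
    using M.mult_act[OF e A_mult[OF bc e] m(1)] M.mult_act[OF bc e m(1)] M.mult_act[OF b(1) c(1) m(1)] m(2) c(2)
      M.act_zero[OF b(1)] M.act_zero[OF e] by simp
  then have "act V (alg_mult x k e (alg_mult x k (alg_mult x k b c) e)) v = 0" by (rule corner[OF bc])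
  moreover have "act V (alg_mult x k e (alg_mult x k (alg_mult x k b c) e)) v = v"
    using V.mult_act[OF e A_mult[OF bc e] v(1)] V.mult_act[OF bc e v(1)] V.mult_act[OF b(1) c(1) v(1)] v(2) b(2) by simp
  ultimately show False using v(3) by simp
qed

text \<open>Applying the preceding lemma in both directions shows that \<open>m\<close> and
  \<open>v\<close> have the same annihilator. As each generates its module, am \<mapsto> av is a
  well-defined isomorphism.\<close>

lemma corner_iso:
  fixes M :: "('a, 'm::ab_group_add) rep" and V :: "('a, 'n::ab_group_add) rep"
  assumes M: "alg_irreducible F x k M" and V: "alg_irreducible F x k V"
    and e: "e \<in> A" and m: "m \<in> rep_space M" "act M e m = m" "m \<noteq> 0" and v: "v \<in> rep_space V" "act V e v = v" "v \<noteq> 0"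
    and corner: "\<And>c. c \<in> A \<Longrightarrow> act M (alg_mult x k e (alg_mult x k c e)) m = 0 \<longleftrightarrow>
      act V (alg_mult x k e (alg_mult x k c e)) v = 0"
  shows "alg_isomorphic F k M V"
proof -
  interpret M: alg_mod F x k M by (rule irreducible_module[OF M])
  interpret V: alg_mod F x k V by (rule irreducible_module[OF V])
  have zero: "act M c m = 0 \<longleftrightarrow> act V c v = 0" if c: "c \<in> A" for c
    using kill_transfer[OF M V e m(1,2) v _ c] kill_transfer[OF V M e v(1,2) m _ c] corner by blast
  have eq: "act M a m = act M b m \<longleftrightarrow> act V a v = act V b v" if ab: "a \<in> A" "b \<in> A" for a b
  proof -
    have b': "dscale (- 1) b \<in> A" by (rule A_dscale[OF ab(2)])
    have "act M (a + dscale (- 1) b) m = act M a m - act M b m"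
      using M.add_act[OF ab(1) b' m(1)] M.scl_act[OF ab(2) m(1), of "- 1"] by simp
    moreover have "act V (a + dscale (- 1) b) v = act V a v - act V b v"
      using V.add_act[OF ab(1) b' v(1)] V.scl_act[OF ab(2) v(1), of "- 1"] by simp
    ultimately show ?thesis using zero[OF A_add[OF ab(1) b']] by simp
  qed
  \<comment> \<open>Chooses a representative \<open>a\<close> with am = w; equality of annihilators
    makes the resulting vector av independent of the choice.\<close>
  define g where "g w = (SOME a. a \<in> A \<and> act M a m = w)" for w
  have g: "g w \<in> A" "act M (g w) m = w" if w: "w \<in> rep_space M" for w
  proof -
    have "\<exists>a. a \<in> A \<and> act M a m = w" using irreducible_cyclic[OF M m(1,3) w] by blast
    from someI_ex[OF this] show "g w \<in> A" "act M (g w) m = w" unfolding g_def by blast+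
  qed
  let ?f = "\<lambda>w. act V (g w) v"
  have f: "?f (act M a m) = act V a v" if a: "a \<in> A" for a
    using eq[OF g(1)[OF M.act_in[OF a m(1)]] a] g(2)[OF M.act_in[OF a m(1)]] by simp
  show ?thesis
    unfolding alg_isomorphic_def
  proof (intro exI conjI ballI allI)
    show "bij_betw ?f (rep_space M) (rep_space V)"
      unfolding bij_betw_def
    proof
      show "inj_on ?f (rep_space M)"
      proof (rule inj_onI)
        fix u w assume uw: "u \<in> rep_space M" "w \<in> rep_space M" "?f u = ?f w"
        then have "act M (g u) m = act M (g w) m" using eq[OF g(1)[OF uw(1)] g(1)[OF uw(2)]] by simp
        then show "u = w" using g(2) uw by simp
      qed
      show "?f ` rep_space M = rep_space V"
      proof
        show "?f ` rep_space M \<subseteq> rep_space V" using V.act_in[OF g(1) v(1)] by blast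
        show "rep_space V \<subseteq> ?f ` rep_space M"
        proof
          fix z assume "z \<in> rep_space V"
          from irreducible_cyclic[OF V v(1,3) this] obtain a where a: "a \<in> A" "act V a v = z" .
          have "z = ?f (act M a m)" using f[OF a(1)] a(2) by simp
          then show "z \<in> ?f ` rep_space M" using M.act_in[OF a(1) m(1)] by (rule image_eqI)
        qed
      qed
    qed
    fix u assume u: "u \<in> rep_space M"
    show "?f (scl M c u) = scl V c (?f u)" for c
      using f[OF A_dscale[OF g(1)[OF u]], of c] M.scl_act[OF g(1)[OF u] m(1), of c] V.scl_act[OF g(1)[OF u] v(1), of c] g(2)[OF u]
      by simp
    show "?f (act M a u) = act V a (?f u)" if a: "a \<in> A" for a
      using f[OF A_mult[OF a g(1)[OF u]]] M.mult_act[OF a g(1)[OF u] m(1)] V.mult_act[OF a g(1)[OF u] v(1)] g(2)[OF u]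
      by simp
    fix w assume w: "w \<in> rep_space M"
    show "?f (u + w) = ?f u + ?f w"
      using f[OF A_add[OF g(1)[OF u] g(1)[OF w]]] M.add_act[OF g(1)[OF u] g(1)[OF w] m(1)]
        V.add_act[OF g(1)[OF u] g(1)[OF w] v(1)] g(2)[OF u] g(2)[OF w]
      by simp
  qed
qed

text \<open>The identity is the only basis diagram of rank k, so every other term of
  \<open>a\<close> acts as 0.\<close>

lemma top_act:
  assumes "alg_mod F x k V" and low: "\<forall>d\<in>B. diagram_rank d < k \<longrightarrow> (\<forall>v\<in>rep_space V. act V (single_diagram d) v = 0)"
    and a: "a \<in> A" and v: "v \<in> rep_space V"
  shows "act V a v = scl V (coef a (id_diagram k)) v"
proof -
  interpret alg_mod F x k V by fact
  have one: "act V (single_diagram (id_diagram k)) v = v" using one_act[OF v] by (simp add: alg_one_def)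
  have "scl V (coef a d) (act V (single_diagram d) v) = (if d = id_diagram k then scl V (coef a (id_diagram k)) v else 0)"
    if "d \<in> Poly_Mapping.keys a" for d
  proof (cases "d = id_diagram k")
    case False
    have d: "d \<in> B" using a that by (auto simp: alg_carrier_def lin_def)
    then have "diagram_rank d < k" using rank_le[OF basis_slim[OF d]] rank_full[OF d] False by linarith
    then show ?thesis using low d v False by simp
  qed (simp add: one)
  then have "act V a v = (\<Sum>d\<in>Poly_Mapping.keys a. if d = id_diagram k then scl V (coef a (id_diagram k)) v else 0)"
    unfolding act_expand[OF a v] by (rule sum.cong[OF refl])
  then show ?thesis by (simp add: in_keys_iff)
qed

lemma R_top: "R k = {id_diagram k}"
  using rank_full[OF S_B] id_sym rank_id by auto

lemma top_space: "rep_space (conj_rep_rank F x k k) = range (\<lambda>c. scl (conj_rep_rank F x k k) c (single_diagram (id_diagram k)))"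
  unfolding conj_rep_rank_eq R_top using lin_singleton lin_dscale[OF lin_single] by (auto simp: image_iff) blast

lemma top_low: "\<forall>d\<in>B. diagram_rank d < k \<longrightarrow> (\<forall>v\<in>rep_space (conj_rep_rank F x k k). act (conj_rep_rank F x k k) (single_diagram d) v = 0)"
proof (intro ballI impI)
  fix d v assume d: "d \<in> B" "diagram_rank d < k" and "v \<in> rep_space (conj_rep_rank F x k k)"
  then have v: "v \<in> lin {id_diagram k}" by (simp add: conj_rep_rank_eq R_top)
  have "diagram_rank (d \<odot> id_diagram k) \<noteq> diagram_rank (id_diagram k)"
    using rank_comp_le(1)[OF d(1) id_basis] d(2) by (simp add: rank_id)
  then have "conj_diagram x k d (id_diagram k) = 0" by (simp add: conj_diagram_eq[OF d(1) id_sym])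
  moreover obtain c where "v = dscale c (single_diagram (id_diagram k))" using lin_singleton[OF v] by blast
  ultimately show "act (conj_rep_rank F x k k) (single_diagram d) v = 0"
    by (simp add: conj_rep_rank_eq dlinear_scale[OF dlinear_bilinear_ext(1)])
qed

lemma top_iso:
  fixes V :: "('a, 'n::ab_group_add) rep"
  assumes V: "alg_module F x k V" and v: "v \<noteq> 0" "rep_space V = range (\<lambda>c. scl V c v)"
    and low: "\<forall>d\<in>B. diagram_rank d < k \<longrightarrow> (\<forall>v\<in>rep_space V. act V (single_diagram d) v = 0)"
  shows "alg_isomorphic F k (conj_rep_rank F x k k) V"
proof -
  let ?M = "conj_rep_rank F x k k"
  let ?i = "id_diagram k"
  interpret V: alg_mod F x k V using V by (simp add: alg_mod_def)
  have M: "alg_mod F x k ?M" using rank_module by (simp add: alg_mod_def)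
  let ?f = "\<lambda>w. scl V (coef w ?i) v"
  have space: "rep_space ?M = lin {?i}" by (simp add: conj_rep_rank_eq R_top)
  have in_V: "scl V c v \<in> rep_space V" for c unfolding v(2) by (rule rangeI)
  show ?thesis
    unfolding alg_isomorphic_def
  proof (intro exI conjI ballI allI)
    show "bij_betw ?f (rep_space ?M) (rep_space V)"
      unfolding bij_betw_def
    proof
      show "inj_on ?f (rep_space ?M)"
      proof (rule inj_onI)
        fix u w assume "u \<in> rep_space ?M" "w \<in> rep_space ?M" and eq: "?f u = ?f w"
        then have uw: "u \<in> lin {?i}" "w \<in> lin {?i}" unfolding space by simp_all
        have "coef u ?i = coef w ?i" using eq v(1) by simp
        then show "u = w" using lin_singleton[OF uw(1)] lin_singleton[OF uw(2)] by metis
      qed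
      show "?f ` rep_space ?M = rep_space V"
      proof
        show "?f ` rep_space ?M \<subseteq> rep_space V" using in_V by blast
        show "rep_space V \<subseteq> ?f ` rep_space ?M"
        proof
          fix z assume "z \<in> rep_space V"
          then obtain c where "z = scl V c v" unfolding v(2) by blast
          then have "z = ?f (dscale c (single_diagram ?i))" by (simp add: coef_single)
          moreover have "dscale c (single_diagram ?i) \<in> rep_space ?M" unfolding space by (simp add: lin_dscale lin_single)
          ultimately show "z \<in> ?f ` rep_space ?M" by (rule image_eqI)
        qed
      qed
    qed
    fix u assume u: "u \<in> rep_space ?M"
    show "?f (scl ?M c u) = scl V c (?f u)" for c by (simp add: conj_rep_rank_eq)
    show "?f (act ?M a u) = act V a (?f u)" if a: "a \<in> A" for a
      unfolding top_act[OF M top_low a u] top_act[OF V.alg_mod_axioms low a in_V] by (simp add: conj_rep_rank_eq)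
    show "?f (u + w) = ?f u + ?f w" for w by (simp add: lookup_add V.vs.scale_left_distrib)
  qed
qed

end

text \<open>Irreducibility on k strands yields an element that carries the hat of \<open>u\<close>
  to the hat of any given \<open>v\<close>. Cutting it down to the corner gives an element on p
  strands that carries \<open>u\<close> to \<open>v\<close>, so a nonzero submodule is
  everything.\<close>

lemma (in diagram_truncation) irreducible_lower:
  assumes irr: "alg_irreducible F x k (conj_rep_rank F x k r)" and ok: "label_ok F p r"
  shows "alg_irreducible F x p (conj_rep_rank F x p r)"
  unfolding alg_irreducible_def
proof (intro conjI allI impI)
  let ?L = "lin (low.R r)"
  show "alg_module F x p (conj_rep_rank F x p r)" by (rule low.rank_module)
  obtain t where "t \<in> low.R r" using sym_exists[OF ok] by auto
  then have "single_diagram t \<in> ?L" by (rule lin_single)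
  then show "rep_space (conj_rep_rank F x p r) \<noteq> {0}"
    unfolding low.conj_rep_rank_eq using single_nonzero[of t, where 'a = 'a] by auto
  fix U assume "alg_submodule F p (conj_rep_rank F x p r) U"
  then have U: "U \<subseteq> ?L" "module.subspace dscale U" "\<And>a u. a \<in> low.A \<Longrightarrow> u \<in> U \<Longrightarrow> low.cact a u \<in> U"
    unfolding alg_submodule_def low.conj_rep_rank_eq by auto
  have LS: "?L \<subseteq> lin low.S" and RS: "lin (R r) \<subseteq> lin S" by (rule lin_mono, blast)+
  show "U = {0} \<or> U = rep_space (conj_rep_rank F x p r)"
  proof (cases "U \<subseteq> {0}")
    case True
    then show ?thesis using dvec.subspace_0[OF U(2)] by blast
  next
    case False
    then obtain u where u: "u \<in> U" "u \<noteq> 0" by blast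
    then have uL: "u \<in> ?L" using U(1) by blast
    have nz: "hatv u \<noteq> 0" using hatv_zero_iff uL low_R_diagrams u(2) by blast
    have "v \<in> U" if v: "v \<in> ?L" for v
    proof -
      have sp: "rep_space (conj_rep_rank F x k r) = lin (R r)" "act (conj_rep_rank F x k r) = cact"
        by (simp_all add: conj_rep_rank_eq)
      obtain c where c: "c \<in> A" "cact c (hatv u) = hatv v"
        using irreducible_cyclic[OF irr _ nz] hatv_R[OF uL] hatv_R[OF v] unfolding sp by blast
      \<comment> \<open>Since e fixes both hats, \<open>c\<close> may be replaced by e c e without
        changing its effect on \<open>hatv u\<close>, and e c e comes from p strands.\<close>
      obtain a where a: "a \<in> low.A" "alg_mult x k (e_idem F x k) (alg_mult x k c (e_idem F x k)) = trunc a"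
        using corner[OF c(1)] .
      have hu: "hatv u \<in> lin S" using hatv_R[OF uL] RS by blast
      have "hatv (low.cact a u) = cact (trunc a) (hatv u)" using trunc_act[OF a(1) subsetD[OF LS uL]] by simp
      also have "\<dots> = cact (e_idem F x k) (cact c (cact (e_idem F x k) (hatv u)))"
        unfolding a(2)[symmetric]
        using cact_mult[OF e_A A_mult[OF c(1) e_A] hu] cact_mult[OF c(1) e_A hu] by simp
      also have "\<dots> = hatv v" using e_fix[OF uL] e_fix[OF v] c(2) by simp
      finally have "low.cact a u = v"
        using inj_onD[OF hatv_inj _ _ v] low.cact_lin[OF a(1) uL] by auto
      then show ?thesis using U(3)[OF a(1) u(1)] by simp
    qed
    then show ?thesis using U(1) unfolding low.conj_rep_rank_eq by auto
  qed
qed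

text \<open>Induction on k along the recursion for labels. Irreducibility is a premise of the
  induction because it is inherited downwards from the given k.\<close>

lemma conj_rep_is_simple:
  assumes "diagram_monoid F x k" "label_ok F k r" "alg_irreducible F x k (conj_rep_rank F x k r)"
  shows "is_simple F x k r (conj_rep_rank F x k r)"
  using assms
proof (induction k rule: less_induct)
  case (less k)
  interpret diagram_monoid F x k by (rule less.prems(1))
  show ?case
  proof (cases "r = k")
    case True
    show ?thesis unfolding True
      using is_simple.top[OF rank_module _ top_low] top_space single_nonzero by blast
  next
    case False
    then have "r < k" using less.prems(2) by (simp add: label_ok_def)
    note lower = label_reducible[OF less.prems(2) this]
    interpret diagram_truncation F x k by unfold_locales (rule lower(1))
    have "is_simple F x p r (conj_rep_rank F x p r)"
      using less.IH[OF pk low.diagram_monoid_axioms lower(2) irreducible_lower[OF less.prems(3) lower(2)]] .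
    then show ?thesis using is_simple.step[OF \<open>r < k\<close> less.prems(2,3) _ truncate_iso] by blast
  qed
qed

text \<open>Induction over the derivation of the label. On fewer strands both corners are isomorphic
  to \<open>W\<close>, so corresponding nonzero vectors have the same annihilator in the corner, and
  \<open>corner_iso\<close> extends this to the full modules.\<close>

lemma is_simple_unique:
  assumes "is_simple F x k r V" "diagram_monoid F x k" "alg_irreducible F x k (conj_rep_rank F x k r)"
  shows "alg_isomorphic F k (conj_rep_rank F x k r) V"
  using assms
proof (induction rule: is_simple.induct)
  case (top k V)
  interpret diagram_monoid F x k by (rule top.prems(1))
  show ?case using top_iso[OF top.hyps(1) _ _ top.hyps(3)] top.hyps(2) by blast
next
  case (step r k V W)
  interpret diagram_monoid F x k by (rule step.prems(1))
  note lower = label_reducible[OF step.hyps(2,1)]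
  interpret diagram_truncation F x k by unfold_locales (rule lower(1))
  let ?L = "lin (low.R r)"
  let ?e = "e_idem F x k"
  interpret V: alg_mod F x k V by (rule irreducible_module[OF step.hyps(3)])
  have irr: "alg_irreducible F x p (conj_rep_rank F x p r)" by (rule irreducible_lower[OF step.prems(2) lower(2)])
  have "alg_isomorphic F p (conj_rep_rank F x p r) W" by (rule step.IH[OF low.diagram_monoid_axioms irr])
  then obtain f where f: "bij_betw f ?L (rep_space W)" "\<And>u w. u \<in> ?L \<Longrightarrow> w \<in> ?L \<Longrightarrow> f (u + w) = f u + f w"
    "\<And>a u. a \<in> low.A \<Longrightarrow> u \<in> ?L \<Longrightarrow> f (low.cact a u) = act W a (f u)"
    unfolding alg_isomorphic_def low.conj_rep_rank_eq by auto
  let ?T = "act V ?e ` rep_space V"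
  obtain g where hom: "bij_betw g ?T (rep_space W) \<and> (\<forall>u\<in>?T. \<forall>w\<in>?T. g (u + w) = g u + g w) \<and>
      (\<forall>c. \<forall>u\<in>?T. g (scl V c u) = scl W c (g u)) \<and>
      (\<forall>a\<in>low.A. \<forall>u\<in>?T. g (act V (trunc a) u) = act W a (g u))"
    using step.hyps(5) unfolding alg_isomorphic_def truncate_rep_def trunc_def rep.simps by (elim exE)
  then have g: "bij_betw g ?T (rep_space W)" "\<And>u w. u \<in> ?T \<Longrightarrow> w \<in> ?T \<Longrightarrow> g (u + w) = g u + g w"
    "\<And>a u. a \<in> low.A \<Longrightarrow> u \<in> ?T \<Longrightarrow> g (act V (trunc a) u) = act W a (g u)"
    by blast+
  have f0: "f u = 0 \<longleftrightarrow> u = 0" if u: "u \<in> ?L" for u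
  proof -
    have "f 0 = 0" using f(2)[OF lin_zero lin_zero] by simp
    then show ?thesis using inj_onD[OF bij_betw_imp_inj_on[OF f(1)] _ u lin_zero] by metis
  qed
  have T0: "0 \<in> ?T" using V.act_zero[OF e_A] V.zero_in by (metis image_eqI)
  have g0: "g u = 0 \<longleftrightarrow> u = 0" if u: "u \<in> ?T" for u
  proof -
    have "g 0 = 0" using g(2)[OF T0 T0] by simp
    then show ?thesis using inj_onD[OF bij_betw_imp_inj_on[OF g(1)] _ u T0] by metis
  qed
  obtain t where t: "t \<in> low.R r" using sym_exists[OF lower(2)] by auto
  define s :: "'a dvec" where "s = single_diagram t"
  have s: "s \<in> ?L" "s \<noteq> 0" unfolding s_def by (rule lin_single[OF t], rule single_nonzero)
  \<comment> \<open>The partner \<open>v\<close> of \<open>hatv s\<close> in \<open>e V\<close> is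
    found through \<open>W\<close>: it is the preimage under \<open>g\<close> of the image of
    \<open>s\<close> under \<open>f\<close>.\<close>
  have "f s \<in> rep_space W" using bij_betwE[OF f(1)] s(1) by (rule bspec)
  then have "f s \<in> g ` ?T" unfolding bij_betw_imp_surj_on[OF g(1)] .
  then obtain v where v: "v \<in> ?T" "g v = f s" by (metis imageE)
  have "v \<noteq> 0" using v f0[OF s(1)] g0[OF v(1)] s(2) by simp
  obtain v' where v': "v' \<in> rep_space V" "v = act V ?e v'" using v(1) by blast
  have vV: "v \<in> rep_space V" unfolding v'(2) by (rule V.act_in[OF e_A v'(1)])
  have ee: "alg_mult x k ?e ?e = ?e" using e_trunc[OF low.one_A] by (simp only: trunc_one)
  have ev: "act V ?e v = v" using V.mult_act[OF e_A e_A v'(1)] unfolding ee v'(2) by simp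
  \<comment> \<open>Elements of the corner act compatibly with \<open>f\<close> and
    \<open>g\<close>, and both maps send only 0 to 0. So vanishing can be tested in
    \<open>W\<close>, where the two vectors have the same image.\<close>
  have trunc0: "cact (trunc a) (hatv s) = 0 \<longleftrightarrow> act V (trunc a) v = 0" if a: "a \<in> low.A" for a
  proof -
    have as: "low.cact a s \<in> ?L" using low.cact_lin[OF a s(1)] by auto
    have sS: "s \<in> lin low.S" using s(1) lin_mono[of "low.R r" low.S] by blast
    have aV: "act V (trunc a) v \<in> rep_space V" by (rule V.act_in[OF trunc_A[OF a] vV])
    have "act V (trunc a) v = act V ?e (act V (trunc a) v)"
      using V.mult_act[OF e_A trunc_A[OF a] vV] unfolding e_trunc[OF a] .
    then have aT: "act V (trunc a) v \<in> ?T" using aV by (rule image_eqI)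
    have "cact (trunc a) (hatv s) = 0 \<longleftrightarrow> low.cact a s = 0"
      unfolding trunc_act[OF a sS] using hatv_zero_iff as low_R_diagrams by blast
    also have "\<dots> \<longleftrightarrow> g (act V (trunc a) v) = 0"
      using f0[OF as] f(3)[OF a s(1)] g(3)[OF a v(1)] v(2) by simp
    also have "\<dots> \<longleftrightarrow> act V (trunc a) v = 0" by (rule g0[OF aT])
    finally show ?thesis .
  qed
  have sp: "rep_space (conj_rep_rank F x k r) = lin (R r)" "act (conj_rep_rank F x k r) = cact"
    by (simp_all add: conj_rep_rank_eq)
  have nz: "hatv s \<noteq> 0" using hatv_zero_iff s low_R_diagrams by blast
  show ?case
  proof (rule corner_iso[OF step.prems(2) step.hyps(3) e_A _ _ nz vV ev \<open>v \<noteq> 0\<close>])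
    show "hatv s \<in> rep_space (conj_rep_rank F x k r)" unfolding sp by (rule hatv_R[OF s(1)])
    show "act (conj_rep_rank F x k r) ?e (hatv s) = hatv s" unfolding sp by (rule e_fix[OF s(1)])
    fix c assume "c \<in> A"
    then obtain a where a: "a \<in> low.A" "alg_mult x k ?e (alg_mult x k c ?e) = trunc a" by (rule corner)
    show "act (conj_rep_rank F x k r) (alg_mult x k ?e (alg_mult x k c ?e)) (hatv s) = 0 \<longleftrightarrow>
        act V (alg_mult x k ?e (alg_mult x k c ?e)) v = 0"
      unfolding sp a(2) by (rule trunc0[OF a(1)])
  qed
qed

lemma sym_space_trivial:
  assumes "r \<le> k" "\<not> label_ok F k r"
  shows "sym_space F k r = {0}"
proof -
  have "F = TL" "r mod 2 \<noteq> k mod 2" using assms by (auto simp: label_ok_def)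
  then have none: "{t \<in> sym_diagrams F k. diagram_rank t = r} = {}"
    using rank_parity by (auto simp: sym_diagrams_def)
  have "v = 0" if "v \<in> lin {}" for v :: "'a dvec"
    using that by (intro dvec_eqI) (simp add: lin_iff)
  then show ?thesis unfolding sym_space_def none using lin_zero by blast
qed

text \<open>Labels are given by a recursion on arbitrary modules. Identifying the label of the
  conjugation module therefore has two parts: the module satisfies the recursion, and every module
  satisfying it is isomorphic to this one.\<close>

theorem corollary3p34:
  fixes F :: planar_family and x :: "'a::alg_closed_field" and k :: nat
  assumes "x \<noteq> 0"
    and "F = Planar_Rook \<Longrightarrow> x = 1"
    and "alg_semisimple F x k"
  shows "(\<forall>r. label_ok F k r \<longrightarrow>
            alg_irreducible F x k (conj_rep_rank F x k r) \<and>
            is_simple F x k r (conj_rep_rank F x k r) \<and>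
            (\<forall>V :: ('a, 'v::ab_group_add) rep.
               is_simple F x k r V \<longrightarrow> alg_isomorphic F k (conj_rep_rank F x k r) V)) \<and>
         alg_module F x k (conj_rep F x k) \<and>
         alg_direct_sum F k (conj_rep F x k) {0..k} (sym_space F k) \<and>
         (\<forall>r\<le>k. \<not> label_ok F k r \<longrightarrow> (sym_space F k r :: 'a dvec set) = {0})"
proof -
  have dm: "diagram_monoid F x k" by (rule semisimple_diagram_monoid[OF assms(1,3)])
  interpret diagram_monoid F x k by (rule dm)
  have irr: "alg_irreducible F x k (conj_rep_rank F x k r)" if "label_ok F k r" for r
    by (rule semisimple_irreducible[OF assms(3) that])
  show ?thesis
    using irr conj_rep_is_simple[OF dm _ irr] is_simple_unique[OF _ dm irr] conj_rep_module conj_direct_sum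
      sym_space_trivial by blast
qed

end
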